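(* Let $m,n\ge 1$ be integers, let $\Omega\subset\mathbb{R}^n$ be an open set, and let $L\subset M^{m\times n}$ be a linear subspace without rank-$1$ connections. Suppose $u:\Omega\to\mathbb{R}^m$ is differentiable at every point of $\Omega$ and that $Du(x)\in L$ for every $x\in\Omega$. Then $u$ is real analytic in $\Omega$.
   Context: $M^{m\times n}$ denotes the space of real $m\times n$ matrices. A subset $L\subset M^{m\times n}$ is said to have no rank-$1$ connections (to be without rank-$1$ connections) if there are no $A,B\in L$ with $\mathrm{rank}(A-B)=1$; for a linear subspace this means that $L$ contains no matrix of rank $1$. $Du(x)\in M^{m\times n}$ denotes the (Fréchet) derivative of $u$ at $x$, i.e. the matrix with entries $\partial u_i/\partial x_j(x)$; no continuity or integrability of $Du$ is assumed. *)

theory Defs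
  imports "HOL-Analysis.Analysis"
begin

definition no_rank1_connections :: "(real ^ 'n ^ 'm) set \<Rightarrow> bool" where
  "no_rank1_connections L \<longleftrightarrow> \<not> (\<exists>A\<in>L. \<exists>B\<in>L. rank (A - B) = 1)"

(* Multi-indices are functions \<alpha> :: 'n \<Rightarrow> nat on the finite coordinate type 'n. *)
definition multi_power :: "real ^ 'n \<Rightarrow> ('n \<Rightarrow> nat) \<Rightarrow> real" where
  "multi_power x \<alpha> = (\<Prod>j\<in>UNIV. (x $ j) ^ \<alpha> j)"

(* Near each point of S, f is the sum of a power series in several variables. Convergence is
   that of has_sum, i.e. unconditional, which in finite dimension means absolute.
   Used for open S, where requiring a full ball around each point is no restriction. *)
definition real_analytic_on :: "(real ^ 'n \<Rightarrow> real ^ 'm) \<Rightarrow> (real ^ 'n) set \<Rightarrow> bool" where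
  "real_analytic_on f S \<longleftrightarrow>
     (\<forall>a\<in>S. \<exists>r>0. \<exists>c :: ('n \<Rightarrow> nat) \<Rightarrow> real ^ 'm.
        \<forall>x\<in>ball a r. ((\<lambda>\<alpha>. multi_power (x - a) \<alpha> *\<^sub>R c \<alpha>) has_sum f x) UNIV)"

end

theory Submission
  imports Defs
begin

text \<open>Absence of rank-one matrices in \<open>L\<close> says that the constant coefficient system \<open>Du \<in> L\<close> is elliptic.
  Goursat's subdivision argument gives the divergence theorem for everywhere differentiable fields whose
  divergence is continuous, so \<open>u\<close> solves the system weakly although \<open>Du\<close> need not be integrable.
  After rescaling, \<open>u\<close> is defined near the cube \<open>[-\<pi>, \<pi>]\<^sup>n\<close>. It is multiplied by a cut-off \<open>\<phi>\<close>
  depending on \<open>N\<close> whose derivatives of order \<open>m \<le> N\<close> are at most \<open>(C N)\<^sup>m\<close>. Inserting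
  \<open>\<phi> cos (k \<bullet> y + \<theta>)\<close> into the weak equation trades one factor \<open>\<bar>k\<bar>\<close> for one derivative of \<open>\<phi>\<close>,
  by ellipticity. Hence the Fourier coefficients of \<open>\<phi> u\<close> are at most a constant times
  \<open>(C N / \<bar>k\<bar>)\<^sup>m\<close>. Choosing \<open>N\<close> close to the order of a Taylor coefficient of \<open>u\<close> bounds that
  coefficient geometrically, since \<open>N\<^sup>N / N!\<close> grows only geometrically.\<close>

section \<open>Divergence theorem without integrable derivatives\<close>

text \<open>Since \<open>Du\<close> need not be integrable, integration by parts cannot go through
  Fubini or a mollification of \<open>Du\<close>. What helps is a cancellation: for a constant
  matrix l orthogonal to L, the field \<eta> l^T u has divergence grad \<eta> . l^T u, because the
  term with \<open>Du\<close> drops out pointwise. The rest is continuous, which is all that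
  Goursat's argument asks for, and afterwards only values of u are estimated. A fixed smooth cut-off
  would not do. A nonzero function of compact support is not analytic, so its derivatives outgrow
  every (C m)^m and the method would give smoothness only. Hence the cut-off has just N controlled
  derivatives, and all constants must be independent of N. Changing N changes the Fourier
  coefficients, but not u on the smaller cube where the cut-off is 1. Fourier series on a torus,
  rather than the transform on the whole space, keep all integrals on one cube. The decay estimate
  uses real cosines with a free phase, so that differentiation stays inside the family.\<close>

definition set_coord :: "'n \<Rightarrow> real \<Rightarrow> real ^ 'n \<Rightarrow> real ^ 'n" where
  "set_coord j t x = (\<chi> i. if i = j then t else x $ i)"

lemma set_coord_nth [simp]: "set_coord j t x $ i = (if i = j then t else x $ i)"
  by (simp add: set_coord_def)

lemma set_coord_idem [simp]: "set_coord j s (set_coord j t x) = set_coord j s x"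
  by (simp add: vec_eq_iff)

lemma continuous_on_set_coord [continuous_intros]:
  "continuous_on S (set_coord j t)"
  unfolding set_coord_def
proof (rule continuous_on_vec_lambda)
  show "continuous_on S (\<lambda>x. if i = j then t else x $ i)" for i
    by (cases "i = j") (auto intro!: continuous_intros)
qed

lemma cbox_split_set_coord:
  fixes a b :: "real ^ 'n"
  assumes "a $ i \<le> m" "m \<le> b $ i"
  shows "cbox a b \<inter> {x. x \<bullet> axis i 1 \<le> m} = cbox a (set_coord i m b)" (is ?A)
    and "cbox a b \<inter> {x. x \<bullet> axis i 1 \<ge> m} = cbox (set_coord i m a) b" (is ?B)
proof -
  have m: "x $ j \<le> b $ j" if "x $ j \<le> (if j = i then m else b $ j)" for x j
    using that assms(2) by (cases "j = i") auto
  show ?A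
  proof (intro subset_antisym subsetI)
    fix x assume "x \<in> cbox a (set_coord i m b)"
    then have h: "a $ j \<le> x $ j" "x $ j \<le> (if j = i then m else b $ j)" for j by (auto simp: mem_box_cart)
    show "x \<in> cbox a b \<inter> {x. x \<bullet> axis i 1 \<le> m}"
      using h(1) m[OF h(2)] h(2)[of i] by (simp add: mem_box_cart inner_axis)
  qed (auto simp: mem_box_cart inner_axis)
  have m: "a $ j \<le> x $ j" if "(if j = i then m else a $ j) \<le> x $ j" for x j
    using that assms(1) by (cases "j = i") auto
  show ?B
  proof (intro subset_antisym subsetI)
    fix x assume "x \<in> cbox (set_coord i m a) b"
    then have h: "(if j = i then m else a $ j) \<le> x $ j" "x $ j \<le> b $ j" for j by (auto simp: mem_box_cart)
    show "x \<in> cbox a b \<inter> {x. x \<bullet> axis i 1 \<ge> m}"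
      using h(2) m[OF h(1)] h(1)[of i] by (simp add: mem_box_cart inner_axis)
  qed (auto simp: mem_box_cart inner_axis)
qed

lemma integral_split_set_coord:
  fixes f :: "real ^ 'n \<Rightarrow> real"
  assumes "f integrable_on cbox a b" "a $ i \<le> m" "m \<le> b $ i"
  shows "integral (cbox a b) f = integral (cbox a (set_coord i m b)) f + integral (cbox (set_coord i m a) b) f"
  using integral_split[OF assms(1), of "axis i 1" m] cbox_split_set_coord[OF assms(2,3)]
  by (simp add: axis_in_Basis_iff)

text \<open>The two halves are translates of each other along axis i, and \<open>indep\<close> makes
  g invariant under this translation. So the two integrals agree, and they add up to the
  whole.\<close>

lemma integral_half_indep:
  fixes g :: "real ^ 'n \<Rightarrow> real"
  assumes cont: "continuous_on (cbox a b) g"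
    and indep: "\<And>x t. g (set_coord i t x) = g x"
    and le: "a $ i \<le> b $ i" and m: "m = (a $ i + b $ i) / 2"
  shows "integral (cbox a (set_coord i m b)) g = integral (cbox a b) g / 2"
    and "integral (cbox (set_coord i m a) b) g = integral (cbox a b) g / 2"
proof -
  define c where "c = axis i (m - a $ i)"
  have am: "a $ i \<le> m" "m \<le> b $ i" using le m by auto
  have int: "g integrable_on cbox a b" by (rule integrable_continuous[OF cont])
  have sub2: "cbox (set_coord i m a) b \<subseteq> cbox a b"
    using cbox_split_set_coord(2)[OF am] by blast
  have int2: "g integrable_on cbox (set_coord i m a) b"
    using integrable_on_subcbox[OF int sub2] .
  have "((\<lambda>x. g (1 *\<^sub>R x + c)) has_integral (integral (cbox (set_coord i m a) b) g /\<^sub>R 1 ^ DIM(real^'n)))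
      (cbox ((set_coord i m a - c) /\<^sub>R 1) ((b - c) /\<^sub>R 1))"
    by (rule has_integral_affinity') (use int2 integrable_integral in auto)
  moreover have "set_coord i m a - c = a" "b - c = set_coord i m b"
    using m by (auto simp: vec_eq_iff c_def axis_def field_simps)
  moreover have "g (x + c) = g x" for x
  proof -
    have "set_coord i (x $ i) (x + c) = x" by (auto simp: vec_eq_iff c_def axis_def)
    then show ?thesis using indep[of "x $ i" "x + c"] by simp
  qed
  ultimately have "(g has_integral (integral (cbox (set_coord i m a) b) g)) (cbox a (set_coord i m b))"
    by simp
  then have "integral (cbox a (set_coord i m b)) g = integral (cbox (set_coord i m a) b) g"
    by (rule integral_unique)
  with integral_split_set_coord[OF int am]
  show "integral (cbox a (set_coord i m b)) g = integral (cbox a b) g / 2"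
    and "integral (cbox (set_coord i m a) b) g = integral (cbox a b) g / 2" by auto
qed

text \<open>The integral over the two faces orthogonal to axis \<open>j\<close> is written as an integral over
  the whole box by adding a dummy variable and dividing by the length of the edge.\<close>
definition face_flux :: "'n \<Rightarrow> (real ^ 'n \<Rightarrow> real) \<Rightarrow> real ^ 'n \<Rightarrow> real ^ 'n \<Rightarrow> real" where
  "face_flux j f a b =
     integral (cbox a b) (\<lambda>x. f (set_coord j (b $ j) x) - f (set_coord j (a $ j) x)) / (b $ j - a $ j)"

lemma set_coord_mem_cbox:
  "x \<in> cbox a b \<Longrightarrow> a $ j \<le> t \<Longrightarrow> t \<le> b $ j \<Longrightarrow> set_coord j t x \<in> cbox a b"
  by (auto simp: mem_box_cart)

lemma continuous_on_compose_set_coord: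
  fixes f :: "real ^ 'n \<Rightarrow> real"
  assumes "continuous_on (cbox a b) f" "a $ j \<le> t" "t \<le> b $ j"
  shows "continuous_on (cbox a b) (\<lambda>x. f (set_coord j t x))"
  by (rule continuous_on_compose2[OF assms(1)])
     (use assms set_coord_mem_cbox in \<open>auto intro!: continuous_intros\<close>)

text \<open>For j different from i only the domain of integration is split. For j = i the integrand
  does not depend on coordinate i, so bisection halves the integral together with the edge length
  and their quotient survives; the contributions of the middle face then cancel.\<close>

lemma face_flux_split:
  fixes f :: "real ^ 'n \<Rightarrow> real"
  assumes cont: "continuous_on (cbox a b) f"
    and lt: "\<And>i. a $ i < b $ i" and m: "m = (a $ i + b $ i) / 2"
  shows "face_flux j f a b = face_flux j f a (set_coord i m b) + face_flux j f (set_coord i m a) b"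
proof (cases "j = i")
  case False
  let ?g = "\<lambda>x. f (set_coord j (b $ j) x) - f (set_coord j (a $ j) x)"
  have "continuous_on (cbox a b) ?g"
    by (intro continuous_on_diff continuous_on_compose_set_coord cont) (auto intro: less_imp_le lt)
  then have "?g integrable_on cbox a b" by (rule integrable_continuous)
  from integral_split_set_coord[OF this, of i m] show ?thesis
    unfolding face_flux_def using False lt[of i] m
    by (simp add: add_divide_distrib)
next
  case True
  let ?f = "\<lambda>t x. f (set_coord i t x)"
  have am: "a $ i < m" "m < b $ i" using lt[of i] m by auto
  have c: "continuous_on (cbox a b) (?f t)" if "a $ i \<le> t" "t \<le> b $ i" for t
    using continuous_on_compose_set_coord[OF cont that] .
  let ?I = "\<lambda>s t. integral (cbox a b) (\<lambda>x. ?f t x - ?f s x)"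
  have I: "?I s t = integral (cbox a b) (?f t) - integral (cbox a b) (?f s)"
    if "a $ i \<le> t" "t \<le> b $ i" "a $ i \<le> s" "s \<le> b $ i" for s t
    by (intro integral_diff integrable_continuous c that)
  have h: "integral (cbox a (set_coord i m b)) (\<lambda>x. ?f t x - ?f s x) = ?I s t / 2"
    "integral (cbox (set_coord i m a) b) (\<lambda>x. ?f t x - ?f s x) = ?I s t / 2"
    if "a $ i \<le> t" "t \<le> b $ i" "a $ i \<le> s" "s \<le> b $ i" for s t
    by (intro integral_half_indep continuous_on_diff c that less_imp_le lt m; simp)+
  have d: "m - a $ i = (b $ i - a $ i) / 2" "b $ i - m = (b $ i - a $ i) / 2" using m by (auto simp: field_simps)
  have "face_flux i f a (set_coord i m b) = ?I (a $ i) m / (b $ i - a $ i)"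
    unfolding face_flux_def using am by (simp add: d(1) h(1)[of m "a $ i"])
  moreover have "face_flux i f (set_coord i m a) b = ?I m (b $ i) / (b $ i - a $ i)"
    unfolding face_flux_def using am by (simp add: d(2) h(2)[of "b $ i" m])
  moreover have "?I (a $ i) (b $ i) = ?I (a $ i) m + ?I m (b $ i)"
    using I am by simp
  ultimately show ?thesis
    unfolding True by (simp add: face_flux_def add_divide_distrib)
qed

section \<open>Goursat's bisection argument\<close>

lemma split_cube_step:
  fixes \<mu> :: "real ^ 'n \<Rightarrow> real ^ 'n \<Rightarrow> real"
  assumes split: "\<And>a b i m. (\<And>i. a $ i < b $ i) \<Longrightarrow> cbox a b \<subseteq> K \<Longrightarrow> m = (a $ i + b $ i) / 2 \<Longrightarrow>
       \<mu> a b = \<mu> a (set_coord i m b) + \<mu> (set_coord i m a) b"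
    and big: "\<bar>\<mu> a b\<bar> > e * measure lborel (cbox a b)" and lt: "\<And>i. a $ i < b $ i"
    and sub: "cbox a b \<subseteq> K"
  shows "\<exists>c d. \<bar>\<mu> c d\<bar> > e * measure lborel (cbox c d) \<and> cbox c d \<subseteq> cbox a b \<and>
      (\<forall>i. d $ i - c $ i = (b $ i - a $ i) / 2)"
proof -
  \<comment> \<open>Directions are bisected one at a time, S being the set of those already treated.
    Both \<mu> and the volume are additive, so one of the two halves keeps the inequality. The
    intermediate boxes have other proportions than the original one, which is why
    \<open>split\<close> speaks of all boxes and not only of cubes.\<close>
  have "\<exists>c d. \<bar>\<mu> c d\<bar> > e * measure lborel (cbox c d) \<and> cbox c d \<subseteq> cbox a b \<and>
      (\<forall>i\<in>S. d $ i - c $ i = (b $ i - a $ i) / 2) \<and> (\<forall>i. i \<notin> S \<longrightarrow> d $ i - c $ i = b $ i - a $ i)" 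
    if "finite S" for S
    using that
  proof induction
    case empty
    show ?case using big by (intro exI[of _ a] exI[of _ b]) auto
  next
    case (insert i S)
    then obtain c d where cd: "\<bar>\<mu> c d\<bar> > e * measure lborel (cbox c d)" "cbox c d \<subseteq> cbox a b"
      "\<And>i. i \<in> S \<Longrightarrow> d $ i - c $ i = (b $ i - a $ i) / 2" "\<And>i. i \<notin> S \<Longrightarrow> d $ i - c $ i = b $ i - a $ i"
      by blast
    have lt': "c $ j < d $ j" for j
      using cd(3)[of j] cd(4)[of j] lt[of j] by (cases "j \<in> S") auto
    define m where "m = (c $ i + d $ i) / 2"
    have m: "c $ i \<le> m" "m \<le> d $ i" using lt'[of i] by (auto simp: m_def)
    note \<mu> = split[OF lt' order_trans[OF cd(2) sub] m_def]
    have "measure lborel (cbox c d) = measure lborel (cbox c (set_coord i m d)) + measure lborel (cbox (set_coord i m c) d)"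
      using integral_split_set_coord[OF integrable_const[of "1::real" c d] m] by simp
    then have "e * measure lborel (cbox c d) = e * measure lborel (cbox c (set_coord i m d)) + e * measure lborel (cbox (set_coord i m c) d)"
      by (simp add: distrib_left)
    with cd(1) \<mu> consider
       "\<bar>\<mu> c (set_coord i m d)\<bar> > e * measure lborel (cbox c (set_coord i m d))"
      | "\<bar>\<mu> (set_coord i m c) d\<bar> > e * measure lborel (cbox (set_coord i m c) d)" by linarith
    then show ?case
    proof cases
      case 1
      have "cbox c (set_coord i m d) \<subseteq> cbox c d" using cbox_split_set_coord(1)[OF m] by blast
      moreover have "set_coord i m d $ j - c $ j = (if j \<in> insert i S then (b $ j - a $ j) / 2 else b $ j - a $ j)" for j
        using cd(3)[of j] cd(4)[of j] insert.hyps by (auto simp: m_def field_simps)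
      ultimately show ?thesis using 1 cd(2)
        by (intro exI[of _ c] exI[of _ "set_coord i m d"]) (auto simp del: set_coord_nth)
    next
      case 2
      have "cbox (set_coord i m c) d \<subseteq> cbox c d" using cbox_split_set_coord(2)[OF m] by blast
      moreover have "d $ j - set_coord i m c $ j = (if j \<in> insert i S then (b $ j - a $ j) / 2 else b $ j - a $ j)" for j
        using cd(3)[of j] cd(4)[of j] insert.hyps by (auto simp: m_def field_simps)
      ultimately show ?thesis using 2 cd(2)
        by (intro exI[of _ "set_coord i m c"] exI[of _ d]) (auto simp del: set_coord_nth)
    qed
  qed
  from this[OF finite_class.finite_UNIV] show ?thesis by simp
qed

text \<open>If \<mu> did not vanish, repeated halving would keep its absolute value above a fixed
  multiple of the volume on nested cubes, contradicting \<open>small\<close> at their common point.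
  \<open>small\<close> is restricted to cubes because on flat boxes the linearisation error in
  \<open>divergence_cube\<close> is not controlled by the volume.\<close>

lemma goursat_cube:
  fixes \<mu> :: "real ^ 'n \<Rightarrow> real ^ 'n \<Rightarrow> real"
  assumes split: "\<And>a b i m. (\<And>i. a $ i < b $ i) \<Longrightarrow> cbox a b \<subseteq> cbox a0 b0 \<Longrightarrow> m = (a $ i + b $ i) / 2 \<Longrightarrow>
       \<mu> a b = \<mu> a (set_coord i m b) + \<mu> (set_coord i m a) b"
    and small: "\<And>x e. x \<in> cbox a0 b0 \<Longrightarrow> e > 0 \<Longrightarrow> \<exists>d>0. \<forall>a b h. 0 < h \<and> h < d \<and> (\<forall>i. b $ i - a $ i = h) \<and> 
        x \<in> cbox a b \<and> cbox a b \<subseteq> cbox a0 b0 \<longrightarrow> \<bar>\<mu> a b\<bar> \<le> e * measure lborel (cbox a b)"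
    and cube: "\<And>i. b0 $ i - a0 $ i = h0" and h0: "h0 > 0"
  shows "\<mu> a0 b0 = 0"
proof (rule ccontr)
  assume nz: "\<mu> a0 b0 \<noteq> 0"
  have lt0: "a0 $ i < b0 $ i" for i using cube[of i] h0 by linarith
  have cpos: "measure lborel (cbox a0 b0) > 0"
    using lt0 by (auto simp: content_cbox_if_cart interval_ne_empty_cart less_imp_le intro!: prod_pos)
  \<comment> \<open>Half of the initial ratio, so that the starting cube satisfies the strict
    inequality.\<close>
  define e where "e = \<bar>\<mu> a0 b0\<bar> / (2 * measure lborel (cbox a0 b0))"
  have e: "e > 0" using nz cpos by (simp add: e_def)
  have e1: "e * measure lborel (cbox a0 b0) < \<bar>\<mu> a0 b0\<bar>" using nz cpos by (simp add: e_def)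
  let ?P = "\<lambda>n (q :: (real^'n) \<times> (real^'n)). \<bar>\<mu> (fst q) (snd q)\<bar> > e * measure lborel (cbox (fst q) (snd q)) \<and>
      cbox (fst q) (snd q) \<subseteq> cbox a0 b0 \<and> (\<forall>i. snd q $ i - fst q $ i = h0 / 2 ^ n)"
  obtain q where q: "\<And>n. ?P n (q n)" 
    "\<And>n. cbox (fst (q (Suc n))) (snd (q (Suc n))) \<subseteq> cbox (fst (q n)) (snd (q n))"
  proof -
    have "\<exists>q. \<forall>n. ?P n (q n) \<and> cbox (fst (q (Suc n))) (snd (q (Suc n))) \<subseteq> cbox (fst (q n)) (snd (q n))"
    proof (rule dependent_nat_choice)
      show "\<exists>q. ?P 0 q" using e1 cube by (intro exI[of _ "(a0, b0)"]) auto
    next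
      fix q n assume q: "?P n q"
      have lt: "fst q $ i < snd q $ i" for i
      proof -
        have "snd q $ i - fst q $ i > 0" using q h0 by simp
        then show ?thesis by simp
      qed
      obtain c d where cd: "e * measure lborel (cbox c d) < \<bar>\<mu> c d\<bar>" "cbox c d \<subseteq> cbox (fst q) (snd q)"
       "\<And>i. d $ i - c $ i = (snd q $ i - fst q $ i) / 2"
        using split_cube_step[of "cbox a0 b0" \<mu> e "fst q" "snd q", OF split] q lt by blast
      then show "\<exists>q'. ?P (Suc n) q' \<and> cbox (fst q') (snd q') \<subseteq> cbox (fst q) (snd q)"
        using q by (intro exI[of _ "(c,d)"]) auto
    qed
    then show ?thesis using that by blast
  qed
  have dec: "cbox (fst (q n)) (snd (q n)) \<subseteq> cbox (fst (q m)) (snd (q m))" if "m \<le> n" for m n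
    using that by (induction rule: dec_induct) (use q(2) in auto)
  have ne: "cbox (fst (q n)) (snd (q n)) \<noteq> {}" for n
  proof -
    have "fst (q n) $ i \<le> snd (q n) $ i" for i
    proof -
      have "snd (q n) $ i - fst (q n) $ i = h0 / 2 ^ n" using q(1)[of n] by blast
      moreover have "h0 / 2 ^ n \<ge> 0" using h0 by simp
      ultimately show ?thesis by linarith
    qed
    then show ?thesis by (simp add: interval_ne_empty_cart)
  qed
  have "(\<Inter>n. cbox (fst (q n)) (snd (q n))) \<noteq> {}"
    by (rule compact_nest) (use ne dec in auto)
  then obtain x where x: "\<And>n. x \<in> cbox (fst (q n)) (snd (q n))" by blast
  then have "x \<in> cbox a0 b0" using q(1) by blast
  from small[OF this e] obtain d where d: "d > 0" 
    "\<And>a b h. 0 < h \<Longrightarrow> h < d \<Longrightarrow> (\<forall>i. b $ i - a $ i = h) \<Longrightarrow>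
        x \<in> cbox a b \<Longrightarrow> cbox a b \<subseteq> cbox a0 b0 \<Longrightarrow> \<bar>\<mu> a b\<bar> \<le> e * measure lborel (cbox a b)" by blast
  have "(\<lambda>n. h0 * (1/2) ^ n) \<longlonglongrightarrow> h0 * 0"
    by (intro tendsto_mult tendsto_const LIMSEQ_power_zero) simp
  then have "\<forall>\<^sub>F n in sequentially. h0 * (1/2) ^ n < d"
    using d(1) by (simp add: order_tendstoD(2))
  then obtain n where n: "h0 / 2 ^ n < d" by (auto simp: eventually_sequentially power_divide)
  have "\<bar>\<mu> (fst (q n)) (snd (q n))\<bar> \<le> e * measure lborel (cbox (fst (q n)) (snd (q n)))"
    by (rule d(2)[of "h0 / 2 ^ n"]) (use n h0 x q(1)[of n] in auto)
  then show False using q(1)[of n] by linarith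
qed

lemma integral_near_const:
  fixes f :: "'a::euclidean_space \<Rightarrow> real"
  assumes "continuous_on (cbox a b) f" and "\<And>y. y \<in> cbox a b \<Longrightarrow> \<bar>f y - C\<bar> \<le> B" and "0 \<le> B"
  shows "\<bar>integral (cbox a b) f - C * measure lborel (cbox a b)\<bar> \<le> B * measure lborel (cbox a b)"
proof -
  have i: "f integrable_on cbox a b" using assms(1) by (rule integrable_continuous)
  have "((\<lambda>y. f y - C) has_integral (integral (cbox a b) f - measure lborel (cbox a b) *\<^sub>R C)) (cbox a b)"
    by (intro has_integral_diff integrable_integral i has_integral_const)
  then show ?thesis
    using has_integral_bound[of B "\<lambda>y. f y - C"] assms by (simp add: mult.commute)
qed

text \<open>Flux minus integral is additive under bisection. On a cube of edge h near x the linear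
  part of f has flux exactly trace times volume, while the error o(h) in f, divided by the edge h,
  contributes o(volume). Continuity is asked of the trace g alone, and this is what
  \<open>weak_identity\<close> can supply.\<close>

lemma divergence_cube:
  fixes f :: "real ^ 'n \<Rightarrow> real ^ 'n" and D :: "real ^ 'n \<Rightarrow> real ^ 'n ^ 'n"
  assumes der: "\<And>x. x \<in> cbox a b \<Longrightarrow> (f has_derivative (\<lambda>h. D x *v h)) (at x)"
    and cont: "continuous_on (cbox a b) g" and g: "\<And>x. x \<in> cbox a b \<Longrightarrow> g x = (\<Sum>j\<in>UNIV. D x $ j $ j)"
    and cube: "\<And>i. b $ i - a $ i = h" and "h > 0"
  shows "(\<Sum>j\<in>UNIV. face_flux j (\<lambda>x. f x $ j) a b) = integral (cbox a b) g"
proof -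
  let ?n = "real CARD('n)"
  have n: "?n \<ge> 1" by (simp add: Suc_leI)
  define \<mu> where "\<mu> a b = (\<Sum>j\<in>UNIV. face_flux j (\<lambda>x. f x $ j) a b) - integral (cbox a b) g" for a b
  have fc: "continuous_on (cbox a b) f"
    by (intro continuous_at_imp_continuous_on ballI has_derivative_continuous[OF der])
  have fcj: "continuous_on (cbox a b) (\<lambda>x. f x $ j)" for j
    by (intro continuous_intros fc)
  have "\<mu> a b = 0"
  proof (rule goursat_cube[OF _ _ cube \<open>h > 0\<close>])
    fix c d :: "real ^ 'n" and i m
    assume lt: "\<And>i. c $ i < d $ i" and sub: "cbox c d \<subseteq> cbox a b" and m: "m = (c $ i + d $ i) / 2"
    have "face_flux j (\<lambda>x. f x $ j) c d = face_flux j (\<lambda>x. f x $ j) c (set_coord i m d) + face_flux j (\<lambda>x. f x $ j) (set_coord i m c) d" for j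
      by (rule face_flux_split[OF continuous_on_subset[OF fcj sub] lt m])
    moreover have "integral (cbox c d) g = integral (cbox c (set_coord i m d)) g + integral (cbox (set_coord i m c) d) g"
      by (rule integral_split_set_coord)
         (use lt[of i] m continuous_on_subset[OF cont sub] in \<open>auto intro!: integrable_continuous\<close>)
    ultimately show "\<mu> c d = \<mu> c (set_coord i m d) + \<mu> (set_coord i m c) d"
      by (simp add: \<mu>_def sum.distrib)
  next
    fix x and e :: real
    assume x: "x \<in> cbox a b" and e: "e > 0"
    \<comment> \<open>Each of the n directions has an error of 2 e' n times the volume, in total e /
      2; the oscillation of g takes the other e / 2. One factor n stems from bounding the norm by
      the sum of the coordinates.\<close>
    define e' where "e' = e / (4 * ?n * ?n)"
    have e': "e' > 0" using e n by (simp add: e'_def)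
    obtain d1 where d1: "d1 > 0" "\<And>y. norm (y - x) < d1 \<Longrightarrow> norm (f y - f x - D x *v (y - x)) \<le> e' * norm (y - x)"
      using der[OF x] e' unfolding has_derivative_at_alt by blast
    obtain d2 where d2: "d2 > 0" "\<And>y. y \<in> cbox a b \<Longrightarrow> dist y x < d2 \<Longrightarrow> dist (g y) (g x) < e / 2"
      using cont x e unfolding continuous_on_iff by (meson half_gt_zero)
    \<comment> \<open>Points of a cube of edge s that contains x are at distance at most n s from x,
      and s < d keeps this below d1 and d2.\<close>
    define d where "d = min d1 d2 / ?n"
    have d: "d > 0" using d1(1) d2(1) n by (simp add: d_def)
    have "\<bar>\<mu> p q\<bar> \<le> e * measure lborel (cbox p q)"
      if s: "0 < s" "s < d" "\<And>i. q $ i - p $ i = s" "x \<in> cbox p q" "cbox p q \<subseteq> cbox a b" for p q s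
    proof -
      let ?c = "measure lborel (cbox p q)"
      have c0: "?c \<ge> 0" by simp
      have qp: "p $ i \<le> q $ i" for i using s(3)[of i] s(1) by linarith
      have nrm: "norm (y - x) \<le> ?n * s" if "y \<in> cbox p q" for y
      proof -
        have "\<bar>(y - x) $ i\<bar> \<le> s" for i
          using that s(4) s(3)[of i] unfolding mem_box_cart by (smt (verit) vector_minus_component)
        then have "(\<Sum>i\<in>UNIV. \<bar>(y - x) $ i\<bar>) \<le> (\<Sum>i\<in>(UNIV::'n set). s)" by (rule sum_mono)
        then show ?thesis using norm_le_l1_cart[of "y - x"] by simp
      qed
      have nd: "?n * s < min d1 d2" using s(2) n by (simp add: d_def field_simps)
      have sm: "norm (f y - f x - D x *v (y - x)) \<le> e' * (?n * s)" if "y \<in> cbox p q" for y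
        using d1(2)[of y] nrm[OF that] nd e' by (smt (verit) mult_left_mono)
      have F: "\<bar>face_flux j (\<lambda>x. f x $ j) p q - D x $ j $ j * ?c\<bar> \<le> 2 * e' * ?n * ?c" for j
      proof -
        let ?F = "\<lambda>y. f (set_coord j (q $ j) y) $ j - f (set_coord j (p $ j) y) $ j"
        have "\<bar>?F y - D x $ j $ j * s\<bar> \<le> 2 * e' * ?n * s" if y: "y \<in> cbox p q" for y
        proof -
          let ?y1 = "set_coord j (q $ j) y" and ?y2 = "set_coord j (p $ j) y"
          have m: "?y1 \<in> cbox p q" "?y2 \<in> cbox p q" by (auto intro!: set_coord_mem_cbox y qp)
          have "?y1 - ?y2 = s *\<^sub>R axis j 1" using s(3) by (auto simp: vec_eq_iff axis_def)
          then have "D x *v (?y1 - x) - D x *v (?y2 - x) = s *\<^sub>R column j (D x)"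
            by (metis (no_types) add_diff_eq diff_add_cancel matrix_vector_mult_diff_distrib matrix_vector_mult_scaleR matrix_vector_mult_basis diff_diff_eq2 diff_diff_add)
          then have "(D x *v (?y1 - x)) $ j - (D x *v (?y2 - x)) $ j = s * D x $ j $ j"
            by (metis column_def vec_lambda_beta vector_minus_component vector_scaleR_component real_scaleR_def)
          moreover have "\<bar>(f ?y1 - f x - D x *v (?y1 - x)) $ j\<bar> \<le> e' * (?n * s)"
            using sm[OF m(1)] component_le_norm_cart order_trans by blast
          moreover have "\<bar>(f ?y2 - f x - D x *v (?y2 - x)) $ j\<bar> \<le> e' * (?n * s)"
            using sm[OF m(2)] component_le_norm_cart order_trans by blast
          ultimately show ?thesis by (simp add: algebra_simps)
        qed
        moreover have "continuous_on (cbox p q) ?F"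
          by (intro continuous_on_diff continuous_on_compose_set_coord continuous_on_subset[OF fcj s(5)] qp order_refl)
        ultimately have "\<bar>integral (cbox p q) ?F - D x $ j $ j * s * ?c\<bar> \<le> 2 * e' * ?n * s * ?c"
          using e' s(1) n by (intro integral_near_const) auto
        then have "\<bar>integral (cbox p q) ?F - D x $ j $ j * s * ?c\<bar> / s \<le> 2 * e' * ?n * ?c"
          using s(1) by (simp add: field_simps)
        moreover have "\<bar>integral (cbox p q) ?F - D x $ j $ j * s * ?c\<bar> / s = \<bar>integral (cbox p q) ?F / s - D x $ j $ j * ?c\<bar>"
          using s(1) by (simp add: field_simps flip: abs_div_pos)
        ultimately show ?thesis by (simp add: face_flux_def s(3))
      qed
      have "\<bar>(\<Sum>j\<in>UNIV. face_flux j (\<lambda>x. f x $ j) p q) - g x * ?c\<bar> 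
          = \<bar>\<Sum>j\<in>UNIV. (face_flux j (\<lambda>x. f x $ j) p q - D x $ j $ j * ?c)\<bar>"
        by (simp add: g[OF x] sum_subtractf sum_distrib_right)
      also have "\<dots> \<le> (\<Sum>j\<in>(UNIV::'n set). 2 * e' * ?n * ?c)"
        by (rule order_trans[OF sum_abs]) (intro sum_mono F)
      also have "\<dots> = e / 2 * ?c" using n by (simp add: e'_def field_simps)
      finally have 1: "\<bar>(\<Sum>j\<in>UNIV. face_flux j (\<lambda>x. f x $ j) p q) - g x * ?c\<bar> \<le> e / 2 * ?c" .
      have "\<bar>integral (cbox p q) g - g x * ?c\<bar> \<le> e / 2 * ?c"
      proof (rule integral_near_const)
        show "continuous_on (cbox p q) g" by (rule continuous_on_subset[OF cont s(5)])
        show "\<bar>g y - g x\<bar> \<le> e / 2" if "y \<in> cbox p q" for y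
          using d2(2)[of y] s(5) that nrm[OF that] nd by (auto simp: dist_norm)
      qed (use e in simp)
      with 1 show ?thesis unfolding \<mu>_def by linarith
    qed
    with d show "\<exists>d>0. \<forall>p q s. 0 < s \<and> s < d \<and> (\<forall>i. q $ i - p $ i = s) \<and> 
        x \<in> cbox p q \<and> cbox p q \<subseteq> cbox a b \<longrightarrow> \<bar>\<mu> p q\<bar> \<le> e * measure lborel (cbox p q)"
      by blast
  qed
  then show ?thesis by (simp add: \<mu>_def)
qed

section \<open>Weak form of the system, and integrals of characters\<close>

lemma face_flux_eq_0:
  assumes "\<And>x. x \<in> cbox a b \<Longrightarrow> f (set_coord j (b $ j) x) = f (set_coord j (a $ j) x)"
  shows "face_flux j f a b = 0"
proof -
  have "integral (cbox a b) (\<lambda>x. f (set_coord j (b $ j) x) - f (set_coord j (a $ j) x)) = integral (cbox a b) (\<lambda>x. 0)"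
    by (rule integral_cong) (simp add: assms)
  then show ?thesis by (simp add: face_flux_def)
qed

text \<open>\<open>divergence_cube\<close> is applied to \<eta> l^T v. The product rule gives grad
  \<eta> . l^T v plus \<eta> times l . D, and \<open>orth\<close> removes the second term, so the
  divergence is continuous however irregular D is. There is no flux through the faces because \<eta>
  vanishes on them.\<close>

lemma weak_identity:
  fixes v :: "real ^ 'n \<Rightarrow> real ^ 'm" and D :: "real ^ 'n \<Rightarrow> real ^ 'n ^ 'm"
    and \<eta> :: "real ^ 'n \<Rightarrow> real" and X :: "real ^ 'n \<Rightarrow> real ^ 'n"
  assumes der: "\<And>x. x \<in> cbox a b \<Longrightarrow> (v has_derivative (\<lambda>h. D x *v h)) (at x)"
    and orth: "\<And>x. x \<in> cbox a b \<Longrightarrow> l \<bullet> D x = 0"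
    and \<eta>: "\<And>x. (\<eta> has_derivative (\<lambda>h. X x \<bullet> h)) (at x)" and X: "continuous_on (cbox a b) X"
    and van: "\<And>x j. x \<in> cbox a b \<Longrightarrow> x $ j = a $ j \<or> x $ j = b $ j \<Longrightarrow> \<eta> x = 0"
    and cube: "\<And>i. b $ i - a $ i = h" and "h > 0"
  shows "(\<Sum>p\<in>UNIV. \<Sum>j\<in>UNIV. l $ p $ j * integral (cbox a b) (\<lambda>x. v x $ p * X x $ j)) = 0"
proof -
  define f where "f x = \<eta> x *\<^sub>R (transpose l *v v x)" for x
  define E where "E x = (\<chi> i j. X x $ j * (transpose l *v v x) $ i + \<eta> x * (transpose l ** D x) $ i $ j)" for x
  let ?g = "\<lambda>x. (\<Sum>p\<in>UNIV. \<Sum>j\<in>UNIV. l $ p $ j * (v x $ p * X x $ j))"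
  have vc: "continuous_on (cbox a b) v"
    by (intro continuous_at_imp_continuous_on ballI has_derivative_continuous[OF der])
  have le: "a $ i \<le> b $ i" for i using cube[of i] \<open>h > 0\<close> by linarith
  have "(\<Sum>j\<in>UNIV. face_flux j (\<lambda>x. f x $ j) a b) = integral (cbox a b) ?g"
  proof (rule divergence_cube[OF _ _ _ cube \<open>h > 0\<close>, where D = E])
    fix x assume x: "x \<in> cbox a b"
    have "((\<lambda>x. transpose l *v v x) has_derivative (\<lambda>h. transpose l *v (D x *v h))) (at x)"
      by (rule bounded_linear.has_derivative[OF matrix_vector_mul_bounded_linear der[OF x]])
    from has_derivative_scaleR[OF \<eta> this]
    have "(f has_derivative (\<lambda>h. \<eta> x *\<^sub>R (transpose l *v (D x *v h)) + (X x \<bullet> h) *\<^sub>R (transpose l *v v x))) (at x)"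
      unfolding f_def .
    moreover have "\<eta> x *\<^sub>R (transpose l *v (D x *v h)) + (X x \<bullet> h) *\<^sub>R (transpose l *v v x) = E x *v h" for h
    proof -
      define W where "W = transpose l *v v x"
      define T where "T = transpose l ** D x"
      have "(E x *v h) $ i = (\<Sum>j\<in>UNIV. (X x $ j * W $ i + \<eta> x * T $ i $ j) * h $ j)" for i
        unfolding E_def W_def[symmetric] T_def[symmetric] by (simp add: matrix_vector_mult_def)
      moreover have "transpose l *v (D x *v h) = T *v h" by (simp add: T_def matrix_vector_mul_assoc)
      ultimately show ?thesis unfolding W_def[symmetric]
        by (simp add: vec_eq_iff matrix_vector_mult_def inner_vec_def sum.distrib algebra_simps sum_distrib_left)
    qed
    ultimately show "(f has_derivative (\<lambda>h. E x *v h)) (at x)" by simp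
    have "(\<Sum>j\<in>UNIV. E x $ j $ j) = (\<Sum>j\<in>UNIV. X x $ j * (\<Sum>p\<in>UNIV. l $ p $ j * v x $ p)) +
       \<eta> x * (\<Sum>j\<in>UNIV. \<Sum>p\<in>UNIV. l $ p $ j * D x $ p $ j)"
      by (simp add: E_def sum.distrib sum_distrib_left matrix_vector_mult_def matrix_matrix_mult_def transpose_def)
    also have "(\<Sum>j\<in>UNIV. \<Sum>p\<in>UNIV. l $ p $ j * D x $ p $ j) = l \<bullet> D x"
      by (subst sum.swap) (simp add: inner_vec_def)
    also have "(\<Sum>j\<in>UNIV. X x $ j * (\<Sum>p\<in>UNIV. l $ p $ j * v x $ p)) = ?g x"
      by (subst sum.swap) (simp add: sum_distrib_left mult_ac)
    finally show "?g x = (\<Sum>j\<in>UNIV. E x $ j $ j)" using orth[OF x] by simp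
  next
    show "continuous_on (cbox a b) ?g"
      by (intro continuous_intros vc X)
  qed
  moreover have "face_flux j (\<lambda>x. f x $ j) a b = 0" for j
  proof (rule face_flux_eq_0)
    fix x assume x: "x \<in> cbox a b"
    have "\<eta> (set_coord j (b $ j) x) = 0"
      by (rule van[of _ j]) (auto intro!: set_coord_mem_cbox x le)
    moreover have "\<eta> (set_coord j (a $ j) x) = 0"
      by (rule van[of _ j]) (auto intro!: set_coord_mem_cbox x le)
    ultimately show "f (set_coord j (b $ j) x) $ j = f (set_coord j (a $ j) x) $ j" by (simp add: f_def)
  qed
  moreover have "integral (cbox a b) ?g = (\<Sum>p\<in>UNIV. \<Sum>j\<in>UNIV. integral (cbox a b) (\<lambda>x. l $ p $ j * (v x $ p * X x $ j)))"
    by (subst integral_sum; (intro integrable_sum integrable_continuous continuous_intros vc X)?; simp)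
       (subst integral_sum; (intro integrable_continuous continuous_intros vc X)?; simp)
  ultimately show ?thesis by simp
qed

definition of_int_vec :: "('n \<Rightarrow> int) \<Rightarrow> real ^ 'n" where
  "of_int_vec k = (\<chi> j. of_int (k j))"

lemma of_int_vec_nth [simp]: "of_int_vec k $ j = of_int (k j)"
  by (simp add: of_int_vec_def)

abbreviation torus :: "(real ^ 'n) set" where
  "torus \<equiv> cbox (\<chi> i. - pi) (\<chi> i. pi)"

text \<open>The integrand is the divergence of the field sin (k . y + \<theta>) / k_i along axis i,
  and the values of this field on opposite faces agree by periodicity.\<close>

lemma integral_torus_cos_eq_0:
  fixes k :: "'n::finite \<Rightarrow> int"
  assumes "k i \<noteq> 0"
  shows "integral torus (\<lambda>y. cos (of_int_vec k \<bullet> y + \<theta>)) = 0"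
proof -
  let ?k = "of_int_vec k"
  define f :: "real ^ 'n \<Rightarrow> real ^ 'n" where "f x = (sin (?k \<bullet> x + \<theta>) / of_int (k i)) *\<^sub>R axis i 1" for x
  define E :: "real ^ 'n \<Rightarrow> real ^ 'n ^ 'n" where
    "E x = (\<chi> j l. if j = i then cos (?k \<bullet> x + \<theta>) * (?k $ l) / of_int (k i) else 0)" for x
  have "(\<Sum>j\<in>UNIV. face_flux j (\<lambda>x. f x $ j) (\<chi> i. - pi) (\<chi> i. pi)) = integral torus (\<lambda>y. cos (of_int_vec k \<bullet> y + \<theta>))"
  proof (rule divergence_cube[where D = E and h = "2 * pi"])
    fix x :: "real ^ 'n"
    have "(f has_derivative (\<lambda>h. (cos (?k \<bullet> x + \<theta>) * (?k \<bullet> h) / of_int (k i)) *\<^sub>R axis i 1)) (at x)"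
      unfolding f_def using assms by (auto intro!: derivative_eq_intros simp: field_simps)
    moreover have "(cos (?k \<bullet> x + \<theta>) * (?k \<bullet> h) / of_int (k i)) *\<^sub>R axis i 1 = E x *v h" for h
      by (simp add: vec_eq_iff E_def matrix_vector_mult_def axis_def inner_vec_def sum_distrib_left sum_divide_distrib mult.assoc)
    ultimately show "(f has_derivative (\<lambda>h. E x *v h)) (at x)" by simp
    have "E x $ j $ j = (if j = i then cos (?k \<bullet> x + \<theta>) else 0)" for j
      using assms by (simp add: E_def)
    then show "cos (?k \<bullet> x + \<theta>) = (\<Sum>j\<in>UNIV. E x $ j $ j)" by simp
  qed (auto intro!: continuous_intros)
  moreover have "face_flux j (\<lambda>x. f x $ j) (\<chi> i. - pi) (\<chi> i. pi) = 0" for j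
  proof (rule face_flux_eq_0)
    fix x :: "real ^ 'n"
    show "f (set_coord j ((\<chi> i. pi) $ j) x) $ j = f (set_coord j ((\<chi> i. - pi) $ j) x) $ j"
    proof (cases "j = i")
      case True
      have d: "?k \<bullet> set_coord i t x = of_int (k i) * t + (\<Sum>l\<in>UNIV - {i}. of_int (k l) * x $ l)" for t
        by (simp add: inner_vec_def sum.remove[of UNIV i])
      have "sin (?k \<bullet> set_coord i pi x + \<theta>) = sin ((?k \<bullet> set_coord i (- pi) x + \<theta>) + 2 * pi * of_int (k i))"
        unfolding d by (simp add: algebra_simps)
      also have "\<dots> = sin (?k \<bullet> set_coord i (- pi) x + \<theta>)"
        by (simp only: sin_add[of _ "2 * pi * of_int (k i)"] sin_int_2pin cos_int_2pin)
      finally show ?thesis using True by (simp add: f_def)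
    qed (simp add: f_def axis_def)
  qed
  ultimately show ?thesis by simp
qed

section \<open>Ellipticity\<close>

lemma rank_outer_product:
  fixes a :: "real ^ 'm" and \<xi> :: "real ^ 'n"
  assumes "a \<noteq> 0" "\<xi> \<noteq> 0"
  shows "rank (\<chi> p j. a $ p * \<xi> $ j) = 1"
proof -
  let ?A = "\<chi> p j. a $ p * \<xi> $ j"
  have A: "?A *v x = (\<xi> \<bullet> x) *\<^sub>R a" for x
    by (simp add: vec_eq_iff matrix_vector_mult_def inner_vec_def sum_distrib_left sum_distrib_right mult_ac)
  have "range (\<lambda>x. ?A *v x) = span {a}"
  proof -
    have "t *\<^sub>R a = ?A *v ((t / (\<xi> \<bullet> \<xi>)) *\<^sub>R \<xi>)" for t
      using assms by (simp add: A)
    then have "t *\<^sub>R a \<in> range (\<lambda>x. ?A *v x)" for t by (metis rangeI)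
    then show ?thesis unfolding span_singleton by (auto simp: A)
  qed
  then show ?thesis
    unfolding rank_dim_range using assms by (simp add: dim_span)
qed

lemma inner_outer_product:
  fixes b :: "real ^ 'n ^ 'm"
  shows "b \<bullet> (\<chi> p j. a $ p * \<xi> $ j) = a \<bullet> (b *v \<xi>)"
  by (simp add: inner_vec_def matrix_vector_mult_def sum_distrib_left mult_ac)

text \<open>The matrices \<open>l\<close> are obtained by inverting the symbol of the normal equations, which is
  bounded below by compactness of the unit spheres.\<close>
lemma elliptic_dual:
  fixes L :: "(real ^ 'n ^ 'm) set"
  assumes L: "subspace L" and no: "no_rank1_connections L"
  obtains C where "C > 0"
    "\<And>\<xi> i. \<xi> \<noteq> 0 \<Longrightarrow> \<exists>l :: real ^ 'n ^ 'm. (\<forall>A\<in>L. l \<bullet> A = 0) \<and> l *v \<xi> = axis i 1 \<and>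
      (\<forall>p j. \<bar>l $ p $ j\<bar> \<le> C / norm \<xi>)"
proof -
  obtain B where B: "finite B" "B \<subseteq> L\<^sup>\<bottom>" "span B = L\<^sup>\<bottom>"
    using basis_subspace_exists[OF subspace_orthogonal_comp[of L]] by metis
  \<comment> \<open>q tests the outer product of a and \<xi> against a spanning set of the
    orthogonal complement of L. If q vanishes, the outer product lies in the double complement,
    which is L, although it has rank one.\<close>
  define q where "q a \<xi> = (\<Sum>b\<in>B. (a \<bullet> (b *v \<xi>))\<^sup>2)" for a \<xi>
  have q_pos: "q a \<xi> > 0" if "a \<noteq> 0" "\<xi> \<noteq> 0" for a \<xi>
  proof (rule ccontr)
    assume "\<not> q a \<xi> > 0"
    moreover have "q a \<xi> \<ge> 0" by (simp add: q_def sum_nonneg)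
    ultimately have "q a \<xi> = 0" by simp
    then have z: "a \<bullet> (b *v \<xi>) = 0" if "b \<in> B" for b
      using that B(1) by (simp add: q_def sum_nonneg_eq_0_iff)
    let ?A = "\<chi> p j. a $ p * \<xi> $ j"
    have "orthogonal ?A b" if "b \<in> span B" for b
      by (rule orthogonal_to_span[OF that])
         (use z inner_outer_product[of _ a \<xi>] in \<open>simp add: orthogonal_def inner_commute\<close>)
    then have "?A \<in> (L\<^sup>\<bottom>)\<^sup>\<bottom>"
      unfolding orthogonal_comp_def[of "L\<^sup>\<bottom>"] using B(3) by (simp add: orthogonal_commute)
    then have "?A \<in> L" using orthogonal_comp_self[OF L] by simp
    moreover have "rank (?A - 0) = 1" using rank_outer_product[OF that] by simp
    ultimately show False using no subspace_0[OF L] unfolding no_rank1_connections_def by blast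
  qed
  let ?K = "sphere (0::real^'m) 1 \<times> sphere (0::real^'n) 1"
  have cont: "continuous_on ?K (\<lambda>z. q (fst z) (snd z))"
    unfolding q_def by (intro continuous_intros) 
      (auto intro!: continuous_intros linear_continuous_on_compose[OF _ matrix_vector_mul_linear])
  have "?K \<noteq> {}"
  proof -
    have "(axis undefined 1, axis undefined 1) \<in> ?K" by (simp add: norm_axis_1)
    then show ?thesis by blast
  qed
  then obtain z where z: "z \<in> ?K" "\<And>y. y \<in> ?K \<Longrightarrow> q (fst z) (snd z) \<le> q (fst y) (snd y)"
    using continuous_attains_inf[OF _ _ cont] by (metis compact_Times compact_sphere)
  define c where "c = q (fst z) (snd z)"
  have c: "c > 0" unfolding c_def by (rule q_pos) (use z(1) in \<open>auto simp: mem_Times_iff\<close>)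
  have q_ge: "c * (norm a)\<^sup>2 * (norm \<xi>)\<^sup>2 \<le> q a \<xi>" if "a \<noteq> 0" "\<xi> \<noteq> 0" for a \<xi>
  proof -
    have "c \<le> q (a /\<^sub>R norm a) (\<xi> /\<^sub>R norm \<xi>)"
      using z(2)[of "(a /\<^sub>R norm a, \<xi> /\<^sub>R norm \<xi>)"] that by (simp add: c_def)
    also have "\<dots> = q a \<xi> / ((norm a)\<^sup>2 * (norm \<xi>)\<^sup>2)"
      by (simp add: q_def sum_divide_distrib matrix_vector_mult_scaleR power_mult_distrib divide_inverse mult_ac power_inverse)
         (simp add: sum_distrib_left mult_ac)
    finally show ?thesis using that by (simp add: field_simps)
  qed
  \<comment> \<open>The sum comes from the triangle inequality for l, and 1 / sqrt c from its
    coefficients. The summand 1 gives C > 0 at once.\<close>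
  define C where "C = (1 + (\<Sum>b\<in>B. norm b)) / sqrt c"
  have "C > 0" using c by (auto simp: C_def intro!: divide_pos_pos add_pos_nonneg sum_nonneg)
  moreover have "\<exists>l :: real ^ 'n ^ 'm. (\<forall>A\<in>L. l \<bullet> A = 0) \<and> l *v \<xi> = axis i 1 \<and> (\<forall>p j. \<bar>l $ p $ j\<bar> \<le> C / norm \<xi>)"
    if \<xi>: "\<xi> \<noteq> 0" for \<xi> :: "real ^ 'n" and i
  proof -
    \<comment> \<open>A matrix l with coefficients a . (b \<xi>) over B annihilates L and satisfies
      l \<xi> = S a. So it remains to solve S a = e_i, which is possible since a . S a = q a \<xi> >
      0 makes S injective.\<close>
    define S where "S a = (\<Sum>b\<in>B. (a \<bullet> (b *v \<xi>)) *\<^sub>R (b *v \<xi>))" for a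
    have lin: "linear S"
      by (rule linearI) (simp_all add: S_def inner_add_left scaleR_add_left sum.distrib scaleR_sum_right)
    have aS: "a \<bullet> S a = q a \<xi>" for a
      by (simp add: S_def q_def inner_sum_right power2_eq_square)
    have "inj S"
    proof (rule linear_injective_0[OF lin, THEN iffD2], intro allI impI)
      fix a assume "S a = 0"
      then show "a = 0" using aS[of a] q_pos[of a \<xi>] \<xi> by fastforce
    qed
    then have "surj S" by (rule linear_inj_imp_surj[OF lin])
    then obtain a where a: "S a = axis i 1" by (metis surjD)
    define l where "l = (\<Sum>b\<in>B. (a \<bullet> (b *v \<xi>)) *\<^sub>R b)"
    have a0: "a \<noteq> 0"
    proof
      assume "a = 0"
      then have "axis i 1 = (0 :: real^'m)" using a by (simp add: S_def)
      then show False by (simp add: axis_eq_0_iff)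
    qed
    \<comment> \<open>Pairing S a = e_i with a turns \<open>q_ge\<close> into a bound 1 / (c
      |\<xi>|^2) for |a|, hence for q a \<xi> = a_i. Each coefficient of l is at most the square
      root of q, which is of the required order 1 / |\<xi>|.\<close>
    have qa: "q a \<xi> = a $ i" using aS[of a] by (simp add: a inner_axis)
    have "c * (norm a)\<^sup>2 * (norm \<xi>)\<^sup>2 \<le> norm a"
      using q_ge[OF a0 \<xi>] qa component_le_norm_cart[of a i] by linarith
    then have na: "c * norm a * (norm \<xi>)\<^sup>2 \<le> 1"
      using a0 by (simp add: power2_eq_square)
    have q_le: "q a \<xi> \<le> 1 / (c * (norm \<xi>)\<^sup>2)"
    proof -
      have "a $ i * (c * (norm \<xi>)\<^sup>2) \<le> norm a * (c * (norm \<xi>)\<^sup>2)"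
        using component_le_norm_cart[of a i] c by (intro mult_right_mono) auto
      also have "\<dots> \<le> 1" using na by (simp add: mult_ac)
      finally show ?thesis using c \<xi> by (simp add: qa field_simps)
    qed
    have bq: "\<bar>a \<bullet> (b *v \<xi>)\<bar> \<le> 1 / (sqrt c * norm \<xi>)" if "b \<in> B" for b
    proof -
      have "(a \<bullet> (b *v \<xi>))\<^sup>2 \<le> q a \<xi>" unfolding q_def
        by (rule member_le_sum) (use that B(1) in auto)
      also note q_le
      also have "1 / (c * (norm \<xi>)\<^sup>2) = (1 / (sqrt c * norm \<xi>))\<^sup>2"
        using c by (simp add: power_divide power_mult_distrib)
      finally have "\<bar>a \<bullet> (b *v \<xi>)\<bar> \<le> \<bar>1 / (sqrt c * norm \<xi>)\<bar>" by (simp only: abs_le_square_iff)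
      also have "\<dots> = 1 / (sqrt c * norm \<xi>)" using c by (intro abs_of_nonneg) auto
      finally show ?thesis .
    qed
    have "norm l \<le> (\<Sum>b\<in>B. 1 / (sqrt c * norm \<xi>) * norm b)"
      unfolding l_def by (rule sum_norm_le) (simp only: norm_scaleR real_norm_def mult_right_mono[OF bq norm_ge_zero])
    also have "\<dots> = (\<Sum>b\<in>B. norm b) / sqrt c / norm \<xi>" by (simp add: sum_divide_distrib)
    also have "\<dots> \<le> C / norm \<xi>" using c by (auto simp: C_def intro!: divide_right_mono)
    finally have nl: "norm l \<le> C / norm \<xi>" .
    have "\<bar>l $ p $ j\<bar> \<le> C / norm \<xi>" for p j
      using nl component_le_norm_cart[of "l $ p" j] Finite_Cartesian_Product.norm_nth_le[of l p] by linarith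
    moreover have "l *v \<xi> = S a"
    proof -
      have "l *v \<xi> = (\<Sum>b\<in>B. ((a \<bullet> (b *v \<xi>)) *\<^sub>R b) *v \<xi>)"
        unfolding l_def using B(1)
        by (induction rule: finite_induct) (auto simp: matrix_vector_mult_add_rdistrib)
      also have "\<dots> = S a"
        unfolding S_def by (intro sum.cong refl) (simp add: scaleR_matrix_vector_assoc)
      finally show ?thesis .
    qed
    moreover have "l \<bullet> A = 0" if "A \<in> L" for A
    proof -
      have "b \<bullet> A = 0" if "b \<in> B" for b
        using B(2) that \<open>A \<in> L\<close> by (auto simp: orthogonal_comp_def orthogonal_def inner_commute)
      then show ?thesis by (simp add: l_def inner_sum_left)
    qed
    ultimately show ?thesis using a by metis
  qed
  ultimately show ?thesis using that by blast
qed

section \<open>Cut-off functions\<close>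

lemma continuous_on_UNIV_interval:
  "continuous_on UNIV f \<Longrightarrow> continuous_on {a..b::real} f"
  by (rule continuous_on_subset) auto

lemma has_real_derivative_central_diff:
  assumes "(F has_real_derivative a) (at (x + h))" "(F has_real_derivative b) (at (x - h))"
  shows "((\<lambda>y. (F (y + h) - F (y - h)) / (2 * h)) has_real_derivative (a - b) / (2 * h)) (at x)"
  using assms DERIV_shift[of F a x h] DERIV_shift[of F b x "- h"]
  by (intro DERIV_cdivide DERIV_diff) simp_all

lemma has_real_derivative_moving_average:
  fixes f :: "real \<Rightarrow> real"
  assumes f: "continuous_on UNIV f" and h: "h > 0"
  shows "((\<lambda>x. integral {x - h..x + h} f / (2 * h)) has_real_derivative (f (x + h) - f (x - h)) / (2 * h)) (at x)"
proof -
  \<comment> \<open>The windows of all y within distance 1 of x lie between A and B, so a single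
    primitive F serves all of them.\<close>
  define A where "A = x - h - 1"
  define B where "B = x + h + 1"
  define F where "F t = integral {A..t} f" for t
  have F: "(F has_real_derivative f t) (at t)" if "A < t" "t < B" for t
  proof -
    have "(F has_real_derivative f t) (at t within {A..B})"
      unfolding F_def by (rule integral_has_real_derivative) (use continuous_on_UNIV_interval[OF f] that in auto)
    then show ?thesis using that by (simp add: at_within_Icc_at)
  qed
  have dF: "((\<lambda>y. (F (y + h) - F (y - h)) / (2 * h)) has_real_derivative (f (x + h) - f (x - h)) / (2 * h)) (at x)"
    using h by (intro has_real_derivative_central_diff F) (auto simp: A_def B_def)
  have eq: "(F (y + h) - F (y - h)) / (2 * h) = integral {y - h..y + h} f / (2 * h)" if "dist y x < 1" for y
  proof -
    have "F (y - h) + integral {y - h..y + h} f = F (y + h)"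
      unfolding F_def
    proof (rule Henstock_Kurzweil_Integration.integral_combine)
      show "f integrable_on {A..y + h}"
        by (intro integrable_continuous_real continuous_on_UNIV_interval f)
      have "\<bar>y - x\<bar> < 1" using that by (simp add: dist_real_def)
      then show "A \<le> y - h" "y - h \<le> y + h" using h by (auto simp: A_def)
    qed
    then show ?thesis by simp
  qed
  show ?thesis
    by (rule has_field_derivative_transform_within[OF dF zero_less_one UNIV_I eq])
qed

text \<open>Averaging over windows of radius \<open>h\<close> improves the smoothness by one order
  at the price of a factor \<open>1 / h\<close> for each derivative.\<close>
lemma iterated_average_cutoff:
  fixes f0 :: "real \<Rightarrow> real"
  assumes cont: "continuous_on UNIV f0" and bd: "\<And>x. \<bar>f0 x\<bar> \<le> 1" and h: "h > 0"
    and out: "\<And>x. \<bar>x\<bar> \<ge> s \<Longrightarrow> f0 x = 0" and ins: "\<And>x. \<bar>x\<bar> \<le> \<rho> \<Longrightarrow> f0 x = 1"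
  shows "\<exists>\<psi>. (\<forall>m<N. \<forall>x. (\<psi> m has_real_derivative \<psi> (Suc m) x) (at x)) \<and>
     (\<forall>m\<le>N. continuous_on UNIV (\<psi> m)) \<and> (\<forall>m\<le>N. \<forall>x. \<bar>\<psi> m x\<bar> \<le> (1 / h) ^ m) \<and>
     (\<forall>m\<le>N. \<forall>x. \<bar>x\<bar> \<ge> s + N * h \<longrightarrow> \<psi> m x = 0) \<and> (\<forall>x. \<bar>x\<bar> \<le> \<rho> - N * h \<longrightarrow> \<psi> 0 x = 1)"
proof (induction N)
  case 0
  show ?case by (intro exI[of _ "\<lambda>m. f0"]) (use cont bd out ins in auto)
next
  case (Suc N)
  then obtain \<psi> where \<psi>: "(\<forall>m<N. \<forall>x. (\<psi> m has_real_derivative \<psi> (Suc m) x) (at x)) \<and>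
     (\<forall>m\<le>N. continuous_on UNIV (\<psi> m)) \<and> (\<forall>m\<le>N. \<forall>x. \<bar>\<psi> m x\<bar> \<le> (1 / h) ^ m) \<and>
     (\<forall>m\<le>N. \<forall>x. \<bar>x\<bar> \<ge> s + N * h \<longrightarrow> \<psi> m x = 0) \<and> (\<forall>x. \<bar>x\<bar> \<le> \<rho> - N * h \<longrightarrow> \<psi> 0 x = 1)"
    by (elim exE)
  have
    der: "\<And>m x. m < N \<Longrightarrow> (\<psi> m has_real_derivative \<psi> (Suc m) x) (at x)"
    and c: "\<And>m. m \<le> N \<Longrightarrow> continuous_on UNIV (\<psi> m)"
    and b: "\<And>m x. m \<le> N \<Longrightarrow> \<bar>\<psi> m x\<bar> \<le> (1 / h) ^ m"
    and o: "\<And>m x. m \<le> N \<Longrightarrow> \<bar>x\<bar> \<ge> s + N * h \<Longrightarrow> \<psi> m x = 0"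
    and i: "\<And>x. \<bar>x\<bar> \<le> \<rho> - N * h \<Longrightarrow> \<psi> 0 x = 1"
    using \<psi> by auto
  \<comment> \<open>The index is the order of the derivative. Order 0 is the average of the old
    function, and order j + 1 is the central difference quotient of the old order j, which gains the
    factor 1 / h.\<close>
  define \<phi> where "\<phi> m x = (case m of 0 \<Rightarrow> integral {x - h..x + h} (\<psi> 0) / (2 * h)
     | Suc j \<Rightarrow> (\<psi> j (x + h) - \<psi> j (x - h)) / (2 * h))" for m x
  have int: "\<psi> 0 integrable_on {a..b}" for a b
    by (intro integrable_continuous_real continuous_on_UNIV_interval c) simp
  have d: "(\<phi> m has_real_derivative \<phi> (Suc m) x) (at x)" if "m < Suc N" for m x
  proof (cases m)
    case 0
    then show ?thesis
      using has_real_derivative_moving_average[OF c[of 0] h, of x] by (simp add: \<phi>_def[abs_def])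
  next
    case (Suc j)
    then have "j < N" using that by simp
    have "((\<lambda>x. (\<psi> j (x + h) - \<psi> j (x - h)) / (2 * h)) has_real_derivative (\<psi> (Suc j) (x + h) - \<psi> (Suc j) (x - h)) / (2 * h)) (at x)"
      by (intro has_real_derivative_central_diff der \<open>j < N\<close>)
    then show ?thesis by (simp add: \<phi>_def[abs_def] Suc)
  qed
  have "continuous_on UNIV (\<phi> m)" if "m \<le> Suc N" for m
  proof (cases "m < Suc N")
    case True
    show ?thesis
      by (intro continuous_at_imp_continuous_on ballI DERIV_isCont[OF d[OF True]])
  next
    case False
    then have "m = Suc N" using that by simp
    then show ?thesis unfolding \<phi>_def[abs_def] using h
      by (auto intro!: continuous_intros continuous_on_compose2[OF c[of N]])
  qed
  moreover have "\<bar>\<phi> m x\<bar> \<le> (1 / h) ^ m" if "m \<le> Suc N" for m x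
  proof (cases m)
    case 0
    have "norm (integral {x - h..x + h} (\<psi> 0)) \<le> 1 * ((x + h) - (x - h))"
      by (rule integral_bound) (use h b[of 0] in \<open>auto intro!: continuous_on_UNIV_interval c\<close>)
    then show ?thesis using h by (simp add: \<phi>_def 0 field_simps)
  next
    case (Suc j)
    have "\<bar>\<psi> j (x + h) - \<psi> j (x - h)\<bar> \<le> 2 * (1 / h) ^ j"
      using b[of j "x + h"] b[of j "x - h"] that Suc by simp
    then show ?thesis using h by (simp add: \<phi>_def Suc field_simps)
  qed
  moreover have "\<phi> m x = 0" if "m \<le> Suc N" "\<bar>x\<bar> \<ge> s + real (Suc N) * h" for m x
  proof (cases m)
    case 0
    have "integral {x - h..x + h} (\<psi> 0) = integral {x - h..x + h} (\<lambda>x. 0)"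
      using that(2) by (intro integral_cong o) (auto simp: algebra_simps abs_if split: if_splits)
    then show ?thesis by (simp add: \<phi>_def 0)
  next
    case (Suc j)
    have "\<psi> j (x + h) = 0" "\<psi> j (x - h) = 0"
      using that Suc h by (auto intro!: o simp: algebra_simps abs_if split: if_splits)
    then show ?thesis by (simp add: \<phi>_def Suc)
  qed
  moreover have "\<phi> 0 x = 1" if "\<bar>x\<bar> \<le> \<rho> - real (Suc N) * h" for x
  proof -
    have "integral {x - h..x + h} (\<psi> 0) = integral {x - h..x + h} (\<lambda>x. 1)"
      using that by (intro integral_cong i) (auto simp: algebra_simps abs_if split: if_splits)
    then show ?thesis using h by (simp add: \<phi>_def)
  qed
  ultimately show ?case using d by (intro exI[of _ \<phi>] conjI allI impI)
qed

text \<open>\<psi> m stands for the m-th derivative of \<psi> 0; the chain stops at N, where only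
  continuity is left. The support radius 2 is below pi, so products of these functions vanish on the
  faces of the torus.\<close>

definition cutoff_sequence :: "nat \<Rightarrow> (nat \<Rightarrow> real \<Rightarrow> real) \<Rightarrow> bool" where
  "cutoff_sequence N \<psi> \<longleftrightarrow>
     (\<forall>m<N. \<forall>x. (\<psi> m has_real_derivative \<psi> (Suc m) x) (at x)) \<and>
     (\<forall>m\<le>N. continuous_on UNIV (\<psi> m)) \<and>
     (\<forall>m\<le>N. \<forall>x. \<bar>\<psi> m x\<bar> \<le> (4 * real N) ^ m) \<and>
     (\<forall>m\<le>N. \<forall>x. \<bar>x\<bar> \<ge> 2 \<longrightarrow> \<psi> m x = 0) \<and>
     (\<forall>x. \<bar>x\<bar> \<le> 1 \<longrightarrow> \<psi> 0 x = 1)"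

lemma cutoff_sequenceD:
  assumes "cutoff_sequence N \<psi>"
  shows "m < N \<Longrightarrow> (\<psi> m has_real_derivative \<psi> (Suc m) x) (at x)"
    and "m \<le> N \<Longrightarrow> continuous_on UNIV (\<psi> m)"
    and "m \<le> N \<Longrightarrow> \<bar>\<psi> m x\<bar> \<le> (4 * real N) ^ m"
    and "m \<le> N \<Longrightarrow> \<bar>x\<bar> \<ge> 2 \<Longrightarrow> \<psi> m x = 0"
    and "\<bar>x\<bar> \<le> 1 \<Longrightarrow> \<psi> 0 x = 1"
  using assms unfolding cutoff_sequence_def by auto

lemma cutoff_sequence_exists:
  assumes "N \<ge> 1"
  shows "\<exists>\<psi>. cutoff_sequence N \<psi>"
proof -
  define h where "h = 1 / (4 * real N)"
  have h: "h > 0" "1 / h = 4 * real N" "real N * h = 1/4" using assms by (auto simp: h_def)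
  \<comment> \<open>A trapezoid equal to 1 up to 5/4 and to 0 from 7/4 on. N averages of radius h
    shift both thresholds by N h = 1/4, to 1 and 2.\<close>
  let ?f = "\<lambda>x::real. max 0 (min 1 (2 * (7/4 - \<bar>x\<bar>)))"
  have "\<exists>\<psi>. (\<forall>m<N. \<forall>x. (\<psi> m has_real_derivative \<psi> (Suc m) x) (at x)) \<and>
     (\<forall>m\<le>N. continuous_on UNIV (\<psi> m)) \<and> (\<forall>m\<le>N. \<forall>x. \<bar>\<psi> m x\<bar> \<le> (1 / h) ^ m) \<and>
     (\<forall>m\<le>N. \<forall>x. \<bar>x\<bar> \<ge> 7/4 + N * h \<longrightarrow> \<psi> m x = 0) \<and> (\<forall>x. \<bar>x\<bar> \<le> 5/4 - N * h \<longrightarrow> \<psi> 0 x = 1)"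
    by (rule iterated_average_cutoff[of ?f]) (use h in \<open>auto intro!: continuous_intros\<close>)
  then show ?thesis unfolding cutoff_sequence_def h by simp
qed

section \<open>Fourier inversion on the torus\<close>

text \<open>Fourier coefficients of \<open>cos (t / 2) ^ (2 * M)\<close>.\<close>
definition cos_power_coeff :: "nat \<Rightarrow> int \<Rightarrow> real" where
  "cos_power_coeff M l = (if \<bar>l\<bar> \<le> int M then real ((2 * M) choose nat (int M + l)) / 4 ^ M else 0)"

text \<open>(1 + cos t) / 2 is a quarter of the square of e^(it/2) + e^(-it/2). The binomial theorem
  with the even exponent 2 M produces integer frequencies only, namely l = i - M.\<close>

lemma cos_power_fourier:
  "of_real (((1 + cos t) / 2) ^ M) = (\<Sum>l\<in>{- int M..int M}. of_real (cos_power_coeff M l) * cis (of_int l * t))"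
proof -
  have "(cis (t / 2) + cis (- (t / 2)))\<^sup>2 = of_real (4 * ((1 + cos t) / 2))"
  proof -
    have "cis (t / 2) + cis (- (t / 2)) = of_real (2 * cos (t / 2))" by (simp add: complex_eq_iff)
    moreover have "(2 * cos (t / 2))\<^sup>2 = 4 * ((1 + cos t) / 2)"
      using cos_double_cos[of "t / 2"] by (simp add: power_mult_distrib)
    ultimately show ?thesis by (metis of_real_power)
  qed
  then have "of_real ((4 * ((1 + cos t) / 2)) ^ M) = ((cis (t / 2) + cis (- (t / 2)))\<^sup>2) ^ M"
    by (simp only: of_real_power)
  also have "\<dots> = (cis (t / 2) + cis (- (t / 2))) ^ (2 * M)" by (simp add: power_mult)
  also have "\<dots> = (\<Sum>i\<le>2 * M. of_nat ((2 * M) choose i) * cis (t / 2) ^ i * cis (- (t / 2)) ^ (2 * M - i))"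
    by (rule binomial_ring)
  also have "\<dots> = (\<Sum>i\<le>2 * M. of_real (4 ^ M * cos_power_coeff M (int i - int M)) * cis (of_int (int i - int M) * t))"
  proof (rule sum.cong[OF refl])
    fix i assume "i \<in> {..2 * M}"
    then have i: "i \<le> 2 * M" by simp
    have "cis (t / 2) ^ i * cis (- (t / 2)) ^ (2 * M - i) = cis (of_int (int i - int M) * t)"
    proof -
      have "real i * (t / 2) + real (2 * M - i) * - (t / 2) = of_int (int i - int M) * t"
        using i by (simp add: of_nat_diff field_simps)
      then show ?thesis by (simp only: Complex.DeMoivre cis_mult)
    qed
    moreover have "4 ^ M * cos_power_coeff M (int i - int M) = real ((2 * M) choose i)"
      using i by (simp add: cos_power_coeff_def)
    ultimately show "of_nat ((2 * M) choose i) * cis (t / 2) ^ i * cis (- (t / 2)) ^ (2 * M - i)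
        = of_real (4 ^ M * cos_power_coeff M (int i - int M)) * cis (of_int (int i - int M) * t)"
      by (simp add: mult.assoc)
  qed
  also have "\<dots> = (\<Sum>l\<in>{- int M..int M}. of_real (4 ^ M * cos_power_coeff M l) * cis (of_int l * t))"
    by (rule sum.reindex_bij_witness[of _ "\<lambda>l. nat (l + int M)" "\<lambda>i. int i - int M"]) auto
  also have "\<dots> = 4 ^ M * (\<Sum>l\<in>{- int M..int M}. of_real (cos_power_coeff M l) * cis (of_int l * t))"
    by (simp add: sum_distrib_left mult.assoc)
  finally have 1: "complex_of_real ((4 * ((1 + cos t) / 2)) ^ M) = \<dots>" .
  have 2: "complex_of_real ((4 * ((1 + cos t) / 2)) ^ M) = 4 ^ M * of_real (((1 + cos t) / 2) ^ M)"
    by (simp only: power_mult_distrib of_real_mult of_real_power of_real_numeral)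
  have nz: "(4 :: complex) ^ M \<noteq> 0" by simp
  show ?thesis by (rule mult_left_cancel[THEN iffD1, OF nz trans[OF sym[OF 2] 1]])
qed

lemma cos_power_coeff_nonneg: "cos_power_coeff M l \<ge> 0"
  by (simp add: cos_power_coeff_def)

lemma cos_power_coeff_le: "cos_power_coeff M l \<le> cos_power_coeff M 0"
  using binomial_maximum'[of M "nat (int M + l)"] by (simp add: cos_power_coeff_def divide_right_mono)

text \<open>A polynomial bound is enough: normalising the kernel costs at most (2 M)^n, while its
  tail is geometrically small in M.\<close>

lemma cos_power_coeff_0_ge: "M > 0 \<Longrightarrow> cos_power_coeff M 0 \<ge> 1 / (2 * real M)"
  using central_binomial_lower_bound[of M] by (simp add: cos_power_coeff_def field_simps)

lemma cos_power_coeff_0_pos: "cos_power_coeff M 0 > 0"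
  by (simp add: cos_power_coeff_def)

lemma cos_power_coeff_minus: "cos_power_coeff M (- l) = cos_power_coeff M l"
proof (cases "\<bar>l\<bar> \<le> int M")
  case True
  then have "nat (int M + - l) = 2 * M - nat (int M + l)" "nat (int M + l) \<le> 2 * M" by auto
  then show ?thesis using True binomial_symmetric[of "nat (int M + l)" "2 * M"]
    by (simp add: cos_power_coeff_def)
qed (simp add: cos_power_coeff_def)

text \<open>Quotient of neighbouring binomial coefficients. For fixed l the factor tends to 1 as M
  grows, which yields the limit of the multipliers by induction on l.\<close>

lemma cos_power_coeff_Suc:
  assumes "l < M"
  shows "cos_power_coeff M (int (Suc l)) = cos_power_coeff M (int l) * (real (M - l) / real (M + l + 1))"
proof -
  have "Suc (M + l) * ((2 * M) choose Suc (M + l)) = (2 * M - (M + l)) * ((2 * M) choose (M + l))"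
    using binomial_absorption[of "M + l" "2 * M"] binomial_absorb_comp[of "2 * M" "M + l"] by simp
  then have "real (Suc (M + l)) * real ((2 * M) choose Suc (M + l)) = real (M - l) * real ((2 * M) choose (M + l))"
    by (metis (no_types, lifting) of_nat_mult mult_2 diff_diff_left diff_add_inverse)
  then have "real ((2 * M) choose Suc (M + l)) = real (M - l) * real ((2 * M) choose (M + l)) / real (Suc (M + l))"
    by (simp add: nonzero_eq_divide_eq mult.commute)
  moreover have "nat (int M + int (Suc l)) = Suc (M + l)" "nat (int M + int l) = M + l" by auto
  ultimately show ?thesis using assms by (simp only: cos_power_coeff_def) (simp add: mult_ac)
qed

lemma cos_power_coeff_ratio_tendsto_nat: "(\<lambda>M. cos_power_coeff M (int l) / cos_power_coeff M 0) \<longlonglongrightarrow> 1"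
proof (induction l)
  case 0
  show ?case using cos_power_coeff_0_pos by (simp add: less_imp_neq[symmetric])
next
  case (Suc l)
  have "(\<lambda>M. (real M - real l) / (real M + real l + 1)) \<longlonglongrightarrow> 1"
  proof -
    have "(\<lambda>M. 1 - (2 * real l + 1) * inverse (real (M + (l + 1)))) \<longlonglongrightarrow> 1 - (2 * real l + 1) * 0"
      by (intro tendsto_intros LIMSEQ_ignore_initial_segment[OF lim_inverse_n])
    then show ?thesis by (simp add: field_simps)
  qed
  from tendsto_mult[OF Suc this]
  have "(\<lambda>M. cos_power_coeff M (int l) / cos_power_coeff M 0 * ((real M - real l) / (real M + real l + 1))) \<longlonglongrightarrow> 1" by simp
  moreover have "\<forall>\<^sub>F M in sequentially. cos_power_coeff M (int l) / cos_power_coeff M 0 * ((real M - real l) / (real M + real l + 1))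
      = cos_power_coeff M (int (Suc l)) / cos_power_coeff M 0"
    using eventually_gt_at_top[of l]
    by eventually_elim (subst cos_power_coeff_Suc; simp add: of_nat_diff add_ac)
  ultimately show ?case by (rule Lim_transform_eventually)
qed

lemma cos_power_coeff_ratio_tendsto: "(\<lambda>M. cos_power_coeff M l / cos_power_coeff M 0) \<longlonglongrightarrow> 1"
proof (cases "l \<ge> 0")
  case True
  then show ?thesis using cos_power_coeff_ratio_tendsto_nat[of "nat l"] by simp
next
  case False
  then show ?thesis using cos_power_coeff_ratio_tendsto_nat[of "nat (- l)"] by (simp add: cos_power_coeff_minus)
qed

text \<open>The de la Vallee Poussin kernel in each coordinate, not normalised. It is a nonnegative
  trigonometric polynomial with explicit coefficients; divided by the coefficient of frequency 0
  they lie in [0, 1] and tend to 1.\<close>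

definition cos_kernel :: "nat \<Rightarrow> real ^ 'n \<Rightarrow> real" where
  "cos_kernel M z = (\<Prod>j\<in>UNIV. ((1 + cos (z $ j)) / 2) ^ M)"

lemma cis_sum: "finite A \<Longrightarrow> cis (\<Sum>j\<in>A. f j) = (\<Prod>j\<in>A. cis (f j))"
  by (induction A rule: finite_induct) (auto simp: cis_mult[symmetric])

lemma cos_kernel_fourier:
  fixes z :: "real ^ 'n"
  shows "cos_kernel M z = (\<Sum>k\<in>(UNIV \<rightarrow>\<^sub>E {- int M..int M}). (\<Prod>j\<in>UNIV. cos_power_coeff M (k j)) * cos (of_int_vec k \<bullet> z))"
proof -
  have "complex_of_real (cos_kernel M z) = (\<Prod>j\<in>UNIV. \<Sum>l\<in>{- int M..int M}. of_real (cos_power_coeff M l) * cis (of_int l * z $ j))"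
    unfolding cos_kernel_def of_real_prod cos_power_fourier ..
  also have "\<dots> = (\<Sum>k\<in>(UNIV \<rightarrow>\<^sub>E {- int M..int M}). \<Prod>j\<in>UNIV. of_real (cos_power_coeff M (k j)) * cis (of_int (k j) * z $ j))"
    by (rule prod_sum_PiE) auto
  also have "\<dots> = (\<Sum>k\<in>(UNIV \<rightarrow>\<^sub>E {- int M..int M}). of_real (\<Prod>j\<in>UNIV. cos_power_coeff M (k j)) * cis (of_int_vec k \<bullet> z))"
    by (simp add: prod.distrib inner_vec_def cis_sum)
  finally have "complex_of_real (cos_kernel M z) = \<dots>" .
  from arg_cong[OF this, of Re] show ?thesis by (simp del: of_real_prod)
qed

lemma measure_torus: "measure lborel (torus :: (real ^ 'n) set) = (2 * pi) ^ CARD('n)"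
  by (subst content_cbox_cart) (auto simp: interval_ne_empty_cart)

lemma torus_const: "integral (torus :: (real ^ 'n) set) (\<lambda>y. c) = c * (2 * pi) ^ CARD('n)"
  by (simp add: measure_torus mult.commute)

lemma integral_mult_cos_kernel:
  fixes w :: "real ^ 'n \<Rightarrow> real"
  assumes "continuous_on torus w"
  shows "integral torus (\<lambda>y. w y * cos_kernel M (x - y)) =
    (\<Sum>k\<in>(UNIV \<rightarrow>\<^sub>E {- int M..int M}). (\<Prod>j\<in>UNIV. cos_power_coeff M (k j)) * integral torus (\<lambda>y. w y * cos (of_int_vec k \<bullet> (x - y))))"
proof -
  have "integral torus (\<lambda>y. w y * cos_kernel M (x - y)) =
    integral torus (\<lambda>y. \<Sum>k\<in>(UNIV \<rightarrow>\<^sub>E {- int M..int M}). (\<Prod>j\<in>UNIV. cos_power_coeff M (k j)) * (w y * cos (of_int_vec k \<bullet> (x - y))))"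
    by (simp add: cos_kernel_fourier sum_distrib_left mult_ac)
  also have "\<dots> = (\<Sum>k\<in>(UNIV \<rightarrow>\<^sub>E {- int M..int M}). integral torus (\<lambda>y. (\<Prod>j\<in>UNIV. cos_power_coeff M (k j)) * (w y * cos (of_int_vec k \<bullet> (x - y)))))"
    by (intro integral_sum integrable_continuous continuous_intros assms finite_PiE) auto
  finally show ?thesis by simp
qed

text \<open>By \<open>integral_torus_cos_eq_0\<close> only the frequency 0 of the expansion
  contributes.\<close>

lemma integral_cos_kernel:
  fixes x :: "real ^ 'n"
  shows "integral torus (\<lambda>y. cos_kernel M (x - y)) = (2 * pi * cos_power_coeff M 0) ^ CARD('n)"
proof -
  have z: "integral torus (\<lambda>y. cos (of_int_vec k \<bullet> (x - y))) = 0" if k: "k \<noteq> (\<lambda>_. 0)" for k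
  proof -
    obtain i where "k i \<noteq> 0" using k by blast
    then have "(- k) i \<noteq> 0" by simp
    then have "integral torus (\<lambda>y. cos (of_int_vec (- k) \<bullet> y + of_int_vec k \<bullet> x)) = 0" by (rule integral_torus_cos_eq_0)
    moreover have "of_int_vec (- k) \<bullet> y + of_int_vec k \<bullet> x = of_int_vec k \<bullet> (x - y)" for y
      by (simp add: inner_vec_def algebra_simps sum_subtractf sum_negf)
    ultimately show ?thesis by simp
  qed
  have "integral torus (\<lambda>y. 1 * cos_kernel M (x - y)) =
    (\<Sum>k\<in>(UNIV \<rightarrow>\<^sub>E {- int M..int M}). (\<Prod>j\<in>UNIV. cos_power_coeff M (k j)) * integral torus (\<lambda>y. 1 * cos (of_int_vec k \<bullet> (x - y))))"
    by (rule integral_mult_cos_kernel) auto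
  also have "\<dots> = (\<Sum>k\<in>{\<lambda>_. 0}. (\<Prod>j\<in>UNIV. cos_power_coeff M (k j)) * integral torus (\<lambda>y. 1 * cos (of_int_vec k \<bullet> (x - y))))"
    by (rule sum.mono_neutral_right) (auto intro!: finite_PiE simp: z)
  also have "\<dots> = cos_power_coeff M 0 ^ CARD('n) * (2 * pi) ^ CARD('n)"
  proof -
    have "of_int_vec (\<lambda>_. 0) = (0 :: real ^ 'n)" by (simp add: vec_eq_iff)
    then show ?thesis by (simp add: torus_const[of 1, simplified])
  qed
  finally show ?thesis by (simp add: power_mult_distrib mult_ac)
qed

lemma half_one_plus_cos:
  fixes t :: real
  shows "0 \<le> (1 + cos t) / 2" and "(1 + cos t) / 2 \<le> 1"
proof -
  define c where "c = cos t"
  have "- 1 \<le> c" "c \<le> 1" by (auto simp: c_def)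
  then have "0 \<le> 1 + c" "1 + c \<le> 2" by linarith+
  then have "0 \<le> (1 + c) / 2 \<and> (1 + c) / 2 \<le> 1" by simp
  then show "0 \<le> (1 + cos t) / 2" "(1 + cos t) / 2 \<le> 1" unfolding c_def by blast+
qed

lemma cos_kernel_nonneg: "cos_kernel M z \<ge> 0"
  unfolding cos_kernel_def by (intro prod_nonneg ballI zero_le_power half_one_plus_cos)

text \<open>One factor is small and the others are at most 1. The range pi + 1 is that of x - y for
  x in [-1, 1]^n and y in the torus; beyond pi the coordinate is reflected to 2 pi - |z_i|, which is
  at least pi - 1 and thus at least \<delta>.\<close>

lemma cos_kernel_far:
  fixes z :: "real ^ 'n"
  assumes "\<delta> \<le> \<bar>z $ i\<bar>" "\<bar>z $ i\<bar> \<le> pi + 1" "0 < \<delta>" "\<delta> \<le> 1"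
  shows "cos_kernel M z \<le> ((1 + cos \<delta>) / 2) ^ M"
proof -
  let ?c = "\<lambda>j. ((1 + cos (z $ j)) / 2) ^ M"
  note b = half_one_plus_cos[of "z $ j" for j]
  have "cos (z $ i) \<le> cos \<delta>"
  proof (cases "\<bar>z $ i\<bar> \<le> pi")
    case True
    then have "cos \<bar>z $ i\<bar> \<le> cos \<delta>" using assms by (intro cos_monotone_0_pi_le) auto
    then show ?thesis by simp
  next
    case False
    have "cos (2 * pi - \<bar>z $ i\<bar>) \<le> cos \<delta>" using assms False pi_ge_two by (intro cos_monotone_0_pi_le) auto
    moreover have "cos (2 * pi - \<bar>z $ i\<bar>) = cos \<bar>z $ i\<bar>" by (simp add: cos_diff)
    ultimately show ?thesis by simp
  qed
  then have 1: "?c i \<le> ((1 + cos \<delta>) / 2) ^ M" using b by (intro power_mono) auto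
  have "cos_kernel M z = ?c i * (\<Prod>j\<in>UNIV - {i}. ?c j)"
    unfolding cos_kernel_def by (rule prod.remove) auto
  also have "\<dots> \<le> ?c i * 1" using b by (intro mult_left_mono prod_le_1) (auto intro: power_le_one)
  finally show ?thesis using 1 by simp
qed

lemma continuous_on_cos_kernel: "continuous_on S (\<lambda>y. cos_kernel M (x - y))"
  unfolding cos_kernel_def by (intro continuous_intros) auto

text \<open>Where all coordinates of x - y are below \<delta>, continuity of w helps; elsewhere
  \<open>cos_kernel_far\<close> does. No periodicity of w is assumed: for x in [-1, 1]^n the
  translates of x by nonzero multiples of 2 pi in some coordinates lie outside the torus, so the
  kernel peaks only at y = x.\<close>

lemma cos_kernel_approx_identity:
  fixes w :: "real ^ 'n \<Rightarrow> real"
  assumes w: "continuous_on torus w" and x: "\<And>j. \<bar>x $ j\<bar> \<le> 1"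
  shows "(\<lambda>M. integral torus (\<lambda>y. w y * cos_kernel M (x - y)) / cos_power_coeff M 0 ^ CARD('n)) \<longlonglongrightarrow> (2 * pi) ^ CARD('n) * w x"
proof (rule LIMSEQ_I)
  let ?n = "CARD('n)" and ?V = "(2 * pi) ^ CARD('n)"
  have V: "?V > 0" by simp
  fix r :: real assume r: "r > 0"
  define e where "e = r / (2 * ?V)"
  have e: "e > 0" using r by (simp add: e_def)
  have xt: "x \<in> torus" using x pi_ge_two by (auto simp: mem_box_cart abs_le_iff) (smt (verit))+
  obtain W where W: "W > 0" "\<And>y. y \<in> torus \<Longrightarrow> \<bar>w y\<bar> \<le> W"
  proof -
    have "bounded (w ` torus)" by (intro compact_imp_bounded compact_continuous_image w) simp
    then show ?thesis using that unfolding bounded_pos by auto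
  qed
  obtain d where d: "d > 0" "\<And>y. y \<in> torus \<Longrightarrow> dist y x < d \<Longrightarrow> dist (w y) (w x) < e"
    using w xt e unfolding continuous_on_iff by meson
  define \<delta> where "\<delta> = min 1 (d / (2 * real ?n))"
  have \<delta>: "0 < \<delta>" "\<delta> \<le> 1" using d(1) by (auto simp: \<delta>_def)
  define q where "q = (1 + cos \<delta>) / 2"
  have "cos \<delta> < cos 0" using \<delta> pi_ge_two by (intro cos_monotone_0_pi) auto
  then have q: "0 \<le> q" "q < 1" using half_one_plus_cos(1)[of \<delta>] by (auto simp: q_def)
  have pt: "\<bar>(w y - w x) * cos_kernel M (x - y)\<bar> \<le> e * cos_kernel M (x - y) + 2 * W * q ^ M" if y: "y \<in> torus" for y M
  proof (cases "\<exists>i. \<delta> \<le> \<bar>(x - y) $ i\<bar>")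
    case True
    then obtain i where i: "\<delta> \<le> \<bar>(x - y) $ i\<bar>" by blast
    have "\<bar>y $ i\<bar> \<le> pi" using y by (auto simp: mem_box_cart abs_le_iff) (smt (verit))
    then have "\<bar>(x - y) $ i\<bar> \<le> pi + 1" using x[of i] by simp
    then have "cos_kernel M (x - y) \<le> q ^ M" unfolding q_def using cos_kernel_far[OF i _ \<delta>] by blast
    moreover have "\<bar>w y - w x\<bar> \<le> 2 * W" using W(2)[OF y] W(2)[OF xt] by linarith
    ultimately have "\<bar>w y - w x\<bar> * cos_kernel M (x - y) \<le> 2 * W * q ^ M"
      by (intro mult_mono) (use W(1) cos_kernel_nonneg in auto)
    moreover have "0 \<le> e * cos_kernel M (x - y)" using e cos_kernel_nonneg[of M "x - y"] by simp
    ultimately show ?thesis using cos_kernel_nonneg[of M "x - y"] by (simp add: abs_mult)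
  next
    case False
    have "norm (x - y) \<le> (\<Sum>i\<in>UNIV. \<bar>(x - y) $ i\<bar>)" by (rule norm_le_l1_cart)
    also have "\<dots> \<le> (\<Sum>i\<in>(UNIV :: 'n set). \<delta>)" using False by (intro sum_mono) (auto simp: not_le less_imp_le)
    also have "\<dots> = real ?n * \<delta>" by simp
    also have "\<dots> \<le> real ?n * (d / (2 * real ?n))" by (intro mult_left_mono) (auto simp: \<delta>_def)
    also have "\<dots> < d" using d(1) by simp
    finally have "dist (w y) (w x) < e" using d(2)[OF y] by (simp add: dist_norm norm_minus_commute)
    then have "\<bar>w y - w x\<bar> * cos_kernel M (x - y) \<le> e * cos_kernel M (x - y)"
      by (intro mult_right_mono cos_kernel_nonneg) (simp add: dist_real_def)
    moreover have "0 \<le> 2 * W * q ^ M" using W(1) q by simp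
    ultimately show ?thesis using cos_kernel_nonneg[of M "x - y"] by (simp add: abs_mult)
  qed
  have main: "\<bar>integral torus (\<lambda>y. w y * cos_kernel M (x - y)) - w x * (2 * pi * cos_power_coeff M 0) ^ ?n\<bar>
     \<le> e * (2 * pi * cos_power_coeff M 0) ^ ?n + 2 * W * q ^ M * ?V" for M
  proof -
    note ci = integrable_continuous continuous_intros w continuous_on_cos_kernel
    have "integral torus (\<lambda>y. w y * cos_kernel M (x - y)) - w x * (2 * pi * cos_power_coeff M 0) ^ ?n
        = integral torus (\<lambda>y. w y * cos_kernel M (x - y)) - integral torus (\<lambda>y. w x * cos_kernel M (x - y))"
      by (simp add: integral_cos_kernel)
    also have "\<dots> = integral torus (\<lambda>y. w y * cos_kernel M (x - y) - w x * cos_kernel M (x - y))"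
      by (rule integral_diff[symmetric]) (intro ci)+
    also have "\<dots> = integral torus (\<lambda>y. (w y - w x) * cos_kernel M (x - y))"
      by (simp add: algebra_simps)
    finally have eq: "integral torus (\<lambda>y. w y * cos_kernel M (x - y)) - w x * (2 * pi * cos_power_coeff M 0) ^ ?n = \<dots>" .
    have "norm (integral torus (\<lambda>y. (w y - w x) * cos_kernel M (x - y))) \<le> integral torus (\<lambda>y. e * cos_kernel M (x - y) + 2 * W * q ^ M)"
      by (rule integral_norm_bound_integral) (use pt in \<open>auto intro!: ci\<close>)
    also have "\<dots> = integral torus (\<lambda>y. e * cos_kernel M (x - y)) + integral (torus :: (real ^ 'n) set) (\<lambda>y. 2 * W * q ^ M)"
      by (rule integral_add) (intro ci)+
    also have "\<dots> = e * (2 * pi * cos_power_coeff M 0) ^ ?n + 2 * W * q ^ M * ?V"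
      by (simp only: integral_mult_right integral_cos_kernel torus_const)
    finally show ?thesis unfolding eq by simp
  qed
  have "(\<lambda>M. 2 * W * ?V * (q ^ M * (2 * real M) ^ ?n)) \<longlonglongrightarrow> 2 * W * ?V * 0"
  proof (intro tendsto_mult tendsto_const)
    have "(\<lambda>M. real M ^ ?n * q ^ M) \<longlonglongrightarrow> 0"
    proof -
      \<comment> \<open>Taking the n-th root of q reduces the claim to the convergence of M s^M to 0
        for s < 1.\<close>
      let ?s = "root ?n q"
      have s: "norm ?s < 1" "?s ^ ?n = q" using q by (auto simp: real_root_pow_pos2)
      have "(\<lambda>M. (real M * ?s ^ M) ^ ?n) \<longlonglongrightarrow> 0 ^ ?n"
        by (intro tendsto_power powser_times_n_limit_0 s)
      moreover have "(real M * ?s ^ M) ^ ?n = real M ^ ?n * q ^ M" for M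
      proof -
        have "(real M * ?s ^ M) ^ ?n = real M ^ ?n * (?s ^ ?n) ^ M"
          by (simp only: power_mult_distrib power_mult[symmetric] mult.commute[of M])
        then show ?thesis using s(2) by simp
      qed
      ultimately show ?thesis by (simp add: zero_power)
    qed
    then have "(\<lambda>M. 2 ^ ?n * (real M ^ ?n * q ^ M)) \<longlonglongrightarrow> 2 ^ ?n * 0" by (intro tendsto_mult tendsto_const)
    then show "(\<lambda>M. q ^ M * (2 * real M) ^ ?n) \<longlonglongrightarrow> 0" by (simp add: power_mult_distrib mult_ac)
  qed
  then have "\<forall>\<^sub>F M in sequentially. 2 * W * ?V * (q ^ M * (2 * real M) ^ ?n) < r / 2"
    using r by (intro order_tendstoD(2)) auto
  with eventually_gt_at_top[of 0]
  have "\<forall>\<^sub>F M in sequentially. norm (integral torus (\<lambda>y. w y * cos_kernel M (x - y)) / cos_power_coeff M 0 ^ ?n - ?V * w x) < r"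
  proof eventually_elim
    case (elim M)
    let ?b = "cos_power_coeff M 0 ^ ?n" and ?I = "integral torus (\<lambda>y. w y * cos_kernel M (x - y))"
    have b: "?b > 0" using cos_power_coeff_0_pos by simp
    have "1 \<le> ((2 * real M) * cos_power_coeff M 0) ^ ?n"
      using cos_power_coeff_0_ge[OF elim(1)] elim(1) by (intro one_le_power) (simp add: field_simps)
    then have b1: "1 / ?b \<le> (2 * real M) ^ ?n" using b by (simp add: field_simps power_mult_distrib)
    have "norm (?I / ?b - ?V * w x) = \<bar>?I - w x * (2 * pi * cos_power_coeff M 0) ^ ?n\<bar> / ?b"
    proof -
      have "?I / ?b - ?V * w x = (?I - w x * (2 * pi * cos_power_coeff M 0) ^ ?n) / ?b"
        using cos_power_coeff_0_pos[of M] by (simp add: power_mult_distrib diff_divide_distrib)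
      then show ?thesis using b by (simp only: real_norm_def abs_divide abs_of_pos)
    qed
    also have "\<dots> \<le> (e * (2 * pi * cos_power_coeff M 0) ^ ?n + 2 * W * q ^ M * ?V) / ?b"
      using b by (intro divide_right_mono main) auto
    also have "\<dots> = e * ?V + 2 * W * ?V * (q ^ M * (1 / ?b))"
      using cos_power_coeff_0_pos[of M] by (simp add: power_mult_distrib add_divide_distrib)
    also have "\<dots> \<le> e * ?V + 2 * W * ?V * (q ^ M * (2 * real M) ^ ?n)"
      using W(1) q b1 by (intro add_left_mono mult_left_mono) auto
    also have "\<dots> < r" using elim(2) V by (simp add: e_def)
    finally show ?case .
  qed
  then show "\<exists>no. \<forall>M\<ge>no. norm (integral torus (\<lambda>y. w y * cos_kernel M (x - y)) / cos_power_coeff M 0 ^ ?n - ?V * w x) < r"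
    by (simp add: eventually_sequentially)
qed

text \<open>Dominated convergence for series. A finite F carries both the sum of f and the sum of
  |f| up to r/3; on F the weights tend to 1, and off F they are bounded by 1, so the tail of |f|
  takes over.\<close>

lemma weighted_partial_sums_tendsto:
  fixes f :: "'a \<Rightarrow> real"
  assumes f: "f summable_on UNIV" and \<kappa>: "\<And>k. (\<lambda>M::nat. \<kappa> M k) \<longlonglongrightarrow> 1" "\<And>M k. \<bar>\<kappa> M k\<bar> \<le> 1"
    and S: "\<And>M. finite (S M)" "\<And>M k. k \<notin> S M \<Longrightarrow> \<kappa> M k = 0"
  shows "(\<lambda>M. \<Sum>k\<in>S M. \<kappa> M k * f k) \<longlonglongrightarrow> infsum f UNIV"
proof (rule LIMSEQ_I)
  fix r :: real assume r: "r > 0"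
  have fa: "(\<lambda>k. \<bar>f k\<bar>) summable_on UNIV" using f summable_on_iff_abs_summable_on_real[of f UNIV] by simp
  let ?s = "infsum f UNIV" and ?t = "infsum (\<lambda>k. \<bar>f k\<bar>) UNIV"
  have 1: "(sum f \<longlongrightarrow> ?s) (finite_subsets_at_top UNIV)" "(sum (\<lambda>k. \<bar>f k\<bar>) \<longlongrightarrow> ?t) (finite_subsets_at_top UNIV)"
    using has_sum_infsum[OF f] has_sum_infsum[OF fa] by (simp_all add: has_sum_def)
  have "\<forall>\<^sub>F F in finite_subsets_at_top UNIV. dist (sum f F) ?s < r/3 \<and> dist (sum (\<lambda>k. \<bar>f k\<bar>) F) ?t < r/3"
    using 1[THEN tendstoD, of "r/3"] r by (auto intro: eventually_conj)
  then obtain F where F: "finite F" "dist (sum f F) ?s < r/3" "dist (sum (\<lambda>k. \<bar>f k\<bar>) F) ?t < r/3"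
    unfolding eventually_finite_subsets_at_top by blast
  have "(\<lambda>M. \<Sum>k\<in>F. \<kappa> M k * f k) \<longlonglongrightarrow> (\<Sum>k\<in>F. 1 * f k)"
    by (intro tendsto_intros \<kappa>)
  then have "\<forall>\<^sub>F M in sequentially. dist (\<Sum>k\<in>F. \<kappa> M k * f k) (sum f F) < r/3"
    using r by (intro tendstoD) auto
  then have "\<forall>\<^sub>F M in sequentially. norm ((\<Sum>k\<in>S M. \<kappa> M k * f k) - ?s) < r"
  proof eventually_elim
    case (elim M)
    have "(\<Sum>k\<in>S M. \<kappa> M k * f k) = (\<Sum>k\<in>S M \<union> F. \<kappa> M k * f k)"
      by (rule sum.mono_neutral_left) (use S F(1) in auto)
    also have "\<dots> = (\<Sum>k\<in>F. \<kappa> M k * f k) + (\<Sum>k\<in>S M - F. \<kappa> M k * f k)"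
      by (subst Un_commute, subst Un_Diff_cancel[symmetric], rule sum.union_disjoint) (use S F(1) in auto)
    finally have a: "(\<Sum>k\<in>S M. \<kappa> M k * f k) = \<dots>" .
    have "\<bar>\<Sum>k\<in>S M - F. \<kappa> M k * f k\<bar> \<le> (\<Sum>k\<in>S M - F. \<bar>f k\<bar>)"
      by (rule order_trans[OF sum_abs]) (auto intro!: sum_mono mult_left_le_one_le \<kappa> simp: abs_mult)
    also have "\<dots> = sum (\<lambda>k. \<bar>f k\<bar>) (F \<union> (S M - F)) - sum (\<lambda>k. \<bar>f k\<bar>) F"
      using S F(1) by (subst sum.union_disjoint) auto
    also have "\<dots> \<le> ?t - sum (\<lambda>k. \<bar>f k\<bar>) F"
      using S F(1) by (intro diff_right_mono finite_sum_le_infsum fa) auto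
    also have "\<dots> < r/3" using F(3) unfolding dist_real_def by linarith
    finally show ?case using a elim F(2) unfolding dist_real_def real_norm_def by linarith
  qed
  then show "\<exists>no. \<forall>M\<ge>no. norm ((\<Sum>k\<in>S M. \<kappa> M k * f k) - ?s) < r"
    by (simp add: eventually_sequentially)
qed

text \<open>The sums damped by the kernel multipliers \<kappa> have two limits: the plain sum,
  because summability is given, and the value of w, by the approximate identity.\<close>

lemma torus_fourier_inversion:
  fixes w :: "real ^ 'n \<Rightarrow> real"
  assumes w: "continuous_on torus w" and x: "\<And>j. \<bar>x $ j\<bar> \<le> 1"
    and sm: "(\<lambda>k. integral torus (\<lambda>y. w y * cos (of_int_vec k \<bullet> (x - y)))) summable_on UNIV"
  shows "((\<lambda>k. integral torus (\<lambda>y. w y * cos (of_int_vec k \<bullet> (x - y)))) has_sum ((2 * pi) ^ CARD('n) * w x)) UNIV"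
proof -
  let ?I = "\<lambda>k. integral torus (\<lambda>y. w y * cos (of_int_vec k \<bullet> (x - y)))"
  define \<kappa> :: "nat \<Rightarrow> ('n \<Rightarrow> int) \<Rightarrow> real" where "\<kappa> M k = (\<Prod>j\<in>UNIV. cos_power_coeff M (k j) / cos_power_coeff M 0)" for M k
  have "(\<lambda>M. \<Sum>k\<in>(UNIV \<rightarrow>\<^sub>E {- int M..int M}). \<kappa> M k * ?I k) \<longlonglongrightarrow> infsum ?I UNIV"
  proof (rule weighted_partial_sums_tendsto[OF sm])
    show "(\<lambda>M. \<kappa> M k) \<longlonglongrightarrow> 1" for k
      using tendsto_prod[of UNIV "\<lambda>j M. cos_power_coeff M (k j) / cos_power_coeff M 0" "\<lambda>_. 1" sequentially, OF cos_power_coeff_ratio_tendsto]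
      by (simp add: \<kappa>_def)
    show "\<bar>\<kappa> M k\<bar> \<le> 1" for M k
    proof -
      have "0 \<le> cos_power_coeff M l / cos_power_coeff M 0" "cos_power_coeff M l / cos_power_coeff M 0 \<le> 1" for l
        using cos_power_coeff_nonneg cos_power_coeff_0_pos cos_power_coeff_le by (auto simp: divide_nonneg_nonneg)
      then show ?thesis unfolding \<kappa>_def by (subst abs_of_nonneg) (auto intro!: prod_nonneg prod_le_1)
    qed
    show "finite ((UNIV :: 'n set) \<rightarrow>\<^sub>E {- int M..int M})" for M by (intro finite_PiE) auto
    show "\<kappa> M k = 0" if k: "k \<notin> UNIV \<rightarrow>\<^sub>E {- int M..int M}" for M k
    proof -
      obtain j where "k j \<notin> {- int M..int M}" using k by (auto simp: PiE_iff)
      then have "cos_power_coeff M (k j) = 0" by (auto simp: cos_power_coeff_def)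
      then show ?thesis unfolding \<kappa>_def by (intro prod_zero) auto
    qed
  qed
  moreover have "(\<Sum>k\<in>(UNIV \<rightarrow>\<^sub>E {- int M..int M}). \<kappa> M k * ?I k) = integral torus (\<lambda>y. w y * cos_kernel M (x - y)) / cos_power_coeff M 0 ^ CARD('n)" for M
    unfolding integral_mult_cos_kernel[OF w] \<kappa>_def by (simp add: prod_dividef sum_divide_distrib)
  ultimately have "infsum ?I UNIV = (2 * pi) ^ CARD('n) * w x"
    using cos_kernel_approx_identity[OF w x] LIMSEQ_unique by fastforce
  then show ?thesis using has_sum_infsum[OF sm] by simp
qed

section \<open>Decay of Fourier coefficients\<close>

lemma has_derivative_tensor_prod:
  fixes y :: "real ^ 'n" and \<psi> :: "nat \<Rightarrow> real \<Rightarrow> real"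
  assumes "\<And>i. (\<psi> (\<alpha> i) has_real_derivative \<psi> (Suc (\<alpha> i)) (y $ i)) (at (y $ i))"
  shows "((\<lambda>y. \<Prod>i\<in>UNIV. \<psi> (\<alpha> i) (y $ i)) has_derivative
      (\<lambda>h. (\<chi> j. \<Prod>i\<in>UNIV. \<psi> ((\<alpha>(j := Suc (\<alpha> j))) i) (y $ i)) \<bullet> h)) (at y)"
proof -
  have "((\<lambda>y. \<psi> (\<alpha> i) (y $ i)) has_derivative (\<lambda>h. \<psi> (Suc (\<alpha> i)) (y $ i) * h $ i)) (at y)" for i
  proof -
    have "((\<lambda>y. y $ i) has_derivative (\<lambda>h. h $ i)) (at y)"
      by (intro bounded_linear_imp_has_derivative bounded_linear_vec_nth)
    from has_derivative_compose[OF this assms[of i, unfolded has_field_derivative_def]] show ?thesis .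
  qed
  then have "((\<lambda>y. \<Prod>i\<in>UNIV. \<psi> (\<alpha> i) (y $ i)) has_derivative
      (\<lambda>h. \<Sum>j\<in>UNIV. \<psi> (Suc (\<alpha> j)) (y $ j) * h $ j * (\<Prod>i\<in>UNIV - {j}. \<psi> (\<alpha> i) (y $ i)))) (at y)"
    by (intro has_derivative_prod) auto
  moreover have "(\<Prod>i\<in>UNIV. \<psi> ((\<alpha>(j := Suc (\<alpha> j))) i) (y $ i)) =
      \<psi> (Suc (\<alpha> j)) (y $ j) * (\<Prod>i\<in>UNIV - {j}. \<psi> (\<alpha> i) (y $ i))" for j
    by (subst prod.remove[of _ j]) (auto intro!: prod.cong)
  ultimately show ?thesis by (simp add: inner_vec_def mult_ac)
qed

text \<open>The test function is the cut-off product times cos (\<xi> . y + \<theta> - pi/2). Its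
  gradient has a part that differentiates the cut-off, and a part \<xi> times the original cut-off
  and cosine, because -sin (s - pi/2) = cos s. In the weak identity l \<xi> = e_q leaves precisely
  component q of the second part. All \<alpha> i lie below N so that one more derivative of each
  factor exists.\<close>

lemma fourier_recursion:
  fixes v :: "real ^ 'n \<Rightarrow> real ^ 'm" and D :: "real ^ 'n \<Rightarrow> real ^ 'n ^ 'm" and l :: "real ^ 'n ^ 'm"
    and \<xi> :: "real ^ 'n" and \<psi> :: "nat \<Rightarrow> real \<Rightarrow> real" and \<alpha> :: "'n \<Rightarrow> nat"
  defines "I \<equiv> \<lambda>p \<alpha> \<theta>. integral torus (\<lambda>y. v y $ p * (\<Prod>i\<in>UNIV. \<psi> (\<alpha> i) (y $ i)) * cos (\<xi> \<bullet> y + \<theta>))"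
  assumes der: "\<And>x. x \<in> torus \<Longrightarrow> (v has_derivative (\<lambda>h. D x *v h)) (at x)"
    and orth: "\<And>x. x \<in> torus \<Longrightarrow> l \<bullet> D x = 0" and l: "l *v \<xi> = axis q 1"
    and cut: "cutoff_sequence N \<psi>"
    and \<alpha>: "\<And>i. \<alpha> i < N"
  shows "I q \<alpha> \<theta> = - (\<Sum>p\<in>UNIV. \<Sum>j\<in>UNIV. l $ p $ j * I p (\<alpha>(j := Suc (\<alpha> j))) (\<theta> - pi / 2))"
proof -
  note \<psi> = cutoff_sequenceD(1)[OF cut] and c = cutoff_sequenceD(2)[OF cut] and supp = cutoff_sequenceD(4)[OF cut]
  define \<phi> where "\<phi> \<alpha> y = (\<Prod>i\<in>UNIV. \<psi> (\<alpha> i) (y $ i))" for \<alpha> and y :: "real ^ 'n"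
  define \<beta> where "\<beta> j = \<alpha>(j := Suc (\<alpha> j))" for j
  have \<beta>: "\<beta> j i \<le> N" for i j using \<alpha>[of i] by (auto simp: \<beta>_def less_imp_le)
  define X where "X y = (\<chi> j. \<phi> (\<beta> j) y * cos (\<xi> \<bullet> y + (\<theta> - pi / 2)) + \<xi> $ j * (\<phi> \<alpha> y * cos (\<xi> \<bullet> y + \<theta>)))" for y
  have vc: "continuous_on torus v"
    by (intro continuous_at_imp_continuous_on ballI has_derivative_continuous[OF der])
  have c\<phi>: "continuous_on S (\<phi> \<gamma>)" if "\<And>i. \<gamma> i \<le> N" for \<gamma> S
    unfolding \<phi>_def
    by (intro continuous_on_prod continuous_on_compose2[OF c[OF that]] continuous_intros) auto
  have c\<alpha>: "continuous_on S (\<phi> \<alpha>)" "continuous_on S (\<phi> (\<beta> j))" for S j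
    by (rule c\<phi>, use \<alpha> in \<open>simp add: less_imp_le\<close>) (rule c\<phi>, rule \<beta>)
  have sin_eq: "- sin (\<xi> \<bullet> y + (\<theta> - pi / 2)) = cos (\<xi> \<bullet> y + \<theta>)" for y
    using sin_diff[of "\<xi> \<bullet> y + \<theta>" "pi / 2"] by (simp add: add_diff_eq)
  have "(\<Sum>p\<in>UNIV. \<Sum>j\<in>UNIV. l $ p $ j * integral torus (\<lambda>y. v y $ p * X y $ j)) = 0"
  proof (rule weak_identity[OF der orth, where \<eta> = "\<lambda>y. \<phi> \<alpha> y * cos (\<xi> \<bullet> y + (\<theta> - pi / 2))" and h = "2 * pi"])
    fix y :: "real ^ 'n"
    have 1: "(\<phi> \<alpha> has_derivative (\<lambda>h. (\<chi> j. \<phi> (\<beta> j) y) \<bullet> h)) (at y)"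
      unfolding \<phi>_def \<beta>_def by (rule has_derivative_tensor_prod) (rule \<psi>[OF \<alpha>])
    have 2: "((\<lambda>y. cos (\<xi> \<bullet> y + (\<theta> - pi / 2))) has_derivative (\<lambda>h. cos (\<xi> \<bullet> y + \<theta>) * (\<xi> \<bullet> h))) (at y)"
      by (rule has_derivative_eq_rhs, (rule derivative_intros | simp)+) (auto simp: sin_eq[symmetric])
    have "\<phi> \<alpha> y * (cos (\<xi> \<bullet> y + \<theta>) * (\<xi> \<bullet> h)) + (\<chi> j. \<phi> (\<beta> j) y) \<bullet> h * cos (\<xi> \<bullet> y + (\<theta> - pi / 2)) = X y \<bullet> h" for h
      by (simp add: X_def inner_vec_def sum.distrib algebra_simps sum_distrib_left sum_distrib_right)
    then show "((\<lambda>y. \<phi> \<alpha> y * cos (\<xi> \<bullet> y + (\<theta> - pi / 2))) has_derivative (\<lambda>h. X y \<bullet> h)) (at y)"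
      using has_derivative_mult[OF 1 2] by simp
  next
    show "continuous_on torus X"
      unfolding X_def by (intro continuous_on_vec_lambda continuous_intros c\<alpha>)
  next
    fix y :: "real ^ 'n" and j
    assume "y $ j = (\<chi> i. - pi) $ j \<or> y $ j = (\<chi> i. pi) $ j"
    then have "\<psi> (\<alpha> j) (y $ j) = 0" using \<alpha>[of j] pi_ge_two by (intro supp) auto
    then show "\<phi> \<alpha> y * cos (\<xi> \<bullet> y + (\<theta> - pi / 2)) = 0" by (auto simp: \<phi>_def)
  qed auto
  moreover have "integral torus (\<lambda>y. v y $ p * X y $ j) = I p (\<beta> j) (\<theta> - pi / 2) + \<xi> $ j * I p \<alpha> \<theta>" for p j
  proof -
    have "integral torus (\<lambda>y. v y $ p * X y $ j) = integral torus (\<lambda>y. v y $ p * \<phi> (\<beta> j) y * cos (\<xi> \<bullet> y + (\<theta> - pi / 2))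
        + \<xi> $ j * (v y $ p * \<phi> \<alpha> y * cos (\<xi> \<bullet> y + \<theta>)))"
      by (simp add: X_def algebra_simps)
    also have "\<dots> = integral torus (\<lambda>y. v y $ p * \<phi> (\<beta> j) y * cos (\<xi> \<bullet> y + (\<theta> - pi / 2)))
        + integral torus (\<lambda>y. \<xi> $ j * (v y $ p * \<phi> \<alpha> y * cos (\<xi> \<bullet> y + \<theta>)))"
      by (intro integral_add integrable_continuous continuous_intros c\<alpha> vc)
    finally show ?thesis by (simp add: I_def \<phi>_def)
  qed
  ultimately have "0 = (\<Sum>p\<in>UNIV. \<Sum>j\<in>UNIV. l $ p $ j * I p (\<beta> j) (\<theta> - pi / 2)) + (\<Sum>p\<in>UNIV. \<Sum>j\<in>UNIV. l $ p $ j * \<xi> $ j * I p \<alpha> \<theta>)"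
    by (simp add: algebra_simps sum.distrib)
  also have "(\<Sum>p\<in>UNIV. \<Sum>j\<in>UNIV. l $ p $ j * \<xi> $ j * I p \<alpha> \<theta>) = (\<Sum>p\<in>UNIV. (l *v \<xi>) $ p * I p \<alpha> \<theta>)"
    by (simp add: matrix_vector_mult_def sum_distrib_right)
  also have "\<dots> = I q \<alpha> \<theta>" by (simp add: l axis_def if_distrib[of "\<lambda>x. x * _"] cong: if_cong)
  finally have "I q \<alpha> \<theta> = - (\<Sum>p\<in>UNIV. \<Sum>j\<in>UNIV. l $ p $ j * I p (\<beta> j) (\<theta> - pi / 2))" by linarith
  then show ?thesis unfolding \<beta>_def .
qed

text \<open>Each use of \<open>fourier_recursion\<close> costs a factor C / |\<xi>| from l, a sum
  over the entries of an m by n matrix, and a factor 4 N for one derivative of the cut-off. The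
  constant depends on L but not on v, N, the cut-off or the phase. The power of |\<xi>| stands on
  the left so that \<xi> = 0 is included.\<close>

lemma fourier_decay:
  fixes L :: "(real ^ 'n ^ 'm) set"
  assumes "subspace L" "no_rank1_connections L"
  shows "\<exists>C\<ge>1. \<forall>(v :: real ^ 'n \<Rightarrow> real ^ 'm) D V N \<psi> \<xi> p \<theta> j.
    (\<forall>x\<in>torus. (v has_derivative (\<lambda>h. D x *v h)) (at x) \<and> D x \<in> L \<and> (\<forall>p. \<bar>v x $ p\<bar> \<le> V)) \<longrightarrow>
    cutoff_sequence N \<psi> \<longrightarrow> j \<le> N \<longrightarrow>
    \<bar>integral torus (\<lambda>y. v y $ p * (\<Prod>i\<in>UNIV. \<psi> 0 (y $ i)) * cos (\<xi> \<bullet> y + \<theta>))\<bar> * norm \<xi> ^ j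
      \<le> V * (2 * pi) ^ CARD('n) * (C * real N) ^ j"
proof -
  obtain C where C: "C > 0" "\<And>\<xi> i. \<xi> \<noteq> 0 \<Longrightarrow> \<exists>l :: real ^ 'n ^ 'm. (\<forall>A\<in>L. l \<bullet> A = 0) \<and> l *v \<xi> = axis i 1 \<and>
      (\<forall>p j. \<bar>l $ p $ j\<bar> \<le> C / norm \<xi>)"
    using elliptic_dual[OF assms] by blast
  define C1 where "C1 = C * real CARD('m) * real CARD('n)"
  have C1: "C1 > 0" using C(1) by (simp add: C1_def)
  have main: "\<bar>integral torus (\<lambda>y. v y $ p * (\<Prod>i\<in>UNIV. \<psi> 0 (y $ i)) * cos (\<xi> \<bullet> y + \<theta>))\<bar> * norm \<xi> ^ j
        \<le> V * (2 * pi) ^ CARD('n) * ((4 * C1 + 1) * real N) ^ j"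
    if der: "\<And>x. x \<in> torus \<Longrightarrow> (v has_derivative (\<lambda>h. D x *v h)) (at x)"
      and DL: "\<And>x. x \<in> torus \<Longrightarrow> D x \<in> L"
      and V: "\<And>x p. x \<in> torus \<Longrightarrow> \<bar>v x $ p\<bar> \<le> V"
      and cut: "cutoff_sequence N \<psi>" and jN: "j \<le> N"
    for v :: "real ^ 'n \<Rightarrow> real ^ 'm" and D V N \<psi> \<xi> p \<theta> j
  proof -
    note c = cutoff_sequenceD(2)[OF cut] and b = cutoff_sequenceD(3)[OF cut]
    define I where "I = (\<lambda>p \<alpha> \<theta>. integral torus (\<lambda>y. v y $ p * (\<Prod>i\<in>UNIV. \<psi> (\<alpha> i) (y $ i)) * cos (\<xi> \<bullet> y + \<theta>)))"
    let ?V = "V * (2 * pi) ^ CARD('n)"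
    have vc: "continuous_on torus v"
      by (intro continuous_at_imp_continuous_on ballI has_derivative_continuous[OF der])
    have "0 \<in> (torus :: (real ^ 'n) set)" by (auto simp: mem_box_cart)
    then have V0: "V \<ge> 0" using V[of 0 undefined] by linarith
    have comp: "\<alpha> i \<le> sum \<alpha> UNIV" for \<alpha> :: "'n \<Rightarrow> nat" and i
      by (rule member_le_sum) auto
    \<comment> \<open>The induction on j treats all \<alpha> at once: a step lowers j by one and
      raises the order of \<alpha> by one, so the total order on the right is unchanged and never
      exceeds N.\<close>
    have "\<bar>I p \<alpha> \<theta>\<bar> * norm \<xi> ^ j \<le> ?V * C1 ^ j * (4 * real N) ^ (sum \<alpha> UNIV + j)"
      if "sum \<alpha> UNIV + j \<le> N" for p \<alpha> \<theta> j
      using that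
    proof (induction j arbitrary: p \<alpha> \<theta>)
      case 0
      have \<alpha>: "\<alpha> i \<le> N" for i using comp[of \<alpha> i] 0 by simp
      have "norm (I p \<alpha> \<theta>) \<le> integral (torus :: (real ^ 'n) set) (\<lambda>y. V * (4 * real N) ^ sum \<alpha> UNIV)"
        unfolding I_def
      proof (rule integral_norm_bound_integral)
        show "(\<lambda>y. v y $ p * (\<Prod>i\<in>UNIV. \<psi> (\<alpha> i) (y $ i)) * cos (\<xi> \<bullet> y + \<theta>)) integrable_on torus"
          by (intro integrable_continuous continuous_intros vc continuous_on_compose2[OF c[OF \<alpha>]]) auto
        fix y :: "real ^ 'n" assume y: "y \<in> torus"
        have "\<bar>\<Prod>i\<in>UNIV. \<psi> (\<alpha> i) (y $ i)\<bar> \<le> (\<Prod>i\<in>UNIV. (4 * real N) ^ \<alpha> i)"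
          unfolding abs_prod by (rule prod_mono) (use b[OF \<alpha>] in auto)
        also have "\<dots> = (4 * real N) ^ sum \<alpha> UNIV" by (simp add: power_sum)
        finally have "\<bar>\<Prod>i\<in>UNIV. \<psi> (\<alpha> i) (y $ i)\<bar> \<le> \<dots>" .
        then have "\<bar>v y $ p\<bar> * \<bar>\<Prod>i\<in>UNIV. \<psi> (\<alpha> i) (y $ i)\<bar> * \<bar>cos (\<xi> \<bullet> y + \<theta>)\<bar> \<le> V * (4 * real N) ^ sum \<alpha> UNIV * 1"
          using V[OF y, of p] V0 by (intro mult_mono) auto
        then show "norm (v y $ p * (\<Prod>i\<in>UNIV. \<psi> (\<alpha> i) (y $ i)) * cos (\<xi> \<bullet> y + \<theta>)) \<le> V * (4 * real N) ^ sum \<alpha> UNIV"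
          by (simp add: abs_mult)
      qed auto
      then show ?case by (simp add: torus_const mult_ac del: integral_const)
    next
      case (Suc j)
      show ?case
      proof (cases "\<xi> = 0")
        case True
        then show ?thesis using V0 C1 by simp
      next
        case False
        obtain l :: "real ^ 'n ^ 'm" where l: "\<And>A. A \<in> L \<Longrightarrow> l \<bullet> A = 0" "l *v \<xi> = axis p 1"
          "\<And>p j. \<bar>l $ p $ j\<bar> \<le> C / norm \<xi>"
          using C(2)[OF False, of p] by blast
        have \<alpha>: "\<alpha> i < N" for i using comp[of \<alpha> i] Suc.prems by simp
        let ?\<beta> = "\<lambda>i. \<alpha>(i := Suc (\<alpha> i))"
        have s\<beta>: "sum (?\<beta> i) UNIV = Suc (sum \<alpha> UNIV)" for i
        proof -
          have "sum (?\<beta> i) UNIV = Suc (\<alpha> i) + sum \<alpha> (UNIV - {i})"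
            by (subst sum.remove[of _ i]) (auto intro!: sum.cong)
          also have "\<dots> = Suc (sum \<alpha> UNIV)" by (subst (2) sum.remove[of _ i]) auto
          finally show ?thesis .
        qed
        let ?B = "?V * C1 ^ j * (4 * real N) ^ (sum \<alpha> UNIV + Suc j)"
        have IH: "\<bar>I q (?\<beta> i) (\<theta> - pi / 2)\<bar> * norm \<xi> ^ j \<le> ?B" for q i
        proof -
          have "sum (?\<beta> i) UNIV + j = sum \<alpha> UNIV + Suc j" using s\<beta>[of i] by simp
          then show ?thesis using Suc.IH[of "?\<beta> i" q "\<theta> - pi / 2"] Suc.prems by metis
        qed
        have eq: "I p \<alpha> \<theta> = - (\<Sum>q\<in>UNIV. \<Sum>i\<in>UNIV. l $ q $ i * I q (?\<beta> i) (\<theta> - pi / 2))"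
          unfolding I_def by (rule fourier_recursion[where D = D and N = N and \<psi> = \<psi> and v = v])
            (use der l(1,2) DL cut \<alpha> in auto)
        have "\<bar>I p \<alpha> \<theta>\<bar> * norm \<xi> ^ Suc j = norm \<xi> * \<bar>\<Sum>q\<in>UNIV. \<Sum>i\<in>UNIV. l $ q $ i * I q (?\<beta> i) (\<theta> - pi / 2)\<bar> * norm \<xi> ^ j"
          unfolding eq by (simp add: mult_ac)
        also have "\<dots> \<le> norm \<xi> * (\<Sum>q\<in>UNIV. \<Sum>i\<in>UNIV. C / norm \<xi> * \<bar>I q (?\<beta> i) (\<theta> - pi / 2)\<bar>) * norm \<xi> ^ j"
        proof -
          have "\<bar>l $ q $ i * I q (?\<beta> i) (\<theta> - pi / 2)\<bar> \<le> C / norm \<xi> * \<bar>I q (?\<beta> i) (\<theta> - pi / 2)\<bar>" for q i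
            unfolding abs_mult by (rule mult_right_mono[OF l(3) abs_ge_zero])
          then show ?thesis
            by (intro mult_left_mono mult_right_mono order_trans[OF sum_abs] sum_mono) auto
        qed
        also have "\<dots> = (\<Sum>q\<in>UNIV. \<Sum>i\<in>UNIV. C * (\<bar>I q (?\<beta> i) (\<theta> - pi / 2)\<bar> * norm \<xi> ^ j))"
          using False by (simp add: sum_distrib_left sum_distrib_right mult_ac)
        also have "\<dots> \<le> (\<Sum>q\<in>(UNIV :: 'm set). \<Sum>i\<in>(UNIV :: 'n set). C * ?B)"
          using C(1) by (intro sum_mono mult_left_mono IH) auto
        also have "\<dots> = ?V * C1 ^ Suc j * (4 * real N) ^ (sum \<alpha> UNIV + Suc j)"
          by (simp add: C1_def)
        finally show ?thesis .
      qed
    qed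
    from this[of "\<lambda>_. 0" j p \<theta>] jN
    have "\<bar>I p (\<lambda>_. 0) \<theta>\<bar> * norm \<xi> ^ j \<le> ?V * ((4 * C1) * real N) ^ j"
      by (simp add: power_mult_distrib mult_ac)
    also have "\<dots> \<le> ?V * ((4 * C1 + 1) * real N) ^ j"
      using V0 C1 by (intro mult_left_mono power_mono mult_right_mono) auto
    finally show ?thesis by (simp add: I_def)
  qed
  show ?thesis
  \<comment> \<open>The 4 comes from the bound on the cut-off. The added 1 gives a constant of at
    least 1, so that later powers of C N increase with the exponent.\<close>
  proof (intro exI[of _ "4 * C1 + 1"] conjI allI impI)
    show "4 * C1 + 1 \<ge> 1" using C1 by simp
  qed (rule main; blast)
qed

section \<open>Summable weights on the integer lattice\<close>

lemma summable_on_prod_UNIV: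
  fixes f :: "'b \<Rightarrow> real"
  assumes "f summable_on UNIV" and nn: "\<And>b. f b \<ge> 0"
  shows "(\<lambda>g :: 'a::finite \<Rightarrow> 'b. \<Prod>j\<in>UNIV. f (g j)) summable_on UNIV"
proof (rule nonneg_bdd_above_summable_on)
  show "bdd_above (sum (\<lambda>g :: 'a \<Rightarrow> 'b. \<Prod>j\<in>UNIV. f (g j)) ` {F. F \<subseteq> UNIV \<and> finite F})"
  proof (rule bdd_aboveI2)
    fix F :: "('a \<Rightarrow> 'b) set" assume "F \<in> {F. F \<subseteq> UNIV \<and> finite F}"
    then have F: "finite F" by simp
    \<comment> \<open>All values of the functions in F. So F is contained in the finite box of
      functions into S, over which the sum of products factorises.\<close>
    define S where "S = (\<Union>g\<in>F. range g)"
    have S: "finite S" using F by (simp add: S_def)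
    have "(\<Sum>g\<in>F. \<Prod>j\<in>UNIV. f (g j)) \<le> (\<Sum>g\<in>((UNIV :: 'a set) \<rightarrow>\<^sub>E S). \<Prod>j\<in>UNIV. f (g j))"
    proof (rule sum_mono2)
      show "finite (UNIV \<rightarrow>\<^sub>E S :: ('a \<Rightarrow> 'b) set)" by (intro finite_PiE S) simp
      show "F \<subseteq> UNIV \<rightarrow>\<^sub>E S" by (auto simp: S_def)
    qed (auto intro: prod_nonneg nn)
    also have "\<dots> = (\<Prod>j\<in>(UNIV :: 'a set). \<Sum>b\<in>S. f b)"
      by (rule prod_sum_PiE[symmetric]) (use S in auto)
    also have "\<dots> \<le> (\<Prod>j\<in>(UNIV :: 'a set). infsum f UNIV)"
      using S nn assms by (intro prod_mono conjI sum_nonneg finite_sum_le_infsum) auto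
    finally show "(\<Sum>g\<in>F. \<Prod>j\<in>UNIV. f (g j)) \<le> (\<Prod>j\<in>(UNIV :: 'a set). infsum f UNIV)" .
  qed
qed (auto intro: prod_nonneg nn)

lemma summable_on_dominated:
  fixes f g :: "'a \<Rightarrow> real"
  assumes "g summable_on A" and "\<And>k. k \<in> A \<Longrightarrow> \<bar>f k\<bar> \<le> K * g k"
  shows "f summable_on A"
proof -
  have "(\<lambda>k. K * g k) summable_on A" by (rule summable_on_cmult_right[OF assms(1)])
  then have "(\<lambda>k. norm (f k)) summable_on A"
    by (rule summable_on_comparison_test) (use assms(2) in auto)
  then show ?thesis by (rule summable_on_iff_abs_summable_on_real[THEN iffD2])
qed

lemma summable_on_inverse_one_plus_square_int:
  "(\<lambda>l :: int. 1 / (1 + (real_of_int l)\<^sup>2)) summable_on UNIV"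
proof -
  let ?f = "\<lambda>l :: int. 1 / (1 + (real_of_int l)\<^sup>2)"
  have "summable (\<lambda>n. norm (1 / (1 + (real n)\<^sup>2)))"
  proof (rule summable_comparison_test'[of "\<lambda>n. inverse ((real n)\<^sup>2)" 1])
    show "summable (\<lambda>n. inverse ((real n)\<^sup>2))" by (rule inverse_power_summable) simp
    show "norm (norm (1 / (1 + (real n)\<^sup>2))) \<le> inverse ((real n)\<^sup>2)" if "n \<ge> 1" for n
    proof -
      have "1 / (1 + (real n)\<^sup>2) \<le> 1 / (real n)\<^sup>2" using that by (intro divide_left_mono mult_pos_pos add_pos_nonneg) auto
      then show ?thesis by (simp add: inverse_eq_divide)
    qed
  qed
  then have n: "(\<lambda>n. 1 / (1 + (real n)\<^sup>2)) summable_on UNIV" by (rule norm_summable_imp_summable_on)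
  have 1: "?f summable_on (range int)"
    by (subst summable_on_reindex) (use n in \<open>auto simp: o_def\<close>)
  have 2: "?f summable_on (range (\<lambda>n. - int n))"
    by (subst summable_on_reindex) (use n in \<open>auto simp: o_def inj_on_def\<close>)
  have "?f summable_on (range int \<union> range (\<lambda>n. - int n))"
    by (rule summable_on_union[OF 1 2])
  moreover have "range int \<union> range (\<lambda>n. - int n) = UNIV"
  proof -
    have "l \<in> range int \<union> range (\<lambda>n. - int n)" for l
      by (cases l rule: int_cases2) auto
    then show ?thesis by blast
  qed
  ultimately show ?thesis by simp
qed

text \<open>The product form reduces summability to one dimension. By \<open>freq_weight_ge\<close>,
  gaining this weight costs 2 n powers of |k|; this is the origin of every shift by
  \<open>2 * CARD('n)\<close> below.\<close>

definition freq_weight :: "('n::finite \<Rightarrow> int) \<Rightarrow> real" where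
  "freq_weight k = (\<Prod>j\<in>UNIV. 1 / (1 + (real_of_int (k j))\<^sup>2))"

lemma freq_weight_pos: "freq_weight k > 0"
  unfolding freq_weight_def by (intro prod_pos) (auto intro!: divide_pos_pos add_pos_nonneg)

lemma summable_on_freq_weight: "freq_weight summable_on UNIV"
  unfolding freq_weight_def[abs_def]
  by (rule summable_on_prod_UNIV[OF summable_on_inverse_one_plus_square_int]) auto

text \<open>A nonzero integer vector has norm at least 1, so each factor 1 + k_j^2 is at most 2
  |k|^2.\<close>

lemma freq_weight_ge:
  fixes k :: "'n::finite \<Rightarrow> int"
  assumes "k \<noteq> (\<lambda>_. 0)"
  shows "1 \<le> 2 ^ CARD('n) * norm (of_int_vec k) ^ (2 * CARD('n)) * freq_weight k"
proof -
  let ?k = "of_int_vec k"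
  obtain i where "k i \<noteq> 0" using assms by blast
  then have "1 \<le> \<bar>?k $ i\<bar>" by simp
  then have n1: "1 \<le> norm ?k" using component_le_norm_cart[of ?k i] by linarith
  have "1 + (real_of_int (k j))\<^sup>2 \<le> 2 * (norm ?k)\<^sup>2" for j
  proof -
    have "\<bar>?k $ j\<bar>\<^sup>2 \<le> (norm ?k)\<^sup>2" by (intro power_mono component_le_norm_cart) auto
    moreover have "1 \<le> (norm ?k)\<^sup>2" using n1 by simp
    ultimately show ?thesis by simp
  qed
  then have "(\<Prod>j\<in>UNIV. 1 + (real_of_int (k j))\<^sup>2) \<le> (\<Prod>j\<in>(UNIV :: 'n set). 2 * (norm ?k)\<^sup>2)"
    by (intro prod_mono) (auto intro: add_nonneg_nonneg)
  also have "\<dots> = 2 ^ CARD('n) * norm ?k ^ (2 * CARD('n))"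
    by (simp add: power_mult_distrib power_mult)
  finally have "(\<Prod>j\<in>UNIV. 1 + (real_of_int (k j))\<^sup>2) * freq_weight k \<le> 2 ^ CARD('n) * norm ?k ^ (2 * CARD('n)) * freq_weight k"
    by (rule mult_right_mono[OF _ less_imp_le[OF freq_weight_pos]])
  moreover have "(\<Prod>j\<in>UNIV. 1 + (real_of_int (k j))\<^sup>2) * freq_weight k = 1"
  proof -
    have "(1 + (real_of_int (k j))\<^sup>2) * (1 / (1 + (real_of_int (k j))\<^sup>2)) = 1" for j
      by (simp add: add_nonneg_eq_0_iff)
    then show ?thesis by (simp add: freq_weight_def flip: prod.distrib)
  qed
  ultimately show ?thesis by simp
qed

text \<open>Z belongs to v multiplied by the cut-off of order N, which is 1 on [-1, 1]^n, so there
  the series represents v itself. Z varies with N and p, whereas C and A do not.\<close>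

lemma local_fourier_expansion:
  fixes L :: "(real ^ 'n ^ 'm) set" and v :: "real ^ 'n \<Rightarrow> real ^ 'm"
  assumes "subspace L" "no_rank1_connections L"
    and der: "\<And>x. x \<in> torus \<Longrightarrow> (v has_derivative (\<lambda>h. D x *v h)) (at x)"
    and DL: "\<And>x. x \<in> torus \<Longrightarrow> D x \<in> L"
  obtains C A where "C \<ge> 1" "A \<ge> 0"
    "\<And>N p. N \<ge> 2 * CARD('n) \<Longrightarrow> \<exists>Z. (\<forall>x. (\<forall>j. \<bar>x $ j\<bar> \<le> 1) \<longrightarrow> ((\<lambda>k. Re (Z k * cis (of_int_vec k \<bullet> x))) has_sum v x $ p) UNIV) \<and>
       (\<forall>k j. j + 2 * CARD('n) \<le> N \<longrightarrow> norm (Z k) * norm (of_int_vec k :: real ^ 'n) ^ j \<le> A * (C * real N) ^ (j + 2 * CARD('n)) * freq_weight k)"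
proof -
  let ?n = "CARD('n)"
  obtain C where C: "C \<ge> 1" and decay: "\<forall>(v :: real ^ 'n \<Rightarrow> real ^ 'm) D V N \<psi> \<xi> p \<theta> j.
    (\<forall>x\<in>torus. (v has_derivative (\<lambda>h. D x *v h)) (at x) \<and> D x \<in> L \<and> (\<forall>p. \<bar>v x $ p\<bar> \<le> V)) \<longrightarrow>
    cutoff_sequence N \<psi> \<longrightarrow> j \<le> N \<longrightarrow>
    \<bar>integral torus (\<lambda>y. v y $ p * (\<Prod>i\<in>UNIV. \<psi> 0 (y $ i)) * cos (\<xi> \<bullet> y + \<theta>))\<bar> * norm \<xi> ^ j
      \<le> V * (2 * pi) ^ CARD('n) * (C * real N) ^ j"
    using fourier_decay[OF assms(1,2)] by (elim exE conjE)
  have vc: "continuous_on torus v"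
    by (intro continuous_at_imp_continuous_on ballI has_derivative_continuous[OF der])
  obtain V where V: "V > 0" "\<And>x p. x \<in> torus \<Longrightarrow> \<bar>v x $ p\<bar> \<le> V"
  proof -
    have "bounded (v ` torus)" by (intro compact_imp_bounded compact_continuous_image vc) simp
    then obtain V where "V > 0" "\<And>x. x \<in> torus \<Longrightarrow> norm (v x) \<le> V" unfolding bounded_pos by auto
    moreover have "\<bar>v x $ p\<bar> \<le> norm (v x)" for x p by (rule component_le_norm_cart)
    ultimately show ?thesis by (intro that) (auto intro: order_trans)
  qed
  define A where "A = 2 * V * 2 ^ ?n"
  have A: "A \<ge> 0" using V by (simp add: A_def)
  have main: "\<exists>Z. (\<forall>x. (\<forall>j. \<bar>x $ j\<bar> \<le> 1) \<longrightarrow> ((\<lambda>k. Re (Z k * cis (of_int_vec k \<bullet> x))) has_sum v x $ p) UNIV) \<and>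
       (\<forall>k j. j + 2 * ?n \<le> N \<longrightarrow> norm (Z k) * norm (of_int_vec k :: real ^ 'n) ^ j \<le> A * (C * real N) ^ (j + 2 * ?n) * freq_weight k)"
    if N2: "N \<ge> 2 * ?n" for N p
  proof -
    have N: "N \<ge> 1"
    proof -
      have "?n \<ge> 1" by (simp add: Suc_leI)
      then show ?thesis using N2 by linarith
    qed
    obtain \<psi> where \<psi>: "cutoff_sequence N \<psi>" using cutoff_sequence_exists[OF N] by blast
    define w where "w y = v y $ p * (\<Prod>i\<in>UNIV. \<psi> 0 (y $ i))" for y
    have wc: "continuous_on torus w"
      unfolding w_def by (intro continuous_intros vc continuous_on_compose2[OF cutoff_sequenceD(2)[OF \<psi>]]) auto
    define I where "I k \<theta> = integral torus (\<lambda>y. w y * cos (of_int_vec k \<bullet> y + \<theta>))" for k \<theta>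
    have I: "\<bar>I k \<theta>\<bar> * norm (of_int_vec k :: real ^ 'n) ^ j \<le> V * (2 * pi) ^ ?n * (C * real N) ^ j" if "j \<le> N" for k \<theta> j
    proof -
      have "\<forall>x\<in>torus. (v has_derivative (\<lambda>h. D x *v h)) (at x) \<and> D x \<in> L \<and> (\<forall>p. \<bar>v x $ p\<bar> \<le> V)"
        using der DL V(2) by blast
      then show ?thesis unfolding I_def w_def using decay \<psi> that by blast
    qed
    \<comment> \<open>Z merges the cosine and the sine coefficient, the phase -pi/2 turning cosine
      into sine. With the minus sign, Re (Z e^(ik.x)) is the real Fourier term at x.\<close>
    define Z where "Z k = Complex (I k 0 / (2 * pi) ^ ?n) (- I k (- pi / 2) / (2 * pi) ^ ?n)" for k
    have CN: "1 \<le> C * real N" using mult_mono[of 1 C 1 "real N"] C N by simp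
    have Zn: "norm (Z k) \<le> (\<bar>I k 0\<bar> + \<bar>I k (- pi / 2)\<bar>) / (2 * pi) ^ ?n" for k
      using cmod_le[of "Z k"] by (simp add: Z_def add_divide_distrib)
    have Zj: "norm (Z k) * norm (of_int_vec k :: real ^ 'n) ^ j \<le> 2 * V * (C * real N) ^ j" if "j \<le> N" for k j
    proof -
      have "norm (Z k) * norm (of_int_vec k :: real ^ 'n) ^ j \<le> (\<bar>I k 0\<bar> + \<bar>I k (- pi / 2)\<bar>) / (2 * pi) ^ ?n * norm (of_int_vec k :: real ^ 'n) ^ j"
        by (intro mult_right_mono Zn) auto
      also have "\<dots> = (\<bar>I k 0\<bar> * norm (of_int_vec k :: real ^ 'n) ^ j + \<bar>I k (- pi / 2)\<bar> * norm (of_int_vec k :: real ^ 'n) ^ j) / (2 * pi) ^ ?n"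
        by (simp add: algebra_simps)
      also have "\<dots> \<le> (V * (2 * pi) ^ ?n * (C * real N) ^ j + V * (2 * pi) ^ ?n * (C * real N) ^ j) / (2 * pi) ^ ?n"
        by (intro divide_right_mono add_mono I that) auto
      also have "\<dots> = 2 * V * (C * real N) ^ j" by simp
      finally show ?thesis .
    qed
    \<comment> \<open>For k = 0 the weight is 1, and a higher power of C N >= 1 does no harm. For
      other k, 2 n additional orders of decay are spent on the weight.\<close>
    have Zw: "norm (Z k) * norm (of_int_vec k :: real ^ 'n) ^ j \<le> A * (C * real N) ^ (j + 2 * ?n) * freq_weight k"
      if "j + 2 * ?n \<le> N" for k j
    proof (cases "k = (\<lambda>_. 0)")
      case True
      have "norm (Z k) * norm (of_int_vec k :: real ^ 'n) ^ j \<le> 2 * V * (C * real N) ^ j"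
        using that by (intro Zj) auto
      also have "\<dots> \<le> A * (C * real N) ^ (j + 2 * ?n)"
      proof (rule mult_mono)
        show "2 * V \<le> A" using mult_left_mono[of 1 "2 ^ ?n" "2 * V"] V(1) by (simp add: A_def)
        show "(C * real N) ^ j \<le> (C * real N) ^ (j + 2 * ?n)" using CN by (intro power_increasing) auto
      qed (use A CN in auto)
      finally show ?thesis using True by (simp add: freq_weight_def)
    next
      case False
      let ?k = "norm (of_int_vec k :: real ^ 'n)"
      have "norm (Z k) * ?k ^ j * 1 \<le> norm (Z k) * ?k ^ j * (2 ^ ?n * ?k ^ (2 * ?n) * freq_weight k)"
        by (intro mult_left_mono freq_weight_ge[OF False]) auto
      also have "\<dots> = (norm (Z k) * ?k ^ (j + 2 * ?n)) * (2 ^ ?n * freq_weight k)"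
        by (simp add: power_add mult_ac)
      also have "\<dots> \<le> 2 * V * (C * real N) ^ (j + 2 * ?n) * (2 ^ ?n * freq_weight k)"
        using freq_weight_pos[of k] by (intro mult_right_mono Zj that) auto
      finally show ?thesis by (simp add: A_def mult_ac)
    qed
    have "((\<lambda>k. Re (Z k * cis (of_int_vec k \<bullet> x))) has_sum v x $ p) UNIV" if x: "\<And>j. \<bar>x $ j\<bar> \<le> 1" for x
    proof -
      let ?J = "\<lambda>k. integral torus (\<lambda>y. w y * cos (of_int_vec k \<bullet> (x - y)))"
      have J: "?J k = (2 * pi) ^ ?n * Re (Z k * cis (of_int_vec k \<bullet> x))" for k
      proof -
        have "w y * cos (of_int_vec k \<bullet> (x - y)) = w y * cos (of_int_vec k \<bullet> y + 0) * cos (of_int_vec k \<bullet> x)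
            + w y * cos (of_int_vec k \<bullet> y + - pi / 2) * sin (of_int_vec k \<bullet> x)" for y
          by (simp add: inner_diff_right cos_diff cos_add algebra_simps)
        then have "?J k = integral torus (\<lambda>y. w y * cos (of_int_vec k \<bullet> y + 0) * cos (of_int_vec k \<bullet> x)
            + w y * cos (of_int_vec k \<bullet> y + - pi / 2) * sin (of_int_vec k \<bullet> x))" by simp
        also have "\<dots> = I k 0 * cos (of_int_vec k \<bullet> x) + I k (- pi / 2) * sin (of_int_vec k \<bullet> x)"
          unfolding I_def by (subst integral_add) (auto intro!: integrable_continuous continuous_intros wc)
        finally show ?thesis by (simp add: Z_def field_simps)
      qed
      have sm: "?J summable_on UNIV"
      proof (rule summable_on_dominated[OF summable_on_freq_weight])
        fix k :: "'n \<Rightarrow> int"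
        have "\<bar>Re (Z k * cis (of_int_vec k \<bullet> x))\<bar> \<le> norm (Z k)"
          using abs_Re_le_cmod[of "Z k * cis (of_int_vec k \<bullet> x)"] by (simp add: norm_mult)
        also have "\<dots> \<le> A * (C * real N) ^ (2 * ?n) * freq_weight k"
          using Zw[of 0 k] N2 by simp
        finally have "(2 * pi) ^ ?n * \<bar>Re (Z k * cis (of_int_vec k \<bullet> x))\<bar> \<le> (2 * pi) ^ ?n * (A * (C * real N) ^ (2 * ?n) * freq_weight k)"
          by (intro mult_left_mono) auto
        then show "\<bar>?J k\<bar> \<le> ((2 * pi) ^ ?n * (A * (C * real N) ^ (2 * ?n))) * freq_weight k"
          unfolding J by (simp only: abs_mult abs_of_nonneg mult.assoc) simp
      qed
      have "((\<lambda>k. (1 / (2 * pi) ^ ?n) * ?J k) has_sum (1 / (2 * pi) ^ ?n) * ((2 * pi) ^ ?n * w x)) UNIV"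
        by (intro has_sum_cmult_right torus_fourier_inversion wc x sm)
      moreover have "w x = v x $ p" using cutoff_sequenceD(5)[OF \<psi> x] by (simp add: w_def)
      ultimately show ?thesis by (simp add: J)
    qed
    then show ?thesis using Zw by blast
  qed
  show ?thesis by (rule that[OF C A main])
qed

section \<open>Power series expansion\<close>

lemma finite_multiindices: "finite {\<alpha> :: 'n::finite \<Rightarrow> nat. sum \<alpha> UNIV \<le> s}"
proof (rule finite_subset)
  have "\<alpha> j \<le> sum \<alpha> UNIV" for \<alpha> :: "'n \<Rightarrow> nat" and j by (rule member_le_sum) auto
  then show "{\<alpha> :: 'n \<Rightarrow> nat. sum \<alpha> UNIV \<le> s} \<subseteq> UNIV \<rightarrow>\<^sub>E {..s}" by (auto intro: order_trans)
  show "finite ((UNIV :: 'n set) \<rightarrow>\<^sub>E {..s})" by (intro finite_PiE) auto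
qed

text \<open>In divided powers the binomial theorem is a plain convolution, so splitting off one
  variable closes the induction. Multi-indices are total functions; fixing them to 0 outside A makes
  the index set finite.\<close>

lemma multinomial_divided:
  fixes y :: "'a \<Rightarrow> real"
  assumes "finite A"
  shows "finite {\<alpha>. (\<forall>i. i \<notin> A \<longrightarrow> \<alpha> i = 0) \<and> sum \<alpha> A = s} \<and>
    (\<Sum>j\<in>A. y j) ^ s / fact s = (\<Sum>\<alpha> | (\<forall>i. i \<notin> A \<longrightarrow> \<alpha> i = 0) \<and> sum \<alpha> A = s. \<Prod>j\<in>A. y j ^ \<alpha> j / fact (\<alpha> j))"
  using assms
proof (induction A arbitrary: s rule: finite_induct)
  case empty
  have "{\<alpha> :: 'a \<Rightarrow> nat. (\<forall>i. i \<notin> {} \<longrightarrow> \<alpha> i = 0) \<and> sum \<alpha> {} = s} = (if s = 0 then {\<lambda>_. 0} else {})" by auto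
  then show ?case by (simp add: power_0_left)
next
  case (insert a A)
  let ?T = "\<lambda>A s. {\<alpha>. (\<forall>i. i \<notin> A \<longrightarrow> \<alpha> i = (0::nat)) \<and> sum \<alpha> A = s}"
  let ?S = "SIGMA i:{..s}. ?T A (s - i)"
  let ?f = "\<lambda>(i, \<alpha>). \<alpha>(a := i)"
  have finS: "finite ?S" using insert.IH by auto
  have upd: "sum (\<alpha>(a := i)) A = sum \<alpha> A" for \<alpha> :: "'a \<Rightarrow> nat" and i
    using insert.hyps by (intro sum.cong) auto
  have bij: "bij_betw ?f ?S (?T (insert a A) s)"
  proof (rule bij_betw_byWitness[where f' = "\<lambda>\<alpha>. (\<alpha> a, \<alpha>(a := 0))"])
    show "\<forall>z\<in>?S. (\<lambda>\<alpha>. (\<alpha> a, \<alpha>(a := 0))) (?f z) = z"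
      using insert.hyps by (auto simp: fun_eq_iff)
    show "\<forall>\<alpha>\<in>?T (insert a A) s. ?f (\<alpha> a, \<alpha>(a := 0)) = \<alpha>" by auto
    show "?f ` ?S \<subseteq> ?T (insert a A) s"
    proof (rule image_subsetI)
      fix z assume "z \<in> ?S"
      then obtain i \<alpha> where z: "z = (i, \<alpha>)" and i: "i \<le> s"
        and \<alpha>: "\<forall>i. i \<notin> A \<longrightarrow> \<alpha> i = 0" "sum \<alpha> A = s - i" by auto
      have "sum (\<alpha>(a := i)) (insert a A) = i + sum \<alpha> A"
      proof -
        have "sum (\<alpha>(a := i)) (insert a A) = (\<alpha>(a := i)) a + sum (\<alpha>(a := i)) A"
          by (rule sum.insert) (use insert.hyps in auto)
        then show ?thesis unfolding upd by simp
      qed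
      then have "sum (\<alpha>(a := i)) (insert a A) = s" using i \<alpha> by simp
      then show "?f z \<in> ?T (insert a A) s" using \<alpha>(1) by (simp add: z del: sum.insert)
    qed
    show "(\<lambda>\<alpha>. (\<alpha> a, \<alpha>(a := 0))) ` ?T (insert a A) s \<subseteq> ?S"
    proof (rule image_subsetI)
      fix \<alpha> assume "\<alpha> \<in> ?T (insert a A) s"
      then have \<alpha>: "\<forall>i. i \<notin> insert a A \<longrightarrow> \<alpha> i = 0" "sum \<alpha> (insert a A) = s" by auto
      have "\<alpha> a + sum \<alpha> A = s" using insert.hyps \<alpha>(2) by simp
      then have "\<alpha> a \<le> s" "sum (\<alpha>(a := 0)) A = s - \<alpha> a" unfolding upd by auto
      then show "(\<alpha> a, \<alpha>(a := 0)) \<in> ?S" using \<alpha>(1) by simp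
    qed
  qed
  have "((\<Sum>j\<in>insert a A. y j) ^ s) / fact s = (\<Sum>i\<le>s. of_nat (s choose i) * y a ^ i * (\<Sum>j\<in>A. y j) ^ (s - i)) / fact s"
    using insert.hyps by (simp add: binomial_ring)
  also have "\<dots> = (\<Sum>i\<le>s. y a ^ i / fact i * ((\<Sum>j\<in>A. y j) ^ (s - i) / fact (s - i)))"
    unfolding sum_divide_distrib by (intro sum.cong refl) (simp add: binomial_fact field_simps)
  also have "\<dots> = (\<Sum>i\<le>s. \<Sum>\<alpha>\<in>?T A (s - i). y a ^ i / fact i * (\<Prod>j\<in>A. y j ^ \<alpha> j / fact (\<alpha> j)))"
    using insert.IH by (simp add: sum_distrib_left)
  also have "\<dots> = (\<Sum>z\<in>?S. y a ^ fst z / fact (fst z) * (\<Prod>j\<in>A. y j ^ snd z j / fact (snd z j)))"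
    by (subst sum.Sigma) (use insert.IH in \<open>auto simp: case_prod_beta\<close>)
  also have "\<dots> = (\<Sum>z\<in>?S. \<Prod>j\<in>insert a A. y j ^ ?f z j / fact (?f z j))"
  proof (rule sum.cong[OF refl])
    fix z assume "z \<in> ?S"
    obtain i \<alpha> where z: "z = (i, \<alpha>)" by fastforce
    have "(\<Prod>j\<in>A. y j ^ (\<alpha>(a := i)) j / fact ((\<alpha>(a := i)) j)) = (\<Prod>j\<in>A. y j ^ \<alpha> j / fact (\<alpha> j))"
      using insert.hyps by (intro prod.cong) auto
    then show "y a ^ fst z / fact (fst z) * (\<Prod>j\<in>A. y j ^ snd z j / fact (snd z j)) = (\<Prod>j\<in>insert a A. y j ^ ?f z j / fact (?f z j))"
      using insert.hyps by (simp add: z del: fun_upd_apply) (simp add: fun_upd_same)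
  qed
  also have "\<dots> = (\<Sum>\<alpha>\<in>?T (insert a A) s. \<Prod>j\<in>insert a A. y j ^ \<alpha> j / fact (\<alpha> j))"
    by (rule sum.reindex_bij_betw[OF bij])
  finally show ?case using bij_betw_finite[OF bij] finS by blast
qed

lemma multinomial_UNIV:
  fixes y :: "'n::finite \<Rightarrow> real"
  shows "(\<Sum>j\<in>UNIV. y j) ^ s / fact s = (\<Sum>\<alpha> | sum \<alpha> UNIV = s. \<Prod>j\<in>UNIV. y j ^ \<alpha> j / fact (\<alpha> j))"
  using multinomial_divided[where A = "UNIV :: 'n set" and y = y and s = s] by simp

text \<open>The constant term is isolated by letting \<open>t\<close> tend to \<open>0\<close>, then one divides by \<open>t\<close>.\<close>
lemma small_polynomial_eq_0:
  fixes d :: "nat \<Rightarrow> real"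
  assumes "\<And>t. 0 < t \<Longrightarrow> t \<le> 1 \<Longrightarrow> \<bar>\<Sum>s\<le>m. d s * t ^ s\<bar> \<le> K * t ^ Suc m" and "s \<le> m"
  shows "d s = 0"
  using assms
proof (induction m arbitrary: d s)
  have ev: "\<forall>\<^sub>F t in at_right 0. 0 < t \<and> t \<le> (1 :: real)"
    unfolding eventually_at_right_field by (intro exI[of _ 1]) auto
  have zero: "d 0 = 0" if b: "\<And>t. 0 < t \<Longrightarrow> t \<le> 1 \<Longrightarrow> \<bar>\<Sum>s\<le>m. d s * t ^ s\<bar> \<le> K * t ^ Suc m" for d :: "nat \<Rightarrow> real" and m
  proof -
    have "((\<lambda>t. \<Sum>s\<le>m. d s * t ^ s) \<longlongrightarrow> (\<Sum>s\<le>m. d s * 0 ^ s)) (at_right 0)"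
      by (intro tendsto_intros)
    moreover have "((\<lambda>t. \<Sum>s\<le>m. d s * t ^ s) \<longlongrightarrow> 0) (at_right 0)"
    proof (rule tendsto_0_le[where K = 1])
      have "((\<lambda>t. K * t ^ Suc m) \<longlongrightarrow> K * 0 ^ Suc m) (at_right 0)" by (intro tendsto_intros)
      then show "((\<lambda>t. K * t ^ Suc m) \<longlongrightarrow> 0) (at_right 0)" by simp
      show "\<forall>\<^sub>F t in at_right 0. norm (\<Sum>s\<le>m. d s * t ^ s) \<le> norm (K * t ^ Suc m) * 1"
        using ev
      proof eventually_elim
        case (elim t)
        have "norm (\<Sum>s\<le>m. d s * t ^ s) \<le> K * t ^ Suc m" using b elim by simp
        also have "\<dots> \<le> \<bar>K * t ^ Suc m\<bar>" by (rule abs_ge_self)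
        finally show ?case by simp
      qed
    qed
    ultimately have "(\<Sum>s\<le>m. d s * 0 ^ s) = 0" by (rule tendsto_unique[OF trivial_limit_at_right_real])
    moreover have "(\<Sum>s\<le>m. d s * 0 ^ s) = d 0"
      by (simp add: power_0_left if_distrib[of "\<lambda>x. _ * x"] cong: if_cong)
    ultimately show ?thesis by simp
  qed
  {
    case 0
    then show ?case using zero[OF 0(1)] by simp
  next
    case (Suc m)
    have d0: "d 0 = 0" by (rule zero[OF Suc.prems(1)])
    show ?case
    proof (cases s)
      case (Suc r)
      have "d (Suc r) = 0"
      proof (rule Suc.IH[of "\<lambda>s. d (Suc s)"])
        show "r \<le> m" using Suc Suc.prems by simp
        fix t :: real assume t: "0 < t" "t \<le> 1"
        have "(\<Sum>s\<le>Suc m. d s * t ^ s) = t * (\<Sum>s\<le>m. d (Suc s) * t ^ s)"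
          by (subst sum.atMost_Suc_shift) (simp add: d0 sum_distrib_left mult_ac)
        then have "t * \<bar>\<Sum>s\<le>m. d (Suc s) * t ^ s\<bar> \<le> t * (K * t ^ Suc m)"
          using Suc.prems(1)[OF t] t by (simp add: abs_mult mult_ac)
        then show "\<bar>\<Sum>s\<le>m. d (Suc s) * t ^ s\<bar> \<le> K * t ^ Suc m" using t by simp
      qed
      then show ?thesis using Suc by simp
    qed (use d0 in simp)
  }
qed

text \<open>A single term of the exponential series. It takes the place of Stirling's formula when
  powers of N are compared with factorials.\<close>

lemma power_le_fact_exp:
  fixes x :: real
  assumes "x \<ge> 0"
  shows "x ^ s \<le> fact s * exp x"
proof -
  have "(\<Sum>n\<in>{s}. x ^ n /\<^sub>R fact n) \<le> (\<Sum>n. x ^ n /\<^sub>R fact n)"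
    using assms by (intro sum_le_suminf summable_exp_generic) auto
  then show ?thesis by (simp add: exp_def field_simps)
qed

lemma filterlim_multiindices:
  "filterlim (\<lambda>m. {\<alpha> :: 'n::finite \<Rightarrow> nat. sum \<alpha> UNIV \<le> m}) (finite_subsets_at_top UNIV) sequentially"
  unfolding filterlim_finite_subsets_at_top
proof (intro allI impI)
  fix X :: "('n \<Rightarrow> nat) set" assume "finite X \<and> X \<subseteq> UNIV"
  then have X: "finite X" by simp
  define M where "M = (\<Sum>\<alpha>\<in>X. sum \<alpha> UNIV)"
  have "sum \<alpha> UNIV \<le> M" if "\<alpha> \<in> X" for \<alpha>
    unfolding M_def by (rule member_le_sum[of \<alpha> X "\<lambda>\<alpha>. sum \<alpha> UNIV"]) (use X that in auto)
  then show "\<forall>\<^sub>F m in sequentially. finite {\<alpha> :: 'n \<Rightarrow> nat. sum \<alpha> UNIV \<le> m} \<and> X \<subseteq> {\<alpha>. sum \<alpha> UNIV \<le> m} \<and> {\<alpha>. sum \<alpha> UNIV \<le> m} \<subseteq> (UNIV :: ('n \<Rightarrow> nat) set)"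
    unfolding eventually_sequentially using finite_multiindices by (intro exI[of _ M]) (auto intro: order_trans)
qed

lemma sum_homogeneous_parts:
  fixes f :: "('n::finite \<Rightarrow> nat) \<Rightarrow> real"
  shows "(\<Sum>s\<le>m. \<Sum>\<alpha> | sum \<alpha> UNIV = s. f \<alpha>) = (\<Sum>\<alpha> | sum \<alpha> UNIV \<le> m. f \<alpha>)"
proof -
  have "(\<Sum>\<alpha> | sum \<alpha> UNIV \<le> m. f \<alpha>) = (\<Sum>s\<in>{..m}. \<Sum>\<alpha> | \<alpha> \<in> {\<alpha>. sum \<alpha> UNIV \<le> m} \<and> sum \<alpha> UNIV = s. f \<alpha>)"
    by (rule sum.group[symmetric]) (use finite_multiindices in auto)
  also have "\<dots> = (\<Sum>s\<le>m. \<Sum>\<alpha> | sum \<alpha> UNIV = s. f \<alpha>)"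
    by (intro sum.cong refl) auto
  finally show ?thesis by simp
qed

text \<open>On the cube of half-edge 1 / (2 B) the terms are dominated by a product of geometric
  series, so the series converges unconditionally. Its sum may then be computed by homogeneous
  degrees, which is what \<open>lim\<close> provides.\<close>

lemma has_sum_multi_power:
  fixes c :: "('n::finite \<Rightarrow> nat) \<Rightarrow> real" and x :: "real ^ 'n"
  assumes c: "\<And>\<alpha>. \<bar>c \<alpha>\<bar> \<le> K * B ^ sum \<alpha> UNIV" and B: "B > 0" and x: "\<And>j. \<bar>x $ j\<bar> \<le> 1 / (2 * B)"
    and lim: "(\<lambda>m. \<Sum>s\<le>m. \<Sum>\<alpha> | sum \<alpha> UNIV = s. multi_power x \<alpha> * c \<alpha>) \<longlonglongrightarrow> y"
  shows "((\<lambda>\<alpha>. multi_power x \<alpha> * c \<alpha>) has_sum y) UNIV"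
proof -
  have K: "K \<ge> 0" using c[of "\<lambda>_. 0"] by simp
  have g: "(\<lambda>a :: nat. (1 / 2 :: real) ^ a) summable_on UNIV"
    by (rule norm_summable_imp_summable_on) (simp add: summable_geometric)
  have "(\<lambda>\<alpha>. multi_power x \<alpha> * c \<alpha>) summable_on UNIV"
  proof (rule summable_on_dominated[OF summable_on_prod_UNIV[OF g]])
    fix \<alpha> :: "'n \<Rightarrow> nat"
    have "\<bar>multi_power x \<alpha>\<bar> \<le> (\<Prod>j\<in>UNIV. (1 / (2 * B)) ^ \<alpha> j)"
      unfolding multi_power_def abs_prod
      by (intro prod_mono) (use x in \<open>auto simp: power_abs intro!: power_mono\<close>)
    then have "\<bar>multi_power x \<alpha> * c \<alpha>\<bar> \<le> (\<Prod>j\<in>UNIV. (1 / (2 * B)) ^ \<alpha> j) * (K * B ^ sum \<alpha> UNIV)"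
      unfolding abs_mult using c[of \<alpha>] B by (intro mult_mono) (auto intro!: prod_nonneg)
    also have "\<dots> = K * (\<Prod>j\<in>UNIV. (1 / (2 * B)) ^ \<alpha> j * B ^ \<alpha> j)"
      by (simp add: power_sum prod.distrib)
    also have "\<dots> = K * (\<Prod>j\<in>UNIV. (1 / 2) ^ \<alpha> j)"
      using B by (simp add: power_mult_distrib[symmetric])
    finally show "\<bar>multi_power x \<alpha> * c \<alpha>\<bar> \<le> K * (\<Prod>j\<in>UNIV. (1 / 2) ^ \<alpha> j)" .
  qed auto
  then obtain z where z: "((\<lambda>\<alpha>. multi_power x \<alpha> * c \<alpha>) has_sum z) UNIV" by (auto simp: summable_on_def)
  have "(\<lambda>m. \<Sum>\<alpha> | sum \<alpha> UNIV \<le> m. multi_power x \<alpha> * c \<alpha>) \<longlonglongrightarrow> z"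
    using filterlim_compose[OF z[unfolded has_sum_def] filterlim_multiindices] .
  then have "z = y" using lim LIMSEQ_unique unfolding sum_homogeneous_parts by blast
  then show ?thesis using z by simp
qed

section \<open>From Fourier expansions to a power series\<close>

lemma has_sum_finite_sum:
  fixes f :: "'a \<Rightarrow> 'b \<Rightarrow> real"
  assumes "finite S" "\<And>s. s \<in> S \<Longrightarrow> (f s has_sum a s) A"
  shows "((\<lambda>k. \<Sum>s\<in>S. f s k) has_sum (\<Sum>s\<in>S. a s)) A"
  using assms by (induction S rule: finite_induct) (auto intro!: has_sum_add)

lemma dominated_infsum:
  fixes f g :: "'a \<Rightarrow> real"
  assumes g: "g summable_on UNIV" and le: "\<And>k. \<bar>f k\<bar> \<le> K * g k"
  shows "(f has_sum infsum f UNIV) UNIV" and "\<bar>infsum f UNIV\<bar> \<le> K * infsum g UNIV"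
proof -
  show 1: "(f has_sum infsum f UNIV) UNIV"
    by (rule has_sum_infsum, rule summable_on_dominated[OF g]) (rule le)
  have "((\<lambda>k. K * g k) has_sum (K * infsum g UNIV)) UNIV"
    by (intro has_sum_cmult_right has_sum_infsum g)
  from norm_infsum_le[OF 1 this] le show "\<bar>infsum f UNIV\<bar> \<le> K * infsum g UNIV" by simp
qed

lemma Re_cis_taylor:
  "\<bar>Re (z * cis t) - (\<Sum>s\<le>m. Re (\<i> ^ s * z) * t ^ s / fact s)\<bar> \<le> norm z * (\<bar>t\<bar> ^ Suc m / fact m)"
proof -
  have "Re (z * cis t) - (\<Sum>s\<le>m. Re (\<i> ^ s * z) * t ^ s / fact s) = Re (z * (exp (\<i> * t) - (\<Sum>s\<le>m. (\<i> * t) ^ s / fact s)))"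
  proof -
    have "Re (\<i> ^ s * z) * t ^ s / fact s = Re (z * ((\<i> * t) ^ s / fact s))" for s
    proof -
      have "z * ((\<i> * t) ^ s / fact s) = (\<i> ^ s * z) * complex_of_real (t ^ s / fact s)"
        by (simp add: power_mult_distrib)
      moreover have "Re (w * complex_of_real r) = Re w * r" for w r by simp
      ultimately show ?thesis by (simp only: times_divide_eq_right)
    qed
    then show ?thesis by (simp add: cis_conv_exp algebra_simps sum_distrib_left)
  qed
  also have "\<bar>\<dots>\<bar> \<le> norm (z * (exp (\<i> * t) - (\<Sum>s\<le>m. (\<i> * t) ^ s / fact s)))" by (rule abs_Re_le_cmod)
  also have "\<dots> \<le> norm z * (\<bar>t\<bar> ^ Suc m / fact m)"
    unfolding norm_mult using Taylor_exp[of "\<i> * complex_of_real t" m] by (intro mult_left_mono) (auto simp: norm_mult)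
  finally show ?thesis .
qed

lemma prod_power_le_norm_power:
  fixes k :: "real ^ 'n"
  shows "\<bar>\<Prod>j\<in>UNIV. (k $ j) ^ \<alpha> j\<bar> \<le> norm k ^ sum \<alpha> UNIV"
proof -
  have "\<bar>\<Prod>j\<in>UNIV. (k $ j) ^ \<alpha> j\<bar> \<le> (\<Prod>j\<in>UNIV. norm k ^ \<alpha> j)"
    unfolding abs_prod by (intro prod_mono) (auto simp: power_abs intro!: power_mono component_le_norm_cart)
  then show ?thesis by (simp add: power_sum)
qed

text \<open>The expansion with parameter \<open>N\<close> controls the Taylor polynomial of \<open>f\<close> at \<open>0\<close> up to order
  about \<open>N\<close>. The homogeneous parts do not depend on \<open>N\<close>, because the Taylor polynomial
  along each ray is unique, so each of them may be estimated with the best \<open>N\<close>.\<close>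
lemma power_series_of_fourier_expansions:
  fixes f :: "real ^ 'n \<Rightarrow> real"
  assumes C: "C \<ge> 1" and A: "A \<ge> 0"
    and exp: "\<And>N. N \<ge> 2 * CARD('n) \<Longrightarrow> \<exists>Z. (\<forall>x. (\<forall>j. \<bar>x $ j\<bar> \<le> 1) \<longrightarrow> ((\<lambda>k. Re (Z k * cis (of_int_vec k \<bullet> x))) has_sum f x) UNIV) \<and>
       (\<forall>k j. j + 2 * CARD('n) \<le> N \<longrightarrow> norm (Z k) * norm (of_int_vec k :: real ^ 'n) ^ j \<le> A * (C * real N) ^ (j + 2 * CARD('n)) * freq_weight k)"
  shows "\<exists>r>0. \<exists>c. \<forall>x\<in>ball 0 r. ((\<lambda>\<alpha>. multi_power x \<alpha> * c \<alpha>) has_sum f x) UNIV"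
proof -
  let ?n = "CARD('n)"
  define G where "G = infsum (freq_weight :: ('n \<Rightarrow> int) \<Rightarrow> real) UNIV"
  have G: "G \<ge> 0" unfolding G_def by (intro infsum_nonneg less_imp_le freq_weight_pos)
  obtain Z where Zf: "\<And>N x. N \<ge> 2 * ?n \<Longrightarrow> (\<And>j. \<bar>x $ j\<bar> \<le> 1) \<Longrightarrow> ((\<lambda>k. Re (Z N k * cis (of_int_vec k \<bullet> x))) has_sum f x) UNIV"
    and Zb: "\<And>N k j. j + 2 * ?n \<le> N \<Longrightarrow> norm (Z N k) * norm (of_int_vec k :: real ^ 'n) ^ j \<le> A * (C * real N) ^ (j + 2 * ?n) * freq_weight k"
  proof -
    have "\<forall>N. \<exists>Z. N \<ge> 2 * ?n \<longrightarrow> (\<forall>x. (\<forall>j. \<bar>x $ j\<bar> \<le> 1) \<longrightarrow> ((\<lambda>k. Re (Z k * cis (of_int_vec k \<bullet> x))) has_sum f x) UNIV) \<and>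
       (\<forall>k j. j + 2 * ?n \<le> N \<longrightarrow> norm (Z k) * norm (of_int_vec k :: real ^ 'n) ^ j \<le> A * (C * real N) ^ (j + 2 * ?n) * freq_weight k)"
      using exp by blast
    then obtain Z where Z: "\<forall>N. N \<ge> 2 * ?n \<longrightarrow> (\<forall>x. (\<forall>j. \<bar>x $ j\<bar> \<le> 1) \<longrightarrow> ((\<lambda>k. Re (Z N k * cis (of_int_vec k \<bullet> x))) has_sum f x) UNIV) \<and>
       (\<forall>k j. j + 2 * ?n \<le> N \<longrightarrow> norm (Z N k) * norm (of_int_vec k :: real ^ 'n) ^ j \<le> A * (C * real N) ^ (j + 2 * ?n) * freq_weight k)"
      by (rule choice[THEN exE])
    show ?thesis
    proof (rule that)
      fix N and x :: "real ^ 'n" assume "N \<ge> 2 * ?n" "\<And>j. \<bar>x $ j\<bar> \<le> 1"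
      then show "((\<lambda>k. Re (Z N k * cis (of_int_vec k \<bullet> x))) has_sum f x) UNIV" using Z by blast
    next
      fix N k j assume "j + 2 * ?n \<le> N"
      moreover from this have "2 * ?n \<le> N" by simp
      ultimately show "norm (Z N k) * norm (of_int_vec k :: real ^ 'n) ^ j \<le> A * (C * real N) ^ (j + 2 * ?n) * freq_weight k"
        using Z by blast
    qed
  qed
  \<comment> \<open>T is the term of degree s in the Taylor series of the k-th mode. Its sum a over
    all k is the homogeneous part of degree s of f, as seen by the expansion with parameter N; M
    bounds both up to powers of |x|.\<close>
  define T where "T N s x k = Re (\<i> ^ s * Z N k) * (of_int_vec k \<bullet> x) ^ s / fact s" for N s and x :: "real ^ 'n" and k
  define a where "a N s x = infsum (T N s x) UNIV" for N s x
  define M where "M N s = A * (C * real N) ^ (s + 2 * ?n)" for N s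
  have M0: "M N s \<ge> 0" for N s using A C by (simp add: M_def)
  have dot: "\<bar>of_int_vec k \<bullet> x\<bar> ^ s \<le> norm (of_int_vec k :: real ^ 'n) ^ s * norm x ^ s" for k s and x :: "real ^ 'n"
    unfolding power_mult_distrib[symmetric] by (intro power_mono Cauchy_Schwarz_ineq2) auto
  have ZM: "norm (Z N k) * \<bar>of_int_vec k \<bullet> x\<bar> ^ s \<le> M N s * norm x ^ s * freq_weight k"
    if "s + 2 * ?n \<le> N" for N s k and x :: "real ^ 'n"
  proof -
    have "norm (Z N k) * \<bar>of_int_vec k \<bullet> x\<bar> ^ s \<le> norm (Z N k) * (norm (of_int_vec k :: real ^ 'n) ^ s * norm x ^ s)"
      by (intro mult_left_mono dot) auto
    also have "\<dots> = (norm (Z N k) * norm (of_int_vec k :: real ^ 'n) ^ s) * norm x ^ s" by simp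
    also have "\<dots> \<le> (M N s * freq_weight k) * norm x ^ s"
      unfolding M_def by (intro mult_right_mono Zb that) auto
    finally show ?thesis by (simp add: mult_ac)
  qed
  have Re_i: "\<bar>Re (\<i> ^ s * z)\<bar> \<le> norm z" for s z
    using abs_Re_le_cmod[of "\<i> ^ s * z"] by (simp add: norm_mult norm_power)
  have Ts: "(T N s x has_sum a N s x) UNIV" if "s + 2 * ?n \<le> N" for N s x
    unfolding a_def
  proof (rule dominated_infsum(1)[OF summable_on_freq_weight])
    fix k
    have "\<bar>T N s x k\<bar> = \<bar>Re (\<i> ^ s * Z N k)\<bar> * \<bar>of_int_vec k \<bullet> x\<bar> ^ s / fact s"
      by (simp add: T_def abs_mult power_abs)
    also have "\<dots> \<le> \<bar>Re (\<i> ^ s * Z N k)\<bar> * \<bar>of_int_vec k \<bullet> x\<bar> ^ s / 1"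
      by (intro divide_left_mono) auto
    also have "\<dots> \<le> norm (Z N k) * \<bar>of_int_vec k \<bullet> x\<bar> ^ s"
      using Re_i by (simp add: mult_right_mono)
    also have "\<dots> \<le> M N s * norm x ^ s * freq_weight k" by (rule ZM[OF that])
    finally show "\<bar>T N s x k\<bar> \<le> M N s * norm x ^ s * freq_weight k" .
  qed
  have taylor: "\<bar>f x - (\<Sum>s\<le>m. a N s x)\<bar> \<le> M N (Suc m) * norm x ^ Suc m / fact m * G"
    if N: "Suc m + 2 * ?n \<le> N" and x: "\<And>j. \<bar>x $ j\<bar> \<le> 1" for m N x
  proof -
    let ?D = "\<lambda>k. Re (Z N k * cis (of_int_vec k \<bullet> x)) - (\<Sum>s\<le>m. T N s x k)"
    have "((\<lambda>k. \<Sum>s\<le>m. T N s x k) has_sum (\<Sum>s\<le>m. a N s x)) UNIV"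
      by (rule has_sum_finite_sum) (use N in \<open>auto intro!: Ts\<close>)
    then have "((\<lambda>k. - (\<Sum>s\<le>m. T N s x k)) has_sum - (\<Sum>s\<le>m. a N s x)) UNIV" by (rule has_sum_uminusI)
    from has_sum_add[OF Zf[of N x] this] N x
    have "(?D has_sum (f x - (\<Sum>s\<le>m. a N s x))) UNIV" by simp
    then have e: "f x - (\<Sum>s\<le>m. a N s x) = infsum ?D UNIV" by (simp add: infsumI)
    have "\<bar>infsum ?D UNIV\<bar> \<le> (M N (Suc m) * norm x ^ Suc m / fact m) * G"
      unfolding G_def
    proof (rule dominated_infsum(2)[OF summable_on_freq_weight])
      fix k
      have "\<bar>?D k\<bar> \<le> norm (Z N k) * (\<bar>of_int_vec k \<bullet> x\<bar> ^ Suc m / fact m)"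
        unfolding T_def by (rule Re_cis_taylor)
      also have "\<dots> = norm (Z N k) * \<bar>of_int_vec k \<bullet> x\<bar> ^ Suc m / fact m" by simp
      also have "\<dots> \<le> M N (Suc m) * norm x ^ Suc m * freq_weight k / fact m"
        by (intro divide_right_mono ZM N) auto
      finally show "\<bar>?D k\<bar> \<le> M N (Suc m) * norm x ^ Suc m / fact m * freq_weight k" by simp
    qed
    then show ?thesis unfolding e .
  qed
  have homog: "a N s (t *\<^sub>R x) = t ^ s * a N s x" for N s t x
  proof -
    have "T N s (t *\<^sub>R x) = (\<lambda>k. t ^ s * T N s x k)"
      by (rule ext) (simp add: T_def power_mult_distrib)
    then show ?thesis unfolding a_def by (simp add: infsum_cmult_right')
  qed
  have indep: "a N s x = a N' s x"
    if N: "Suc m + 2 * ?n \<le> N" "Suc m + 2 * ?n \<le> N'" and s: "s \<le> m" and x: "\<And>j. \<bar>x $ j\<bar> \<le> 1" for N N' m s x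
  proof -
    define K where "K N = M N (Suc m) * norm x ^ Suc m / fact m * G" for N
    have "a N s x - a N' s x = 0"
    proof (rule small_polynomial_eq_0[where d = "\<lambda>s. a N s x - a N' s x" and K = "K N + K N'", OF _ s])
      fix t :: real assume t: "0 < t" "t \<le> 1"
      have tx: "\<bar>(t *\<^sub>R x) $ j\<bar> \<le> 1" for j
        using mult_mono[of t 1 "\<bar>x $ j\<bar>" 1] x[of j] t by (simp add: abs_mult)
      have b: "\<bar>f (t *\<^sub>R x) - (\<Sum>s\<le>m. a N s x * t ^ s)\<bar> \<le> K N * t ^ Suc m" if "Suc m + 2 * ?n \<le> N" for N
        using taylor[OF that tx] t by (simp add: homog K_def power_mult_distrib mult_ac)
      have "(\<Sum>s\<le>m. (a N s x - a N' s x) * t ^ s) = (f (t *\<^sub>R x) - (\<Sum>s\<le>m. a N' s x * t ^ s)) - (f (t *\<^sub>R x) - (\<Sum>s\<le>m. a N s x * t ^ s))"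
        by (simp add: algebra_simps sum_subtractf)
      then show "\<bar>\<Sum>s\<le>m. (a N s x - a N' s x) * t ^ s\<bar> \<le> (K N + K N') * t ^ Suc m"
        using b[OF N(1)] b[OF N(2)] by (simp add: distrib_right)
    qed
    then show ?thesis by simp
  qed
  \<comment> \<open>The least N usable in degree s: 2 n orders go into the weight, and one more into
    the remainder of order s + 1 on which \<open>taylor\<close> and \<open>indep\<close>
    rely.\<close>
  define \<nu> where "\<nu> s = Suc s + 2 * ?n" for s
  \<comment> \<open>The coefficient of x^\<alpha> in T, since (k . x)^s / s! is the sum of
    k^\<alpha> x^\<alpha> / \<alpha>! over all \<alpha> of order s.\<close>
  define U where "U \<alpha> k = Re (\<i> ^ sum \<alpha> UNIV * Z (\<nu> (sum \<alpha> UNIV)) k) * (\<Prod>j\<in>UNIV. real_of_int (k j) ^ \<alpha> j / fact (\<alpha> j))" for \<alpha> :: "'n \<Rightarrow> nat" and k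
  define c where "c \<alpha> = infsum (U \<alpha>) UNIV" for \<alpha>
  \<comment> \<open>With N = s + 1 + 2 n, bounding N^s and N^(2 n) by factorials leaves exp ((n + 1)
    N). Its part depending on s goes into B, and the fixed part exp ((n + 1) (2 n + 1)) into
    K.\<close>
  define B where "B = C * exp (real ?n + 1)"
  define K where "K = A * C ^ (2 * ?n) * fact (2 * ?n) * exp ((real ?n + 1) * (2 * real ?n + 1)) * G"
  have Uw: "\<bar>U \<alpha> k\<bar> \<le> M (\<nu> (sum \<alpha> UNIV)) (sum \<alpha> UNIV) / (\<Prod>j\<in>UNIV. fact (\<alpha> j)) * freq_weight k" for \<alpha> k
  proof -
    let ?s = "sum \<alpha> UNIV" and ?F = "\<Prod>j\<in>UNIV. fact (\<alpha> j) :: real"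
    have F: "?F > 0" by (intro prod_pos) auto
    have "\<bar>U \<alpha> k\<bar> = \<bar>Re (\<i> ^ ?s * Z (\<nu> ?s) k)\<bar> * \<bar>\<Prod>j\<in>UNIV. of_int_vec k $ j ^ \<alpha> j\<bar> / ?F"
      using F by (simp add: U_def abs_mult prod_dividef)
    also have "\<dots> \<le> norm (Z (\<nu> ?s) k) * norm (of_int_vec k :: real ^ 'n) ^ ?s / ?F"
      using F by (intro divide_right_mono mult_mono Re_i prod_power_le_norm_power) auto
    also have "\<dots> \<le> (M (\<nu> ?s) ?s * freq_weight k) / ?F"
      using F unfolding M_def by (intro divide_right_mono Zb) (auto simp: \<nu>_def)
    finally show ?thesis by simp
  qed
  note Us = dominated_infsum[OF summable_on_freq_weight Uw, folded c_def G_def]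
  have c_bound: "\<bar>c \<alpha>\<bar> \<le> K * B ^ sum \<alpha> UNIV" for \<alpha>
  proof -
    let ?s = "sum \<alpha> UNIV" and ?F = "\<Prod>j\<in>UNIV. fact (\<alpha> j) :: real" and ?N = "real (\<nu> (sum \<alpha> UNIV))"
    have F: "?F > 0" by (intro prod_pos) auto
    \<comment> \<open>N^s is distributed over the coordinates. Each pays its own exp N, but what
      cancels is the product of the factorials of the \<alpha> j, exactly the denominator in
      U.\<close>
    have 1: "?N ^ ?s \<le> ?F * exp (real ?n * ?N)"
    proof -
      have "?N ^ ?s = (\<Prod>j\<in>UNIV. ?N ^ \<alpha> j)" by (simp add: power_sum)
      also have "\<dots> \<le> (\<Prod>j\<in>UNIV. fact (\<alpha> j) * exp ?N)"
        by (intro prod_mono) (auto intro!: power_le_fact_exp)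
      also have "\<dots> = ?F * exp (real ?n * ?N)" by (simp add: prod.distrib exp_of_nat_mult)
      finally show ?thesis .
    qed
    have 2: "?N ^ (2 * ?n) \<le> fact (2 * ?n) * exp ?N" by (rule power_le_fact_exp) simp
    have "\<bar>c \<alpha>\<bar> \<le> A * C ^ (?s + 2 * ?n) * (?N ^ ?s * ?N ^ (2 * ?n)) / ?F * G"
      using Us(2)[of \<alpha>] by (simp add: M_def power_mult_distrib power_add mult_ac)
    also have "\<dots> \<le> A * C ^ (?s + 2 * ?n) * ((?F * exp (real ?n * ?N)) * (fact (2 * ?n) * exp ?N)) / ?F * G"
      using A C G F 1 2 by (intro mult_right_mono divide_right_mono mult_left_mono mult_mono) auto
    also have "\<dots> = A * C ^ (?s + 2 * ?n) * fact (2 * ?n) * (exp (real ?n * ?N) * exp ?N) * G"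
      using F by simp
    also have "exp (real ?n * ?N) * exp ?N = exp ((real ?n + 1) * (2 * real ?n + 1)) * exp (real ?n + 1) ^ ?s"
      by (simp add: \<nu>_def algebra_simps flip: exp_add exp_of_nat_mult)
    also have "A * C ^ (?s + 2 * ?n) * fact (2 * ?n) * \<dots> * G = K * B ^ ?s"
      by (simp add: K_def B_def power_add power_mult_distrib mult_ac)
    finally show ?thesis .
  qed
  \<comment> \<open>\<nu> depends on the order of \<alpha> only, so all coefficients of one degree
    come from the same expansion and recombine by the multinomial theorem.\<close>
  have part: "(\<Sum>\<alpha> | sum \<alpha> UNIV = s. multi_power x \<alpha> * c \<alpha>) = a (\<nu> s) s x" for s x
  proof -
    have fin: "finite {\<alpha> :: 'n \<Rightarrow> nat. sum \<alpha> UNIV = s}"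
      by (rule finite_subset[OF _ finite_multiindices[of s]]) auto
    have "((\<lambda>k. \<Sum>\<alpha> | sum \<alpha> UNIV = s. multi_power x \<alpha> * U \<alpha> k) has_sum (\<Sum>\<alpha> | sum \<alpha> UNIV = s. multi_power x \<alpha> * c \<alpha>)) UNIV"
      by (intro has_sum_finite_sum fin has_sum_cmult_right Us(1))
    moreover have "(\<Sum>\<alpha> | sum \<alpha> UNIV = s. multi_power x \<alpha> * U \<alpha> k) = T (\<nu> s) s x k" for k
    proof -
      have "(\<Sum>\<alpha> | sum \<alpha> UNIV = s. multi_power x \<alpha> * U \<alpha> k)
          = (\<Sum>\<alpha> | sum \<alpha> UNIV = s. Re (\<i> ^ s * Z (\<nu> s) k) * (\<Prod>j\<in>UNIV. (real_of_int (k j) * x $ j) ^ \<alpha> j / fact (\<alpha> j)))"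
      proof (rule sum.cong[OF refl])
        fix \<alpha> :: "'n \<Rightarrow> nat" assume "\<alpha> \<in> {\<alpha>. sum \<alpha> UNIV = s}"
        then have s: "sum \<alpha> UNIV = s" by simp
        have "multi_power x \<alpha> * (\<Prod>j\<in>UNIV. real_of_int (k j) ^ \<alpha> j / fact (\<alpha> j)) = (\<Prod>j\<in>UNIV. (real_of_int (k j) * x $ j) ^ \<alpha> j / fact (\<alpha> j))"
          unfolding multi_power_def prod.distrib[symmetric] by (intro prod.cong refl) (simp add: power_mult_distrib)
        then show "multi_power x \<alpha> * U \<alpha> k = Re (\<i> ^ s * Z (\<nu> s) k) * (\<Prod>j\<in>UNIV. (real_of_int (k j) * x $ j) ^ \<alpha> j / fact (\<alpha> j))"
          unfolding U_def s by (subst mult.left_commute) (simp only:)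
      qed
      also have "\<dots> = Re (\<i> ^ s * Z (\<nu> s) k) * ((\<Sum>j\<in>UNIV. real_of_int (k j) * x $ j) ^ s / fact s)"
        unfolding multinomial_UNIV sum_distrib_left ..
      finally show ?thesis by (simp add: T_def inner_vec_def)
    qed
    ultimately have "(T (\<nu> s) s x has_sum (\<Sum>\<alpha> | sum \<alpha> UNIV = s. multi_power x \<alpha> * c \<alpha>)) UNIV" by simp
    moreover have "(T (\<nu> s) s x has_sum a (\<nu> s) s x) UNIV" by (rule Ts) (simp add: \<nu>_def)
    ultimately show ?thesis by (rule has_sum_unique)
  qed
  have "exp (real ?n + 1) \<ge> 1" by simp
  then have B1: "B \<ge> 1" unfolding B_def using C mult_mono[of 1 C 1 "exp (real ?n + 1)"] by simp
  have "((\<lambda>\<alpha>. multi_power x \<alpha> * c \<alpha>) has_sum f x) UNIV" if "x \<in> ball 0 (1 / (2 * B))" for x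
  proof -
    have nx: "norm x \<le> 1 / (2 * B)" using that by simp
    have xj: "\<bar>x $ j\<bar> \<le> 1 / (2 * B)" for j using component_le_norm_cart[of x j] nx by linarith
    have "1 / (2 * B) \<le> 1" using B1 by simp
    then have x1: "\<bar>x $ j\<bar> \<le> 1" for j using xj[of j] by linarith
    \<comment> \<open>In M, N^(m + 1 + 2 n) is split as N^m N^(2 n + 1): the first factor cancels
      the m! of the remainder. As N = m + 1 + 2 n, the resulting exp (2 N) is exp (4 n) times (exp
      2)^(m + 1).\<close>
    define Q where "Q = A * C ^ (2 * ?n) * fact (2 * ?n + 1) * exp (4 * real ?n) * G"
    have Q: "Q \<ge> 0" using A C G by (simp add: Q_def)
    have "\<bar>f x - (\<Sum>s\<le>m. a (\<nu> s) s x)\<bar> \<le> Q * exp 2 * (1 / 2) ^ Suc m" for m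
    proof -
      let ?N = "real (\<nu> m)"
      \<comment> \<open>The parts were estimated with different N; \<open>indep\<close> replaces all
        of them by those of the single expansion with N = \<nu> m, to which \<open>taylor\<close>
        applies.\<close>
      have "(\<Sum>s\<le>m. a (\<nu> s) s x) = (\<Sum>s\<le>m. a (\<nu> m) s x)"
      proof (rule sum.cong[OF refl])
        fix s assume "s \<in> {..m}"
        then show "a (\<nu> s) s x = a (\<nu> m) s x"
          by (intro indep[of s]) (auto simp: \<nu>_def x1)
      qed
      then have "\<bar>f x - (\<Sum>s\<le>m. a (\<nu> s) s x)\<bar> \<le> M (\<nu> m) (Suc m) * norm x ^ Suc m / fact m * G"
        using taylor[OF _ x1, of m "\<nu> m"] by (simp add: \<nu>_def)
      also have "\<dots> = A * C ^ (Suc m + 2 * ?n) * (?N ^ m * ?N ^ (2 * ?n + 1)) * norm x ^ Suc m / fact m * G"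
        by (simp add: M_def power_mult_distrib power_add mult_ac)
      also have "\<dots> \<le> A * C ^ (Suc m + 2 * ?n) * ((fact m * exp ?N) * (fact (2 * ?n + 1) * exp ?N)) * norm x ^ Suc m / fact m * G"
        using A C G power_le_fact_exp[of ?N m] power_le_fact_exp[of ?N "2 * ?n + 1"]
        by (intro mult_right_mono divide_right_mono mult_left_mono mult_mono) auto
      also have "\<dots> = A * C ^ (Suc m + 2 * ?n) * fact (2 * ?n + 1) * (exp ?N * exp ?N) * norm x ^ Suc m * G"
        by simp
      also have "exp ?N * exp ?N = exp (4 * real ?n) * exp 2 ^ Suc m"
        by (simp add: \<nu>_def algebra_simps flip: exp_add exp_of_nat_mult)
      also have "A * C ^ (Suc m + 2 * ?n) * fact (2 * ?n + 1) * \<dots> * norm x ^ Suc m * G = Q * (C * exp 2 * norm x) ^ Suc m"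
        by (simp add: Q_def power_add power_mult_distrib mult_ac)
      also have "\<dots> \<le> Q * (1 / 2) ^ Suc m"
      proof -
        have "exp 2 \<le> exp (real ?n + 1)" by (simp add: Suc_leI)
        then have "C * exp 2 \<le> B" unfolding B_def using C by (intro mult_left_mono) auto
        then have "C * exp 2 * norm x \<le> B * (1 / (2 * B))" using nx B1 by (intro mult_mono) auto
        then have "C * exp 2 * norm x \<le> 1 / 2" using B1 by simp
        then show ?thesis using Q C by (intro mult_left_mono power_mono) auto
      qed
      also have "\<dots> \<le> Q * exp 2 * (1 / 2) ^ Suc m"
        using Q mult_left_mono[of 1 "exp 2" Q] by (intro mult_right_mono) auto
      finally show ?thesis .
    qed
    moreover have "(\<lambda>m. Q * exp 2 * (1 / 2) ^ Suc m) \<longlonglongrightarrow> 0"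
      using tendsto_mult_right_zero[OF LIMSEQ_Suc[OF LIMSEQ_power_zero[of "1 / 2 :: real"]]] by simp
    ultimately have "(\<lambda>m. f x - (\<Sum>s\<le>m. a (\<nu> s) s x)) \<longlonglongrightarrow> 0"
      by (intro Lim_null_comparison[of "\<lambda>m. f x - (\<Sum>s\<le>m. a (\<nu> s) s x)" "\<lambda>m. Q * exp 2 * (1 / 2) ^ Suc m"]) auto
    then have "(\<lambda>m. f x - (f x - (\<Sum>s\<le>m. a (\<nu> s) s x))) \<longlonglongrightarrow> f x - 0"
      by (intro tendsto_diff tendsto_const)
    then have "(\<lambda>m. \<Sum>s\<le>m. \<Sum>\<alpha> | sum \<alpha> UNIV = s. multi_power x \<alpha> * c \<alpha>) \<longlonglongrightarrow> f x"
      by (simp add: part)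
    then show ?thesis using B1 by (intro has_sum_multi_power[OF c_bound _ xj]) auto
  qed
  moreover have "1 / (2 * B) > 0" using B1 by simp
  ultimately show ?thesis by blast
qed

section \<open>Vector-valued series and rescaling\<close>

lemma has_sum_vec:
  fixes f :: "'a \<Rightarrow> real ^ 'm"
  assumes "\<And>p. ((\<lambda>k. f k $ p) has_sum y $ p) A"
  shows "(f has_sum y) A"
  using assms unfolding has_sum_def by (intro vec_tendstoI) (simp add: sum_component)

lemma torus_power_series:
  fixes L :: "(real ^ 'n ^ 'm) set" and v :: "real ^ 'n \<Rightarrow> real ^ 'm"
  assumes "subspace L" "no_rank1_connections L"
    and der: "\<And>x. x \<in> torus \<Longrightarrow> (v has_derivative (\<lambda>h. D x *v h)) (at x)"
    and DL: "\<And>x. x \<in> torus \<Longrightarrow> D x \<in> L"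
  shows "\<exists>r>0. \<exists>c. \<forall>x\<in>ball 0 r. ((\<lambda>\<alpha>. multi_power x \<alpha> *\<^sub>R c \<alpha>) has_sum v x) UNIV"
proof -
  obtain C A where C: "C \<ge> 1" and A: "A \<ge> 0" and Z:
    "\<And>N p. N \<ge> 2 * CARD('n) \<Longrightarrow> \<exists>Z. (\<forall>x. (\<forall>j. \<bar>x $ j\<bar> \<le> 1) \<longrightarrow> ((\<lambda>k. Re (Z k * cis (of_int_vec k \<bullet> x))) has_sum v x $ p) UNIV) \<and>
       (\<forall>k j. j + 2 * CARD('n) \<le> N \<longrightarrow> norm (Z k) * norm (of_int_vec k :: real ^ 'n) ^ j \<le> A * (C * real N) ^ (j + 2 * CARD('n)) * freq_weight k)"
    using local_fourier_expansion[OF assms(1,2) der DL] by blast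
  have "\<forall>p. \<exists>r>0. \<exists>c. \<forall>x\<in>ball 0 r. ((\<lambda>\<alpha>. multi_power x \<alpha> * c \<alpha>) has_sum v x $ p) UNIV"
    by (intro allI power_series_of_fourier_expansions[OF C A Z])
  then obtain r where r: "\<And>p. r p > 0"
    and "\<forall>p. \<exists>c. \<forall>x\<in>ball 0 (r p). ((\<lambda>\<alpha>. multi_power x \<alpha> * c \<alpha>) has_sum v x $ p) UNIV"
    by metis
  then obtain c where c: "\<And>p x. x \<in> ball 0 (r p) \<Longrightarrow> ((\<lambda>\<alpha>. multi_power x \<alpha> * c p \<alpha>) has_sum v x $ p) UNIV"
    by metis
  define r0 where "r0 = Min (range r)"
  have "r0 > 0" using r by (auto simp: r0_def)
  moreover have "((\<lambda>\<alpha>. multi_power x \<alpha> *\<^sub>R (\<chi> p. c p \<alpha>)) has_sum v x) UNIV" if "x \<in> ball 0 r0" for x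
  proof (rule has_sum_vec)
    fix p
    have "r0 \<le> r p" by (auto simp: r0_def)
    then show "((\<lambda>\<alpha>. (multi_power x \<alpha> *\<^sub>R (\<chi> p. c p \<alpha>)) $ p) has_sum v x $ p) UNIV"
      using c[of x p] that by simp
  qed
  ultimately show ?thesis by (intro exI[of _ r0] conjI exI[of _ "\<lambda>\<alpha>. \<chi> p. c p \<alpha>"]) auto
qed

theorem theorem2:
  fixes \<Omega> :: "(real ^ 'n) set"
    and L :: "(real ^ 'n ^ 'm) set"
    and u :: "real ^ 'n \<Rightarrow> real ^ 'm"
  assumes "open \<Omega>"
    and "subspace L"
    and "no_rank1_connections L"
    and "\<And>x. x \<in> \<Omega> \<Longrightarrow> u differentiable (at x)"
    and "\<And>x. x \<in> \<Omega> \<Longrightarrow> jacobian u (at x) \<in> L"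
  shows "real_analytic_on u \<Omega>"
  unfolding real_analytic_on_def
proof
  fix a assume a: "a \<in> \<Omega>"
  obtain e where e: "e > 0" "ball a e \<subseteq> \<Omega>" using assms(1) a open_contains_ball by blast
  obtain R :: real where R: "R > 0" "(torus :: (real ^ 'n) set) \<subseteq> ball 0 R"
    using bounded_subset_ballD[OF bounded_cbox, of "\<chi> i. - pi :: real ^ 'n" "\<chi> i. pi" 0] by blast
  \<comment> \<open>The torus lies in the ball of radius R, so scaling by e / R maps it into the
    ball of radius e about a. The derivative is multiplied by \<rho>, which keeps it in the subspace
    L.\<close>
  define \<rho> where "\<rho> = e / R"
  have \<rho>: "\<rho> > 0" using e R by (simp add: \<rho>_def)
  define v where "v y = u (a + \<rho> *\<^sub>R y)" for y
  define D where "D y = \<rho> *\<^sub>R jacobian u (at (a + \<rho> *\<^sub>R y))" for y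
  have mem: "a + \<rho> *\<^sub>R y \<in> \<Omega>" if "y \<in> torus" for y
  proof -
    have "norm y < R" using R(2) that by auto
    then have "\<rho> * norm y < e" using R(1) e(1) by (simp add: \<rho>_def field_simps)
    then have "a + \<rho> *\<^sub>R y \<in> ball a e" using \<rho> by (simp add: dist_norm)
    then show ?thesis using e(2) by blast
  qed
  have der: "(v has_derivative (\<lambda>h. D y *v h)) (at y)" if "y \<in> torus" for y
  proof -
    have "((\<lambda>y. a + \<rho> *\<^sub>R y) has_derivative (\<lambda>h. \<rho> *\<^sub>R h)) (at y)"
      by (auto intro!: derivative_eq_intros)
    moreover have "(u has_derivative (\<lambda>h. jacobian u (at (a + \<rho> *\<^sub>R y)) *v h)) (at (a + \<rho> *\<^sub>R y))"
      using assms(4)[OF mem[OF that]] jacobian_works by blast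
    ultimately have "((\<lambda>y. u (a + \<rho> *\<^sub>R y)) has_derivative (\<lambda>h. jacobian u (at (a + \<rho> *\<^sub>R y)) *v (\<rho> *\<^sub>R h))) (at y)"
      by (rule has_derivative_compose)
    then show ?thesis
      by (simp add: v_def[abs_def] D_def matrix_vector_mult_scaleR scaleR_matrix_vector_assoc)
  qed
  have DL: "D y \<in> L" if "y \<in> torus" for y
    unfolding D_def using assms(2) assms(5)[OF mem[OF that]] by (simp add: subspace_mul)
  obtain r c where r: "r > 0" and c: "\<And>y. y \<in> ball 0 r \<Longrightarrow> ((\<lambda>\<alpha>. multi_power y \<alpha> *\<^sub>R c \<alpha>) has_sum v y) UNIV"
    using torus_power_series[OF assms(2,3) der DL] by blast
  \<comment> \<open>Substituting y = (x - a) / \<rho> multiplies the monomial of index \<alpha> by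
    \<rho> to the power minus the order of \<alpha>; this factor is moved into the
    coefficient.\<close>
  have "((\<lambda>\<alpha>. multi_power (x - a) \<alpha> *\<^sub>R ((1 / \<rho>) ^ sum \<alpha> UNIV *\<^sub>R c \<alpha>)) has_sum u x) UNIV"
    if "x \<in> ball a (\<rho> * r)" for x
  proof -
    let ?y = "(1 / \<rho>) *\<^sub>R (x - a)"
    have "norm (x - a) < \<rho> * r" using that by (simp add: dist_norm norm_minus_commute)
    then have "norm (x - a) / \<rho> < r" using \<rho> by (simp add: pos_divide_less_eq mult.commute)
    moreover have "norm ?y = norm (x - a) / \<rho>" by (subst norm_scaleR) (use \<rho> in simp)
    ultimately have "norm ?y < r" by (rule ord_eq_less_trans[rotated])
    then have "?y \<in> ball 0 r" by (simp only: mem_ball_0)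
    moreover have "v ?y = u x" using \<rho> by (simp add: v_def)
    moreover have "multi_power ?y \<alpha> = multi_power (x - a) \<alpha> * (1 / \<rho>) ^ sum \<alpha> UNIV" for \<alpha>
      unfolding multi_power_def power_sum prod.distrib[symmetric]
      by (intro prod.cong refl) (simp add: power_divide power_mult_distrib)
    ultimately show ?thesis using c[of ?y] by simp
  qed
  then show "\<exists>r>0. \<exists>c :: ('n \<Rightarrow> nat) \<Rightarrow> real ^ 'm. \<forall>x\<in>ball a r. ((\<lambda>\<alpha>. multi_power (x - a) \<alpha> *\<^sub>R c \<alpha>) has_sum u x) UNIV"
    by (intro exI[of _ "\<rho> * r"] exI[of _ "\<lambda>\<alpha>. (1 / \<rho>) ^ sum \<alpha> UNIV *\<^sub>R c \<alpha>"] conjI ballI mult_pos_pos \<rho> r)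
qed

end
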